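(* Let $p\in\mathbb N$ with $(p+1)\alpha>1$, let $\mathbf X$ be an $\alpha$-Hölder rough path over $\mathbb R^d$ on $[0,T]$, let $\mathbf Z=(Z,Z')\in\mathcal D^\alpha_{\mathbf X}([0,T];\mathbb R^m)$, and let $F_a\in C_b^{p+1}(\mathbb R^e;\mathbb R^e)$ for $a\in\mathcal A=\{1,\dots,m\}$. Let $(Y,Y')\in\mathcal D^\alpha_{\mathbf X}([0,T];\mathbb R^e)$ be the exact solution of $dY_t=\sum_{a=1}^mF_a(Y_t)\,d\mathbf Z^a_t$, $Y_0=y_0$. Consider a controlled Runge-Kutta method with coefficients $\mathcal Z^{(a)}_{u,v}\in\mathbb R^{q\times q}$, $\zeta^{(a)}_{u,v}\in\mathbb R^q$ such that, for some $C_{\mathrm{CRK}}>0$, $\|\mathcal Z^{(a)}_{u,v}\|_\infty+|\zeta^{(a)}_{u,v}|_\infty\le C_{\mathrm{CRK}}|v-u|^\alpha$ for all $[u,v]\subset[0,T]$ and $a\in\mathcal A$, and such that its stage system is solvable on each one-step interval. Suppose that the method has tree order $p$, i.e. $a_{u,v}(\tau)=Z^\tau_{u,v}$ for all $\tau\in\mathcal T_{\le p}$ and $0\le u\le v\le T$. Then there exists a constant $C_{p,Y,T}>0$ such that, for every sufficiently small interval $[u,v]\subset[0,T]$ (i.e. for all $[u,v]$ with $v-u\le\delta$ for some $\delta>0$), the one-step approximation with initial value $Y_u$ satisfies $$|Y_v-\Psi^{\mathrm{CRK}}_{u,v}(Y_u)|\le C_{p,Y,T}|v-u|^{(p+1)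\alpha}.$$
   Context: Fix $\alpha\in(1/3,1/2]$, $T>0$ and $d,m,e,q\in\mathbb N=\{1,2,\dots\}$. Write $X_{s,t}:=X_t-X_s$. $C_b^k$ denotes $k$ times continuously differentiable maps with all derivatives of orders $0,\dots,k$ bounded. Rough and controlled paths. An $\alpha$-Hölder rough path over $\mathbb R^d$ is a pair $\mathbf X=(X,\mathbb X)$ with $X\in C^\alpha([0,T];\mathbb R^d)$ and $\mathbb X:\{0\le s\le t\le T\}\to\mathbb R^{d\times d}$ with $\sup_{s<t}|\mathbb X_{s,t}|/|t-s|^{2\alpha}<\infty$ and $\mathbb X_{s,t}=\mathbb X_{s,u}+\mathbb X_{u,t}+X_{s,u}\otimes X_{u,t}$. $\mathcal D^\alpha_{\mathbf X}([0,T];V)$ is the set of pairs $(Y,Y')$ ($\mathbf X$-controlled rough paths) with $Y\in C^\alpha([0,T];V)$, $Y'\in C^\alpha([0,T];\mathcal L(\mathbb R^d,V))$ (Gubinelli derivative) and $R^Y_{s,t}:=Y_{s,t}-Y'_sX_{s,t}$ satisfying $\sup_{s<t}|R^Y_{s,t}|/|t-s|^{2\alpha}<\infty$. Controlled rough integral. For controlled $(H,H')$ with values in $\mathcal L(\mathbb R^k,V)$ and controlled $(W,W')$ with values in $\mathbb R^k$, $\int_s^tH_r\,d\mathbf W_r:=\lim_{|P|\to0}\sum_{[u,v]\in P}(H_uW_{u,v}+(H'_u\diamond W'_u)\mathbb X_{u,v})$ over partitions $P$ of $[s,t]$ (the limit exists), where $(A\diamond B)(x\otimes\tilde x):=A(x)(B\tilde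 x)$. The indefinite integral is controlled with Gubinelli derivative $H_tW'_t$. Solution. With $F(y)e_a=F_a(y)$, a solution is $(Y,Y')\in\mathcal D^\alpha_{\mathbf X}([0,T];\mathbb R^e)$ with $Y_t=y_0+\int_0^tF(Y_r)\,d\mathbf Z_r$ and $Y'_t=F(Y_t)Z'_t$, where $F(Y)$ is controlled with Gubinelli derivative $DF(Y_t)Y'_t$. Trees. $\mathcal T$ is the set of (nonplanar) rooted trees with vertices decorated by $\mathcal A$; $\mathbf 1$ is the empty tree/forest. $[\tau_1\cdots\tau_n]_a$ is the tree obtained by joining the roots of $\tau_1,\dots,\tau_n$ to a new root decorated by $a$; $\bullet_a=[\mathbf 1]_a$. $|\tau|$ is the number of vertices; $\mathcal T_{\le p}=\{\tau\in\mathcal T:|\tau|\le p\}$. Controlled coefficients. For fixed $s$ and $t\in[s,T]$: $Z^{\mathbf 1}_{s,t}:=1$; for forests $Z^{\tau_1\cdots\tau_n}_{s,t}:=\prod_jZ^{\tau_j}_{s,t}$; $Z^{[\eta]_a}_{s,t}:=\int_s^tZ^\eta_{s,u}\,d\mathbf Z^a_u$ (controlled rough integral), with Gubinelli derivatives $(Z^{\mathbf 1}_{s,\cdot})'=0$, $(Z^{\tau_1\cdots\tau_n}_{s,\cdot})'_r=\sum_j(Z^{\tau_j}_{s,\cdot})'_r\prod_{i\ne j}Z^{\tau_i}_{s,r}$, $(Z^{[\eta]_a}_{s,\cdot})'_r=Z^\eta_{s,r}(Z^a)'_r$. Controlled Runge-Kutta method. Prescribed coefficients $\mathcal Z^{(a)}_{u,v},\zeta^{(a)}_{u,v}$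 for each $[u,v]\subset[0,T]$, $a\in\mathcal A$ (which may depend on the values $Z^\eta_{u,v}$ over forests $\eta$ with at most $p$ vertices). Stages: $Y_i^{u,v}(y)=y+\sum_{a}\sum_{j=1}^q(\mathcal Z^{(a)}_{u,v})_{i,j}F_a(Y_j^{u,v}(y))$, $i=1,\dots,q$ (a solution, assumed to exist). One-step map: $\Psi^{\mathrm{CRK}}_{u,v}(y):=y+\sum_a\sum_{i=1}^q(\zeta^{(a)}_{u,v})_iF_a(Y_i^{u,v}(y))$. $|\cdot|_\infty$ is the max norm on $\mathbb R^q$, $\|\cdot\|_\infty$ the induced matrix norm. Numerical tree coefficients. With $\odot$ the componentwise product on $\mathbb R^q$ and $\mathbf 1_q=(1,\dots,1)^\top$ (the empty product): $\Phi_{u,v}(\mathbf 1)=\mathbf 1_q$, $a_{u,v}(\mathbf 1)=1$, and for $\tau=[\tau_1\cdots\tau_n]_a$, $\Phi_{u,v}(\tau)=\mathcal Z^{(a)}_{u,v}(\Phi_{u,v}(\tau_1)\odot\cdots\odot\Phi_{u,v}(\tau_n))$ and $a_{u,v}(\tau)=\langle\zeta^{(a)}_{u,v},\Phi_{u,v}(\tau_1)\odot\cdots\odot\Phi_{u,v}(\tau_n)\rangle_{\mathbb R^q}$, with $\Phi_{u,v}(\bullet_a)=\mathcal Z^{(a)}_{u,v}\mathbf 1_q$, $a_{u,v}(\bullet_a)=\langle\zeta^{(a)}_{u,v},\mathbf 1_q\rangle$. *)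

theory Defs
  imports "HOL-Analysis.Analysis" "HOL-Library.Multiset"
begin

section \<open>Rough paths and controlled rough paths\<close>

text \<open>Paths on \<open>[0,T]\<close> are total functions on \<^typ>\<open>real\<close>; only their values on \<open>[0,T]\<close> are ever
  constrained. The space of linear maps from \<open>\<real>\<^sup>d\<close> to \<open>V\<close> is \<^typ>\<open>(real^'d) \<Rightarrow>\<^sub>L 'v::real_normed_vector\<close>, and
  the tensor \<open>\<Sum>\<^sub>i\<^sub>j M\<^sub>i\<^sub>j e\<^sub>i \<otimes> e\<^sub>j\<close> is the matrix \<open>M\<close> with entries \<open>M $ i $ j\<close>.\<close>

definition holder_path :: "real \<Rightarrow> real \<Rightarrow> (real \<Rightarrow> 'v::real_normed_vector) \<Rightarrow> bool" where
  "holder_path \<alpha> T X \<longleftrightarrow>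
     (\<exists>C. \<forall>s t. 0 \<le> s \<and> s < t \<and> t \<le> T \<longrightarrow> norm (X t - X s) \<le> C * (t - s) powr \<alpha>)"

definition tensor :: "real^'d \<Rightarrow> real^'d \<Rightarrow> real^'d^'d" where
  "tensor x y = (\<chi> i j. x $ i * y $ j)"

definition rough_path ::
  "real \<Rightarrow> real \<Rightarrow> (real \<Rightarrow> real^'d) \<Rightarrow> (real \<Rightarrow> real \<Rightarrow> real^'d^'d) \<Rightarrow> bool" where
  "rough_path \<alpha> T X XX \<longleftrightarrow>
     holder_path \<alpha> T X \<and>
     (\<exists>C. \<forall>s t. 0 \<le> s \<and> s < t \<and> t \<le> T \<longrightarrow> norm (XX s t) \<le> C * (t - s) powr (2 * \<alpha>)) \<and>
     (\<forall>s u t. 0 \<le> s \<and> s \<le> u \<and> u \<le> t \<and> t \<le> T \<longrightarrow>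
        XX s t = XX s u + XX u t + tensor (X u - X s) (X t - X u))"

definition controlled ::
  "real \<Rightarrow> real \<Rightarrow> (real \<Rightarrow> real^'d) \<Rightarrow>
   (real \<Rightarrow> 'v::real_normed_vector) \<Rightarrow> (real \<Rightarrow> (real^'d) \<Rightarrow>\<^sub>L 'v) \<Rightarrow> bool" where
  "controlled \<alpha> T X Y Y' \<longleftrightarrow>
     holder_path \<alpha> T Y \<and> holder_path \<alpha> T Y' \<and>
     (\<exists>C. \<forall>s t. 0 \<le> s \<and> s < t \<and> t \<le> T \<longrightarrow>
        norm (Y t - Y s - blinfun_apply (Y' s) (X t - X s)) \<le> C * (t - s) powr (2 * \<alpha>))"

section \<open>The controlled rough integral\<close>

text \<open>A partition \<open>s = \<pi> 0 < \<dots> < \<pi> n = t\<close> is the pair \<open>(n, \<pi>)\<close>.\<close>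

definition partitions :: "real \<Rightarrow> real \<Rightarrow> (nat \<times> (nat \<Rightarrow> real)) set" where
  "partitions s t = {(n, \<pi>). \<pi> 0 = s \<and> \<pi> n = t \<and> (\<forall>i<n. \<pi> i < \<pi> (Suc i))}"

text \<open>Limits along this filter are limits as the mesh size tends to 0.\<close>

definition mesh_filter :: "real \<Rightarrow> real \<Rightarrow> (nat \<times> (nat \<Rightarrow> real)) filter" where
  "mesh_filter s t =
     (INF \<delta>\<in>{0<..}. principal {P \<in> partitions s t. \<forall>i<fst P. snd P (Suc i) - snd P i < \<delta>})"

text \<open>Linear extension of \<open>x \<otimes> y \<mapsto> A x (B y)\<close>.\<close>

definition diamond ::
  "((real^'d) \<Rightarrow>\<^sub>L 'w::real_normed_vector \<Rightarrow>\<^sub>L 'v::real_normed_vector) \<Rightarrow> ((real^'d) \<Rightarrow>\<^sub>L 'w) \<Rightarrow>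
   real^'d^'d \<Rightarrow> 'v" where
  "diamond A B M = (\<Sum>i\<in>UNIV. \<Sum>j\<in>UNIV.
     M $ i $ j *\<^sub>R blinfun_apply (blinfun_apply A (axis i 1)) (blinfun_apply B (axis j 1)))"

definition rough_sum ::
  "(real \<Rightarrow> real \<Rightarrow> real^'d^'d) \<Rightarrow>
   (real \<Rightarrow> 'w::real_normed_vector \<Rightarrow>\<^sub>L 'v::real_normed_vector) \<Rightarrow> (real \<Rightarrow> (real^'d) \<Rightarrow>\<^sub>L 'w \<Rightarrow>\<^sub>L 'v) \<Rightarrow>
   (real \<Rightarrow> 'w) \<Rightarrow> (real \<Rightarrow> (real^'d) \<Rightarrow>\<^sub>L 'w) \<Rightarrow> nat \<times> (nat \<Rightarrow> real) \<Rightarrow> 'v" where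
  "rough_sum XX H H' W W' P = (\<Sum>i<fst P. let u = snd P i; v = snd P (Suc i) in
     blinfun_apply (H u) (W v - W u) + diamond (H' u) (W' u) (XX u v))"

definition has_rough_integral ::
  "(real \<Rightarrow> real \<Rightarrow> real^'d^'d) \<Rightarrow>
   (real \<Rightarrow> 'w::real_normed_vector \<Rightarrow>\<^sub>L 'v::real_normed_vector) \<Rightarrow> (real \<Rightarrow> (real^'d) \<Rightarrow>\<^sub>L 'w \<Rightarrow>\<^sub>L 'v) \<Rightarrow>
   (real \<Rightarrow> 'w) \<Rightarrow> (real \<Rightarrow> (real^'d) \<Rightarrow>\<^sub>L 'w) \<Rightarrow> real \<Rightarrow> real \<Rightarrow> 'v \<Rightarrow> bool" where
  "has_rough_integral XX H H' W W' s t I \<longleftrightarrow>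
     (rough_sum XX H H' W W' \<longlongrightarrow> I) (mesh_filter s t)"

definition rough_integral ::
  "(real \<Rightarrow> real \<Rightarrow> real^'d^'d) \<Rightarrow>
   (real \<Rightarrow> 'w::real_normed_vector \<Rightarrow>\<^sub>L 'v::real_normed_vector) \<Rightarrow> (real \<Rightarrow> (real^'d) \<Rightarrow>\<^sub>L 'w \<Rightarrow>\<^sub>L 'v) \<Rightarrow>
   (real \<Rightarrow> 'w) \<Rightarrow> (real \<Rightarrow> (real^'d) \<Rightarrow>\<^sub>L 'w) \<Rightarrow> real \<Rightarrow> real \<Rightarrow> 'v" where
  "rough_integral XX H H' W W' s t = Lim (mesh_filter s t) (rough_sum XX H H' W W')"

lemma eventually_mesh_filter:
  "eventually Q (mesh_filter s t) \<longleftrightarrow>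
     (\<exists>\<delta>>0. \<forall>P\<in>partitions s t. (\<forall>i<fst P. snd P (Suc i) - snd P i < \<delta>) \<longrightarrow> Q P)"
  unfolding mesh_filter_def
proof (subst eventually_INF_base)
  fix a b :: real
  assume "a \<in> {0<..}" "b \<in> {0<..}"
  then show "\<exists>x\<in>{0<..}. principal {P \<in> partitions s t. \<forall>i<fst P. snd P (Suc i) - snd P i < x}
      \<le> inf (principal {P \<in> partitions s t. \<forall>i<fst P. snd P (Suc i) - snd P i < a})
            (principal {P \<in> partitions s t. \<forall>i<fst P. snd P (Suc i) - snd P i < b})"
    by (intro bexI[of _ "min a b"]) auto
qed (auto simp: eventually_principal Bex_def Ball_def)

lemma mesh_filter_neq_bot:
  assumes "s \<le> t"
  shows "mesh_filter s t \<noteq> bot"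
proof
  assume "mesh_filter s t = bot"
  then have "eventually (\<lambda>_. False) (mesh_filter s t)" by simp
  then obtain \<delta> where \<delta>: "\<delta> > 0"
    and no: "\<And>P. P \<in> partitions s t \<Longrightarrow> \<not> (\<forall>i<fst P. snd P (Suc i) - snd P i < \<delta>)"
    unfolding eventually_mesh_filter by blast
  show False
  proof (cases "s = t")
    case True
    then have "(0, \<lambda>_. s) \<in> partitions s t" by (simp add: partitions_def)
    with no show False by fastforce
  next
    case False
    then have st: "t - s > 0" using assms by simp
    obtain n :: nat where n: "(t - s) / \<delta> < real n" using reals_Archimedean2 by blast
    have "0 < (t - s) / \<delta>" using st \<delta> by simp
    with n have n0: "real n > 0" by linarith
    define \<pi> where "\<pi> i = s + real i * ((t - s) / real n)" for i
    have step: "\<pi> (Suc i) - \<pi> i = (t - s) / real n" for i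
      by (simp add: \<pi>_def distrib_right add_divide_distrib)
    have "(t - s) / real n > 0" using st n0 by simp
    then have "\<pi> i < \<pi> (Suc i)" for i using step[of i] by linarith
    then have "(n, \<pi>) \<in> partitions s t" using n0 by (simp add: partitions_def \<pi>_def)
    moreover have "(t - s) / real n < \<delta>" using n n0 \<delta> by (simp add: field_simps)
    ultimately show False using no step by fastforce
  qed
qed

lemma rough_integral_eqI:
  "s \<le> t \<Longrightarrow> has_rough_integral XX H H' W W' s t I \<Longrightarrow> rough_integral XX H H' W W' s t = I"
  unfolding has_rough_integral_def rough_integral_def
  by (intro tendsto_Lim) (auto simp: mesh_filter_neq_bot)

section \<open>Vector fields and solutions\<close>

text \<open>Bounded \<open>k\<close> times continuously differentiable maps. The recursion is over directional
  derivatives \<open>x \<mapsto> Df(x) v\<close>, since the type of the \<open>k\<close>-th Frechet derivative depends on \<open>k\<close>.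
  In finite dimensions the \<open>k\<close>-th derivative is continuous and bounded
  iff all \<open>x \<mapsto> D\<^sup>kf(x)[v\<^sub>1,\<dots>,v\<^sub>k]\<close> are.\<close>

primrec Cb :: "nat \<Rightarrow> ('a::euclidean_space \<Rightarrow> 'b::euclidean_space) \<Rightarrow> bool" where
  "Cb 0 f \<longleftrightarrow> continuous_on UNIV f \<and> bounded (range f)"
| "Cb (Suc k) f \<longleftrightarrow> bounded (range f) \<and> (\<forall>x. f differentiable (at x)) \<and>
     (\<forall>v. Cb k (\<lambda>x. frechet_derivative f (at x) v))"

text \<open>The map \<open>F\<close> with \<open>F(y) e\<^sub>a = F\<^sub>a(y)\<close>.\<close>

definition joint_field ::
  "('m::finite \<Rightarrow> real^'e \<Rightarrow> real^'e) \<Rightarrow> real^'e \<Rightarrow> (real^'m) \<Rightarrow>\<^sub>L (real^'e)" where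
  "joint_field F y = Blinfun (\<lambda>z. \<Sum>a\<in>UNIV. z $ a *\<^sub>R F a y)"

definition rde_solution ::
  "real \<Rightarrow> real \<Rightarrow> (real \<Rightarrow> real^'d) \<Rightarrow> (real \<Rightarrow> real \<Rightarrow> real^'d^'d) \<Rightarrow>
   (real \<Rightarrow> real^'m) \<Rightarrow> (real \<Rightarrow> (real^'d) \<Rightarrow>\<^sub>L (real^'m)) \<Rightarrow>
   ('m \<Rightarrow> real^'e \<Rightarrow> real^'e) \<Rightarrow> real^'e \<Rightarrow>
   (real \<Rightarrow> real^'e) \<Rightarrow> (real \<Rightarrow> (real^'d) \<Rightarrow>\<^sub>L (real^'e)) \<Rightarrow> bool" where
  "rde_solution \<alpha> T X XX Z Z' F y\<^sub>0 Y Y' \<longleftrightarrow>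
     controlled \<alpha> T X Y Y' \<and>
     (\<forall>t\<in>{0..T}.
        has_rough_integral XX
          (\<lambda>r. joint_field F (Y r))
          (\<lambda>r. Blinfun (frechet_derivative (joint_field F) (at (Y r))) o\<^sub>L Y' r)
          Z Z' 0 t (Y t - y\<^sub>0) \<and>
        Y' t = joint_field F (Y t) o\<^sub>L Z' t)"

section \<open>Trees and controlled coefficients\<close>

text \<open>Nonempty nonplanar rooted trees: \<open>Node a \<eta>\<close> is \<open>[\<eta>]\<^sub>a\<close>, where the forest \<open>\<eta>\<close> is the
  multiset of the subtrees at the root. The empty forest is \<open>{#}\<close>, so \<open>\<bullet>\<^sub>a\<close> is \<open>Node a {#}\<close>.\<close>

datatype 'a rtree = Node 'a "'a rtree multiset"

primrec tree_size :: "'a rtree \<Rightarrow> nat" where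
  "tree_size (Node a \<eta>) = Suc (sum_mset (image_mset tree_size \<eta>))"

text \<open>Product of finitely many scalar paths, each paired with its Gubinelli derivative;
  the factors are counted with multiplicity.\<close>

definition prod_path :: "((real \<Rightarrow> real) \<times> (real \<Rightarrow> (real^'d) \<Rightarrow>\<^sub>L real)) multiset \<Rightarrow> real \<Rightarrow> real" where
  "prod_path M t = (\<Prod>p\<in>#M. fst p t)"

definition prod_path_deriv ::
  "((real \<Rightarrow> real) \<times> (real \<Rightarrow> (real^'d) \<Rightarrow>\<^sub>L real)) multiset \<Rightarrow> real \<Rightarrow> (real^'d) \<Rightarrow>\<^sub>L real" where
  "prod_path_deriv M t = (\<Sum>p\<in>#M. prod_path (M - {#p#}) t *\<^sub>R snd p t)"

text \<open>The pair \<open>(Z\<^sup>\<tau>\<^bsub>s,\<cdot>\<^esub>, (Z\<^sup>\<tau>\<^bsub>s,\<cdot>\<^esub>)')\<close>. A scalar \<open>c\<close> is identified with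
  \<^term>\<open>blinfun_scaleR_right c :: real \<Rightarrow>\<^sub>L real\<close>, so that scalar paths can be integrated against
  the components of \<open>Z\<close>.\<close>

primrec ctrl_coeff_pair ::
  "(real \<Rightarrow> real \<Rightarrow> real^'d^'d) \<Rightarrow> (real \<Rightarrow> real^'m) \<Rightarrow> (real \<Rightarrow> (real^'d) \<Rightarrow>\<^sub>L (real^'m)) \<Rightarrow>
   real \<Rightarrow> 'm rtree \<Rightarrow> (real \<Rightarrow> real) \<times> (real \<Rightarrow> (real^'d) \<Rightarrow>\<^sub>L real)" where
  "ctrl_coeff_pair XX Z Z' s (Node a \<eta>) =
     (let M = image_mset (ctrl_coeff_pair XX Z Z' s) \<eta>;
          Za' = (\<lambda>r. blinfun_inner_left (axis a 1) o\<^sub>L Z' r)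
      in (\<lambda>t. rough_integral XX
                (\<lambda>u. blinfun_scaleR_right (prod_path M u))
                (\<lambda>u. Blinfun (\<lambda>x. blinfun_scaleR_right (blinfun_apply (prod_path_deriv M u) x)))
                (\<lambda>u. Z u $ a) Za' s t,
          \<lambda>r. prod_path M r *\<^sub>R Za' r))"

definition ctrl_coeff ::
  "(real \<Rightarrow> real \<Rightarrow> real^'d^'d) \<Rightarrow> (real \<Rightarrow> real^'m) \<Rightarrow> (real \<Rightarrow> (real^'d) \<Rightarrow>\<^sub>L (real^'m)) \<Rightarrow>
   real \<Rightarrow> real \<Rightarrow> 'm rtree \<Rightarrow> real" where
  "ctrl_coeff XX Z Z' s t \<tau> = fst (ctrl_coeff_pair XX Z Z' s \<tau>) t"

section \<open>Controlled Runge-Kutta methods\<close>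

text \<open>In the next four constants \<open>A\<close> and \<open>b\<close> are the coefficients
  of one step, that is, for one fixed interval \<open>[u,v]\<close>.\<close>

definition crk_stages ::
  "('m::finite \<Rightarrow> real^'q^'q) \<Rightarrow> ('m \<Rightarrow> real^'e \<Rightarrow> real^'e) \<Rightarrow> real^'e \<Rightarrow> ('q \<Rightarrow> real^'e) \<Rightarrow> bool" where
  "crk_stages A F y k \<longleftrightarrow> (\<forall>i. k i = y + (\<Sum>a\<in>UNIV. \<Sum>j\<in>UNIV. (A a $ i $ j) *\<^sub>R F a (k j)))"

definition crk_step ::
  "('m::finite \<Rightarrow> real^'q) \<Rightarrow> ('m \<Rightarrow> real^'e \<Rightarrow> real^'e) \<Rightarrow> real^'e \<Rightarrow> ('q \<Rightarrow> real^'e) \<Rightarrow> real^'e" where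
  "crk_step b F y k = y + (\<Sum>a\<in>UNIV. \<Sum>i\<in>UNIV. (b a $ i) *\<^sub>R F a (k i))"

primrec stage_coeff :: "('m \<Rightarrow> real^'q^'q) \<Rightarrow> 'm rtree \<Rightarrow> real^'q" where
  "stage_coeff A (Node a \<eta>) = A a *v (\<chi> i. \<Prod>w\<in>#image_mset (stage_coeff A) \<eta>. w $ i)"

fun num_coeff :: "('m \<Rightarrow> real^'q^'q) \<Rightarrow> ('m \<Rightarrow> real^'q) \<Rightarrow> 'm rtree \<Rightarrow> real" where
  "num_coeff A b (Node a \<eta>) = b a \<bullet> (\<chi> i. \<Prod>w\<in>#image_mset (stage_coeff A) \<eta>. w $ i)"

text \<open>The matrix norm induced by the max norm \<^const>\<open>infnorm\<close>.\<close>

definition matrix_infnorm :: "real^'q^'q \<Rightarrow> real" where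
  "matrix_infnorm A = (SUP x\<in>{x. infnorm x \<le> 1}. infnorm (A *v x))"

text \<open>The empty tree is omitted: its order condition is \<open>1 = 1\<close>.\<close>

definition tree_order ::
  "nat \<Rightarrow> real \<Rightarrow> (real \<Rightarrow> real \<Rightarrow> real^'d^'d) \<Rightarrow>
   (real \<Rightarrow> real^'m) \<Rightarrow> (real \<Rightarrow> (real^'d) \<Rightarrow>\<^sub>L (real^'m)) \<Rightarrow>
   (real \<Rightarrow> real \<Rightarrow> 'm \<Rightarrow> real^'q^'q) \<Rightarrow> (real \<Rightarrow> real \<Rightarrow> 'm \<Rightarrow> real^'q) \<Rightarrow> bool" where
  "tree_order p T XX Z Z' A b \<longleftrightarrow>
     (\<forall>\<tau> u v. tree_size \<tau> \<le> p \<and> 0 \<le> u \<and> u \<le> v \<and> v \<le> T \<longrightarrow>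
        num_coeff (A u v) (b u v) \<tau> = ctrl_coeff XX Z Z' u v \<tau>)"

end

theory Submission
  imports Defs
begin

text \<open>
  The exact increment and the method solve the same equation. Fix an interval \<open>[u,v]\<close>, put
  \<open>\<lambda> = (v-u)\<^sup>\<alpha>\<close> and let \<open>\<delta>\<close> stand either for the path \<open>t \<mapsto> Y\<^sub>t - Y\<^sub>u\<close> or for the stage vector of
  the method minus \<open>Y\<^sub>u\<close>. In both cases \<open>\<delta> = \<Sum>\<^sub>a I\<^sub>a(F\<^sub>a(Y\<^sub>u + \<delta>))\<close>, where \<open>I\<^sub>a\<close> is rough integration
  against \<open>Z\<^sup>a\<close> in the first case and multiplication with the coefficient matrix in the second;
  the update \<open>\<Psi>(Y\<^sub>u)\<close> is one more stage whose row of coefficients is \<open>\<zeta>\<close>. The two cases are the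
  components of one equation in a product algebra of trajectories (\<open>displacement_fixed_point\<close>), and
  both sides of an order condition are the two components of one element of that algebra, a tree
  built from \<open>I\<^sub>a\<close> and products (\<open>tree_val_components\<close>).

  On trajectories there is a size, adapted to \<open>[u,v]\<close>, that is submultiplicative up to a constant
  (\<open>ctrl_bound_mult\<close>) and for which every \<open>I\<^sub>a\<close> gains a factor \<open>\<lambda>\<close> (\<open>ctrl_bound_integrate\<close>). For rough
  integration this is the sewing lemma, and \<open>\<alpha> > 1/3\<close> makes the defect exponent \<open>3\<alpha>\<close> exceed one.
  The displacement itself has size of order \<open>\<lambda>\<close>, so a product of \<open>n\<close> of its components has size of
  order \<open>\<lambda>\<^sup>n\<close>.

  As \<open>F\<^sub>a\<close> has \<open>p+1\<close> bounded derivatives, \<open>F\<^sub>a(Y\<^sub>u + \<delta>)\<close> is a polynomial of degree less than \<open>p\<close> in \<open>\<delta>\<close>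
  with coefficients depending only on \<open>F\<close> and \<open>Y\<^sub>u\<close>, up to a trajectory of size of order \<open>\<lambda>\<^sup>p\<close>
  (\<open>taylor_hadamard\<close>, \<open>field_along_taylor\<close>). Drop that remainder and iterate the resulting polynomial
  equation from zero: each iteration gains a factor \<open>\<lambda>\<close>, so after \<open>p\<close> of them the error is of order
  \<open>\<lambda>\<^sup>p\<^sup>+\<^sup>1\<close>. The iterates are finite linear combinations of trees whose coefficients are the same for
  the path component and for the stage component. In the difference of \<open>Y\<^sub>v\<close> and \<open>\<Psi>(Y\<^sub>u)\<close> the trees
  with at most \<open>p\<close> vertices cancel by the order conditions, and a tree with more vertices is itself of
  order \<open>\<lambda>\<^sup>p\<^sup>+\<^sup>1\<close> (\<open>fixed_point_defect\<close>). Only the existence of a common expansion enters, so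
  elementary differentials and symmetry factors never have to be computed.
\<close>

section \<open>Sewing\<close>

lemma partition_points:
  assumes "(n, \<pi>) \<in> partitions s t" "i \<le> n"
  shows "s \<le> \<pi> i" "\<pi> i \<le> t"
proof -
  have \<pi>: "\<pi> 0 = s" "\<pi> n = t" "\<And>i. i < n \<Longrightarrow> \<pi> i < \<pi> (Suc i)" using assms(1) by (auto simp: partitions_def)
  have inc: "\<pi> i \<le> \<pi> j" if "i \<le> j" "j \<le> n" for i j
    using that by (induction j rule: dec_induct) (use \<pi>(3) in \<open>auto intro: order_trans less_imp_le simp: Suc_le_eq\<close>)
  show "s \<le> \<pi> i" "\<pi> i \<le> t" using inc[of 0 i] inc[of i n] assms(2) \<pi> by auto
qed

lemma sewing_defect_diag:
  fixes \<Xi> :: "real \<Rightarrow> real \<Rightarrow> 'v::real_normed_vector"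
  assumes defect: "\<And>s r t. a \<le> s \<Longrightarrow> s \<le> r \<Longrightarrow> r \<le> t \<Longrightarrow> t \<le> b \<Longrightarrow>
      norm (\<Xi> s t - \<Xi> s r - \<Xi> r t) \<le> K * (t - s) powr \<theta>"
    and "a \<le> s" "s \<le> b"
  shows "\<Xi> s s = 0"
  using defect[of s s s] assms(2,3) by simp

text \<open>The bound does not depend on the number of points, which is what makes limits over partitions
  exist. Cut out the subinterval that starts at the last point in the left half: the pieces to its
  left and to its right have at most half the length, so their errors carry a factor \<open>2\<^sup>-\<^sup>\<theta>\<close> each. The constant
  \<open>C = 2K / (1 - 2\<^sup>1\<^sup>-\<^sup>\<theta>)\<close> is the solution of \<open>2 C 2\<^sup>-\<^sup>\<theta> + 2 K = C\<close>, where \<open>2K\<close> pays for the two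
  insertions of a point.\<close>

lemma sewing_partition_bound:
  fixes \<Xi> :: "real \<Rightarrow> real \<Rightarrow> 'v::real_normed_vector"
  assumes \<theta>: "\<theta> > 1" and K: "K \<ge> 0"
    and defect: "\<And>s r t. a \<le> s \<Longrightarrow> s \<le> r \<Longrightarrow> r \<le> t \<Longrightarrow> t \<le> b \<Longrightarrow>
      norm (\<Xi> s t - \<Xi> s r - \<Xi> r t) \<le> K * (t - s) powr \<theta>"
    and mono: "mono \<pi>" and "a \<le> \<pi> m" "\<pi> n \<le> b" "m \<le> n"
  shows "norm ((\<Sum>i\<in>{m..<n}. \<Xi> (\<pi> i) (\<pi> (Suc i))) - \<Xi> (\<pi> m) (\<pi> n))
     \<le> 2 * K / (1 - 2 powr (1 - \<theta>)) * (\<pi> n - \<pi> m) powr \<theta>"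
  using assms(5-7)
proof (induction "n - m" arbitrary: m n rule: less_induct)
  case less
  define C where "C = 2 * K / (1 - 2 powr (1 - \<theta>))"
  have c1: "2 powr (1 - \<theta>) < (1::real)" using \<theta> by (simp add: powr_less_one)
  have C: "C \<ge> 0" unfolding C_def using K c1 by simp
  have Ceq: "2 * C * (1/2) powr \<theta> + 2 * K = C"
  proof -
    have "2 * (1/2) powr \<theta> = 2 powr (1 - \<theta>)"
      by (simp add: powr_diff powr_divide)
    then have "2 * C * (1/2) powr \<theta> = C * 2 powr (1 - \<theta>)" by (metis mult.assoc mult.commute)
    moreover have "C * (1 - 2 powr (1 - \<theta>)) = 2 * K" unfolding C_def using less_imp_neq[OF c1] by (simp del: powr_eq_one_iff)
    ultimately show ?thesis by argo
  qed
  show ?case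
  proof (cases "m = n")
    case True
    then show ?thesis using sewing_defect_diag[OF defect, of a b "\<pi> m"] less by simp
  next
    case False
    then have mn: "m < n" using less by simp
    define L where "L = \<pi> n - \<pi> m"
    have mon: "i \<le> j \<Longrightarrow> \<pi> i \<le> \<pi> j" for i j using mono by (simp add: monoD)
    have L: "L \<ge> 0" unfolding L_def using mon[of m n] mn by simp
    define A where "A = {l\<in>{m..<n}. \<pi> l - \<pi> m \<le> L / 2}"
    have finA: "finite A" and "m \<in> A" unfolding A_def using mn L by auto
    define l where "l = Max A"
    have lA: "l \<in> A" unfolding l_def using finA \<open>m \<in> A\<close> by (intro Max_in) auto
    then have l: "m \<le> l" "l < n" "\<pi> l - \<pi> m \<le> L / 2" by (auto simp: A_def)
    have l2: "\<pi> n - \<pi> (Suc l) \<le> L / 2"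
    proof (cases "Suc l = n")
      case True then show ?thesis using L by simp
    next
      case False
      have "Suc l \<notin> A" using Max_ge[OF finA, of "Suc l"] unfolding l_def[symmetric] by auto
      then have "\<pi> (Suc l) - \<pi> m > L / 2" using l False unfolding A_def by auto
      then show ?thesis unfolding L_def by (simp add: field_simps)
    qed
    have half: "x powr \<theta> \<le> L powr \<theta> * (1/2) powr \<theta>" if "0 \<le> x" "x \<le> L / 2" for x
    proof -
      have "x powr \<theta> \<le> (L / 2) powr \<theta>" using that \<theta> by (intro powr_mono2) auto
      also have "\<dots> = L powr \<theta> * (1/2) powr \<theta>" using L by (simp add: powr_divide)
      finally show ?thesis .
    qed
    have e1: "norm ((\<Sum>i\<in>{m..<l}. \<Xi> (\<pi> i) (\<pi> (Suc i))) - \<Xi> (\<pi> m) (\<pi> l)) \<le> C * (L powr \<theta> * (1/2) powr \<theta>)"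
    proof -
      have "norm ((\<Sum>i\<in>{m..<l}. \<Xi> (\<pi> i) (\<pi> (Suc i))) - \<Xi> (\<pi> m) (\<pi> l)) \<le> C * (\<pi> l - \<pi> m) powr \<theta>"
        unfolding C_def using less.hyps[of l m] l less.prems mon[of l n] by auto
      also have "\<dots> \<le> C * (L powr \<theta> * (1/2) powr \<theta>)"
        using half[of "\<pi> l - \<pi> m"] l mon[of m l] C by (intro mult_left_mono) auto
      finally show ?thesis .
    qed
    have e2: "norm ((\<Sum>i\<in>{Suc l..<n}. \<Xi> (\<pi> i) (\<pi> (Suc i))) - \<Xi> (\<pi> (Suc l)) (\<pi> n)) \<le> C * (L powr \<theta> * (1/2) powr \<theta>)"
    proof -
      have "norm ((\<Sum>i\<in>{Suc l..<n}. \<Xi> (\<pi> i) (\<pi> (Suc i))) - \<Xi> (\<pi> (Suc l)) (\<pi> n)) \<le> C * (\<pi> n - \<pi> (Suc l)) powr \<theta>"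
        unfolding C_def using less.hyps[of n "Suc l"] l less.prems mon[of m "Suc l"] by auto
      also have "\<dots> \<le> C * (L powr \<theta> * (1/2) powr \<theta>)"
        using half[of "\<pi> n - \<pi> (Suc l)"] l2 l mon[of "Suc l" n] C by (intro mult_left_mono) auto
      finally show ?thesis .
    qed
    have le: "\<pi> m \<le> \<pi> l" "\<pi> l \<le> \<pi> (Suc l)" "\<pi> (Suc l) \<le> \<pi> n"
      using mon[of m l] mon[of l "Suc l"] mon[of "Suc l" n] l by auto
    have d1: "norm (\<Xi> (\<pi> m) (\<pi> n) - \<Xi> (\<pi> m) (\<pi> l) - \<Xi> (\<pi> l) (\<pi> n)) \<le> K * L powr \<theta>"
      unfolding L_def using le less.prems by (intro defect) auto
    have "norm (\<Xi> (\<pi> l) (\<pi> n) - \<Xi> (\<pi> l) (\<pi> (Suc l)) - \<Xi> (\<pi> (Suc l)) (\<pi> n)) \<le> K * (\<pi> n - \<pi> l) powr \<theta>"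
      using le less.prems by (intro defect) auto
    also have "\<dots> \<le> K * L powr \<theta>"
      unfolding L_def using le K \<theta> by (intro mult_left_mono powr_mono2) auto
    finally have d2: "norm (\<Xi> (\<pi> l) (\<pi> n) - \<Xi> (\<pi> l) (\<pi> (Suc l)) - \<Xi> (\<pi> (Suc l)) (\<pi> n)) \<le> K * L powr \<theta>" .
    have split: "(\<Sum>i\<in>{m..<n}. \<Xi> (\<pi> i) (\<pi> (Suc i))) = (\<Sum>i\<in>{m..<l}. \<Xi> (\<pi> i) (\<pi> (Suc i)))
        + \<Xi> (\<pi> l) (\<pi> (Suc l)) + (\<Sum>i\<in>{Suc l..<n}. \<Xi> (\<pi> i) (\<pi> (Suc i)))"
      using sum.atLeastLessThan_concat[of m l n "\<lambda>i. \<Xi> (\<pi> i) (\<pi> (Suc i))"] l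
      by (simp add: sum.atLeast_Suc_lessThan add.assoc)
    have tri: "norm (x + y - z - w) \<le> norm x + norm y + norm z + norm w" for x y z w :: 'v
      by (smt (verit) norm_triangle_ineq norm_triangle_ineq4)
    have "norm ((\<Sum>i\<in>{m..<n}. \<Xi> (\<pi> i) (\<pi> (Suc i))) - \<Xi> (\<pi> m) (\<pi> n))
       = norm (((\<Sum>i\<in>{m..<l}. \<Xi> (\<pi> i) (\<pi> (Suc i))) - \<Xi> (\<pi> m) (\<pi> l))
            + ((\<Sum>i\<in>{Suc l..<n}. \<Xi> (\<pi> i) (\<pi> (Suc i))) - \<Xi> (\<pi> (Suc l)) (\<pi> n))
            - (\<Xi> (\<pi> m) (\<pi> n) - \<Xi> (\<pi> m) (\<pi> l) - \<Xi> (\<pi> l) (\<pi> n))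
            - (\<Xi> (\<pi> l) (\<pi> n) - \<Xi> (\<pi> l) (\<pi> (Suc l)) - \<Xi> (\<pi> (Suc l)) (\<pi> n)))"
      unfolding split by (simp add: algebra_simps)
    also have "\<dots> \<le> C * (L powr \<theta> * (1/2) powr \<theta>) + C * (L powr \<theta> * (1/2) powr \<theta>) + K * L powr \<theta> + K * L powr \<theta>"
      using tri[THEN order_trans, OF add_mono[OF add_mono[OF add_mono[OF e1 e2] d1] d2]] .
    also have "\<dots> = (2 * C * (1/2) powr \<theta> + 2 * K) * L powr \<theta>" by (simp add: algebra_simps)
    also have "\<dots> = C * L powr \<theta>" using Ceq by simp
    finally show ?thesis unfolding C_def L_def .
  qed
qed

text \<open>The limit is taken along the dyadic subdivisions of the whole of \<open>[a,b]\<close>, cut off at \<open>t\<close>, instead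
  of along subdivisions of each \<open>[s,t]\<close>. The resulting germ is then an increment \<open>J t - J s\<close> by
  construction, and its additivity need not be proved.\<close>

theorem sewing:
  fixes \<Xi> :: "real \<Rightarrow> real \<Rightarrow> 'v::banach"
  assumes \<theta>: "\<theta> > 1" and K: "K \<ge> 0" and ab: "a \<le> b"
    and defect: "\<And>s r t. a \<le> s \<Longrightarrow> s \<le> r \<Longrightarrow> r \<le> t \<Longrightarrow> t \<le> b \<Longrightarrow>
      norm (\<Xi> s t - \<Xi> s r - \<Xi> r t) \<le> K * (t - s) powr \<theta>"
  shows "\<exists>J. \<forall>s t. a \<le> s \<and> s \<le> t \<and> t \<le> b \<longrightarrow>
     norm (J t - J s - \<Xi> s t) \<le> 2 * K / (1 - 2 powr (1 - \<theta>)) * (t - s) powr \<theta>"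
proof -
  define g where "g n k = a + real k * ((b - a) / 2 ^ n)" for n k :: nat
  define S where "S n t = (\<Sum>k<2^n. \<Xi> (min t (g n k)) (min t (g n (Suc k))))" for n t
  define \<epsilon> where "\<epsilon> n = 2 ^ n * (K * ((b - a) / 2 ^ n) powr \<theta>)" for n :: nat
  have g_step: "g n (Suc k) - g n k = (b - a) / 2 ^ n" for n k
    by (simp add: g_def ring_distribs(2) add.commute del: times_divide_eq_right)
  have g_mono: "mono (g n)" for n
    by (rule incseq_SucI) (use g_step[of n] ab in \<open>smt (verit) divide_nonneg_nonneg zero_le_power\<close>)
  have ga: "a \<le> g n k" for n k using ab by (simp add: g_def)
  have g0: "g n 0 = a" and gend: "g n (2 ^ n) = b" for n by (simp_all add: g_def)
  have diag: "\<Xi> s s = 0" if "a \<le> s" "s \<le> b" for s using sewing_defect_diag[OF defect that] .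
  have \<epsilon>_eq: "\<epsilon> n = K * (b - a) powr \<theta> * (2 powr (1 - \<theta>)) ^ n" for n
    using ab by (simp add: \<epsilon>_def powr_divide powr_realpow[symmetric] powr_powr powr_diff powr_mult_base divide_simps mult.commute)
  have c1: "2 powr (1 - \<theta>) < (1::real)" using \<theta> by (simp add: powr_less_one)
  have \<epsilon>_sum: "summable \<epsilon>" unfolding \<epsilon>_eq using c1 by (intro summable_mult summable_geometric) auto
  have cell: "K * (y - x) powr \<theta> \<le> K * ((b - a) / 2 ^ n) powr \<theta>" if "x \<le> y" "y - x \<le> (b - a) / 2 ^ n" for x y n
    using that \<theta> K by (intro mult_left_mono powr_mono2) auto
  have step: "norm (S (Suc n) t - S n t) \<le> \<epsilon> n" if t: "a \<le> t" "t \<le> b" for n t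
  proof -
    have g2: "g (Suc n) (k * 2) = g n k" for k by (simp add: g_def)
    have "S (Suc n) t = (\<Sum>k<2^n. \<Sum>i\<in>{k*2..<k*2+2}. \<Xi> (min t (g (Suc n) i)) (min t (g (Suc n) (Suc i))))"
      unfolding S_def by (subst sum.nat_group) (simp add: mult.commute)
    also have "\<dots> = (\<Sum>k<2^n. \<Xi> (min t (g n k)) (min t (g (Suc n) (Suc (k*2)))) + \<Xi> (min t (g (Suc n) (Suc (k*2)))) (min t (g n (Suc k))))"
      by (intro sum.cong refl) (simp add: g2[symmetric] numeral_2_eq_2)
    finally have "S (Suc n) t - S n t = - (\<Sum>k<2^n. \<Xi> (min t (g n k)) (min t (g n (Suc k))) - \<Xi> (min t (g n k)) (min t (g (Suc n) (Suc (k*2)))) - \<Xi> (min t (g (Suc n) (Suc (k*2)))) (min t (g n (Suc k))))"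
      unfolding S_def by (simp add: sum_subtractf sum.distrib algebra_simps)
    also have "norm \<dots> \<le> (\<Sum>k<(2::nat)^n. K * ((b - a) / 2 ^ n) powr \<theta>)"
      unfolding norm_minus_cancel
    proof (intro sum_norm_le order_trans[OF defect cell])
      fix k
      have 1: "g n k \<le> g (Suc n) (Suc (k*2))" "g (Suc n) (Suc (k*2)) \<le> g n (Suc k)"
        using monoD[OF g_mono[of "Suc n"], of "k*2" "Suc (k*2)"] monoD[OF g_mono[of "Suc n"], of "Suc (k*2)" "Suc k*2"]
        unfolding g2 by auto
      show "a \<le> min t (g n k)" "min t (g n k) \<le> min t (g (Suc n) (Suc (k*2)))"
        "min t (g (Suc n) (Suc (k*2))) \<le> min t (g n (Suc k))" "min t (g n (Suc k)) \<le> b"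
        "min t (g n k) \<le> min t (g n (Suc k))"
        using 1 t ga[of n k] by auto
      show "min t (g n (Suc k)) - min t (g n k) \<le> (b - a) / 2 ^ n"
        using g_step[of n k] 1 by (auto simp: min_def)
    qed
    finally show ?thesis by (simp add: \<epsilon>_def)
  qed
  have conv: "convergent (\<lambda>n. S n t)" if "a \<le> t" "t \<le> b" for t
  proof -
    have "summable (\<lambda>n. S (Suc n) t - S n t)"
      by (rule summable_comparison_test'[OF \<epsilon>_sum]) (use step that in auto)
    then have "convergent (\<lambda>n. S n t - S 0 t)"
      by (simp add: summable_iff_convergent sum_lessThan_telescope[of "\<lambda>n. S n t"])
    then show ?thesis by (simp only: convergent_diff_const_right_iff)
  qed
  define J where "J t = lim (\<lambda>n. S n t)" for t
  have J: "(\<lambda>n. S n t) \<longlonglongrightarrow> J t" if "a \<le> t" "t \<le> b" for t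
    unfolding J_def using conv[OF that] by (simp add: convergent_LIMSEQ_iff)
  have est: "norm (S n t - S n s - \<Xi> s t) \<le> \<epsilon> n + 2 * K / (1 - 2 powr (1 - \<theta>)) * (t - s) powr \<theta>"
    if st: "a \<le> s" "s \<le> t" "t \<le> b" for n s t
  proof -
    define q where "q k = max s (min t (g n k))" for k
    have q0: "q 0 = s" and qend: "q (2^n) = t" using st by (auto simp: q_def g0 gend)
    have "mono q" using g_mono[of n] unfolding q_def mono_def by (meson max.mono min.mono order_refl)
    then have p1: "norm ((\<Sum>k<2^n. \<Xi> (q k) (q (Suc k))) - \<Xi> s t) \<le> 2 * K / (1 - 2 powr (1 - \<theta>)) * (t - s) powr \<theta>"
      using sewing_partition_bound[OF \<theta> K defect, of a b q 0 "2^n"] st unfolding q0 qend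
      by (simp add: atLeast0LessThan)
    \<comment> \<open>Only the cell that contains \<open>s\<close> in its interior contributes, but the crude sum over all cells vanishes in the limit too.\<close>
    have "norm (S n t - S n s - (\<Sum>k<2^n. \<Xi> (q k) (q (Suc k)))) \<le> (\<Sum>k<(2::nat)^n. K * ((b - a) / 2 ^ n) powr \<theta>)"
      unfolding S_def sum_subtractf[symmetric]
    proof (intro sum_norm_le)
      fix k
      have m: "g n k \<le> g n (Suc k)" using monoD[OF g_mono] by simp
      have nn: "0 \<le> K * ((b - a) / 2 ^ n) powr \<theta>" using K by simp
      consider "g n (Suc k) \<le> s" | "s \<le> g n k" | "g n k < s" "s < g n (Suc k)" by linarith
      then show "norm (\<Xi> (min t (g n k)) (min t (g n (Suc k))) - \<Xi> (min s (g n k)) (min s (g n (Suc k))) - \<Xi> (q k) (q (Suc k)))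
         \<le> K * ((b - a) / 2 ^ n) powr \<theta>"
      proof cases
        case 1
        then have "q k = s" "q (Suc k) = s" "min t (g n k) = g n k" "min s (g n k) = g n k"
          "min t (g n (Suc k)) = g n (Suc k)" "min s (g n (Suc k)) = g n (Suc k)"
          using m st by (auto simp: q_def)
        then show ?thesis using diag[of s] st nn by simp
      next
        case 2
        then have "q k = min t (g n k)" "q (Suc k) = min t (g n (Suc k))" "min s (g n k) = s" "min s (g n (Suc k)) = s"
          using m st by (auto simp: q_def)
        then show ?thesis using diag[of s] st nn by simp
      next
        case 3
        then have eq: "min t (g n k) = g n k" "min s (g n k) = g n k" "min s (g n (Suc k)) = s" "q k = s"
          "q (Suc k) = min t (g n (Suc k))" using st by (auto simp: q_def)
        show ?thesis unfolding eq
          by (intro order_trans[OF defect cell]) (use ga[of n k] g_step[of n k] 3 st in auto)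
      qed
    qed
    then have p2: "norm (S n t - S n s - (\<Sum>k<2^n. \<Xi> (q k) (q (Suc k)))) \<le> \<epsilon> n" by (simp add: \<epsilon>_def)
    have eq: "S n t - S n s - \<Xi> s t = (S n t - S n s - (\<Sum>k<2^n. \<Xi> (q k) (q (Suc k)))) + ((\<Sum>k<2^n. \<Xi> (q k) (q (Suc k))) - \<Xi> s t)"
      by simp
    show ?thesis unfolding eq by (rule norm_triangle_mono[OF p2 p1])
  qed
  have "norm (J t - J s - \<Xi> s t) \<le> 2 * K / (1 - 2 powr (1 - \<theta>)) * (t - s) powr \<theta>"
    if st: "a \<le> s" "s \<le> t" "t \<le> b" for s t
  proof (rule LIMSEQ_le)
    show "(\<lambda>n. norm (S n t - S n s - \<Xi> s t)) \<longlonglongrightarrow> norm (J t - J s - \<Xi> s t)"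
      using J[of s] J[of t] st by (intro tendsto_intros) auto
    show "(\<lambda>n. \<epsilon> n + 2 * K / (1 - 2 powr (1 - \<theta>)) * (t - s) powr \<theta>) \<longlonglongrightarrow> 2 * K / (1 - 2 powr (1 - \<theta>)) * (t - s) powr \<theta>"
      using tendsto_add[OF summable_LIMSEQ_zero[OF \<epsilon>_sum] tendsto_const] by simp
  qed (use est st in auto)
  then show ?thesis by blast
qed

text \<open>Closeness to an additive germ on all subintervals gives convergence along arbitrary partitions:
  the errors add up to at most \<open>C \<delta>\<^sup>\<theta>\<^sup>-\<^sup>1 (b - a)\<close> for mesh \<open>\<delta>\<close>, so no common refinements are needed.\<close>

lemma sewn_limit:
  fixes \<Xi> :: "real \<Rightarrow> real \<Rightarrow> 'v::real_normed_vector"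
  assumes \<theta>: "\<theta> > 1" and ab: "a \<le> b"
    and close: "\<And>s t. a \<le> s \<Longrightarrow> s \<le> t \<Longrightarrow> t \<le> b \<Longrightarrow> norm (J t - J s - \<Xi> s t) \<le> C * (t - s) powr \<theta>"
  shows "((\<lambda>P. \<Sum>i<fst P. \<Xi> (snd P i) (snd P (Suc i))) \<longlongrightarrow> J b - J a) (mesh_filter a b)"
proof (rule tendstoI)
  fix e :: real assume e: "e > 0"
  define C' where "C' = max C 1"
  \<comment> \<open>The mesh for which \<open>C' \<delta>\<^sup>\<theta>\<^sup>-\<^sup>1 (b - a) < e\<close>.\<close>
  define \<delta> where "\<delta> = (e / (C' * (b - a) + 1)) powr (1 / (\<theta> - 1))"
  have C': "C' > 0" "C \<le> C'" by (auto simp: C'_def)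
  have den: "C' * (b - a) + 1 > 0" using C' ab by (smt (verit) mult_nonneg_nonneg)
  have "\<delta> > 0" unfolding \<delta>_def using e den by simp
  have \<delta>p: "\<delta> powr (\<theta> - 1) = e / (C' * (b - a) + 1)"
    unfolding \<delta>_def using \<theta> e den by (simp add: powr_powr)
  show "\<forall>\<^sub>F P in mesh_filter a b. dist (\<Sum>i<fst P. \<Xi> (snd P i) (snd P (Suc i))) (J b - J a) < e"
    unfolding eventually_mesh_filter
  proof (intro exI[of _ \<delta>] conjI ballI impI \<open>\<delta> > 0\<close>)
    fix P assume P: "P \<in> partitions a b" and mesh: "\<forall>i<fst P. snd P (Suc i) - snd P i < \<delta>"
    obtain n \<pi> where P_eq: "P = (n, \<pi>)" by (cases P)
    have \<pi>: "\<pi> 0 = a" "\<pi> n = b" "\<And>i. i < n \<Longrightarrow> \<pi> i < \<pi> (Suc i)" using P by (auto simp: P_eq partitions_def)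
    have "norm ((\<Sum>i<n. \<Xi> (\<pi> i) (\<pi> (Suc i))) - (J b - J a)) = norm (\<Sum>i<n. (J (\<pi> (Suc i)) - J (\<pi> i)) - \<Xi> (\<pi> i) (\<pi> (Suc i)))"
      using sum_lessThan_telescope[of "\<lambda>i. J (\<pi> i)" n]
      by (simp add: sum_subtractf norm_minus_commute \<pi>)
    also have "\<dots> \<le> (\<Sum>i<n. C' * \<delta> powr (\<theta> - 1) * (\<pi> (Suc i) - \<pi> i))"
    proof (intro sum_norm_le)
      fix i assume i: "i \<in> {..<n}"
      have len: "0 < \<pi> (Suc i) - \<pi> i" using \<pi>(3) i by simp
      have "norm ((J (\<pi> (Suc i)) - J (\<pi> i)) - \<Xi> (\<pi> i) (\<pi> (Suc i))) \<le> C * (\<pi> (Suc i) - \<pi> i) powr \<theta>"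
        using partition_points[of n \<pi> a b] P i len by (intro close) (auto simp: P_eq)
      also have "\<dots> \<le> C' * ((\<pi> (Suc i) - \<pi> i) powr (\<theta> - 1) * (\<pi> (Suc i) - \<pi> i))"
        using len C' by (simp add: powr_diff mult_right_mono)
      also have "\<dots> \<le> C' * (\<delta> powr (\<theta> - 1) * (\<pi> (Suc i) - \<pi> i))"
        using len C' mesh i \<theta> by (intro mult_left_mono mult_right_mono powr_mono2) (auto simp: P_eq intro: less_imp_le)
      finally show "norm ((J (\<pi> (Suc i)) - J (\<pi> i)) - \<Xi> (\<pi> i) (\<pi> (Suc i))) \<le> C' * \<delta> powr (\<theta> - 1) * (\<pi> (Suc i) - \<pi> i)"
        by (simp add: mult.assoc)
    qed
    also have "\<dots> = C' * \<delta> powr (\<theta> - 1) * (b - a)"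
      unfolding sum_distrib_left[symmetric] sum_lessThan_telescope \<pi> by simp
    also have "\<dots> < e"
      unfolding \<delta>p using e den by (simp add: field_simps)
    finally show "dist (\<Sum>i<fst P. \<Xi> (snd P i) (snd P (Suc i))) (J b - J a) < e"
      by (simp add: P_eq dist_norm)
  qed
qed

section \<open>Smooth functions and Hadamard expansions\<close>

definition pderiv_at :: "(real^'e \<Rightarrow> real) \<Rightarrow> 'e \<Rightarrow> real^'e \<Rightarrow> real" where
  "pderiv_at f j x = frechet_derivative f (at x) (axis j 1)"

text \<open>A quantitative form of \<^const>\<open>Cb\<close> for scalar functions: one constant bounds all partial
  derivatives up to the order \<open>k\<close>. With one constant the estimates are uniform in the base
  point \<open>Y\<^sub>u\<close>, since translations preserve the class.\<close>

primrec smooth_bounded :: "nat \<Rightarrow> real \<Rightarrow> (real^'e \<Rightarrow> real) \<Rightarrow> bool" where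
  "smooth_bounded 0 M f \<longleftrightarrow> continuous_on UNIV f \<and> (\<forall>x. \<bar>f x\<bar> \<le> M)"
| "smooth_bounded (Suc k) M f \<longleftrightarrow> (\<forall>x. \<bar>f x\<bar> \<le> M) \<and> (\<forall>x. f differentiable (at x)) \<and>
     (\<forall>j. smooth_bounded k M (pderiv_at f j))"

lemma has_derivative_pderiv_at:
  fixes f :: "real^'e \<Rightarrow> real"
  assumes "f differentiable (at x)"
  shows "(f has_derivative (\<lambda>v. \<Sum>j\<in>UNIV. v $ j * pderiv_at f j x)) (at x)"
proof -
  have d: "(f has_derivative frechet_derivative f (at x)) (at x)"
    using assms frechet_derivative_works by blast
  then have "linear (frechet_derivative f (at x))" by (rule has_derivative_linear)
  then have "frechet_derivative f (at x) v = (\<Sum>j\<in>UNIV. v $ j * pderiv_at f j x)" for v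
    unfolding pderiv_at_def
    by (subst basis_expansion[symmetric, of v]) (simp only: linear_sum linear_scale scalar_mult_eq_scaleR real_scaleR_def)
  then have "frechet_derivative f (at x) = (\<lambda>v. \<Sum>j\<in>UNIV. v $ j * pderiv_at f j x)" by blast
  with d show ?thesis by simp
qed

lemma pderiv_at_eqI:
  fixes f :: "real^'e \<Rightarrow> real"
  assumes "(f has_derivative (\<lambda>v. \<Sum>j\<in>UNIV. v $ j * g j)) (at x)"
  shows "pderiv_at f j x = g j"
proof -
  have "frechet_derivative f (at x) = (\<lambda>v. \<Sum>j\<in>UNIV. v $ j * g j)"
    using frechet_derivative_at[OF assms] by simp
  moreover have "(\<Sum>i\<in>UNIV. axis j 1 $ i * g i) = (\<Sum>i\<in>UNIV. if i = j then g i else 0)"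
    by (intro sum.cong refl) (simp add: axis_def)
  ultimately show ?thesis by (simp add: pderiv_at_def)
qed

lemma smooth_bounded_bound: "smooth_bounded k M f \<Longrightarrow> \<bar>f x\<bar> \<le> M"
  by (cases k) auto

lemma smooth_bounded_continuous: "smooth_bounded k M f \<Longrightarrow> continuous_on UNIV f"
proof (cases k)
  case (Suc n)
  assume "smooth_bounded k M f"
  then have "f differentiable_on UNIV" by (simp add: Suc differentiable_on_def)
  then show ?thesis by (rule differentiable_imp_continuous_on)
qed simp

lemma smooth_bounded_weaken: "smooth_bounded k M f \<Longrightarrow> M \<le> M' \<Longrightarrow> smooth_bounded k M' f"
  by (induction k arbitrary: f) (auto intro: order_trans)

lemma smooth_bounded_lower: "smooth_bounded (Suc k) M f \<Longrightarrow> smooth_bounded k M f"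
proof (induction k arbitrary: f)
  case 0
  then show ?case using smooth_bounded_continuous[of "Suc 0" M f] by simp
qed auto

lemma pderiv_at_translate:
  fixes f :: "real^'e \<Rightarrow> real"
  assumes "f differentiable (at (y + z))"
  shows "pderiv_at (\<lambda>z. f (y + z)) j z = pderiv_at f j (y + z)"
proof (rule pderiv_at_eqI)
  have shift: "((\<lambda>z. y + z) has_derivative (\<lambda>v. v)) (at z)"
    by (auto intro!: derivative_eq_intros)
  show "((\<lambda>z. f (y + z)) has_derivative (\<lambda>v. \<Sum>j\<in>UNIV. v $ j * pderiv_at f j (y + z))) (at z)"
    using has_derivative_compose[OF shift has_derivative_pderiv_at[OF assms]] .
qed

lemma smooth_bounded_translate:
  "smooth_bounded k M f \<Longrightarrow> smooth_bounded k M (\<lambda>z. f (y + z))"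
proof (induction k arbitrary: f)
  case 0
  then show ?case by (auto intro!: continuous_on_compose2[of UNIV f] continuous_intros)
next
  case (Suc k)
  have shift: "(\<lambda>z. y + z) differentiable (at z)" for z by simp
  have "(\<lambda>z. f (y + z)) differentiable (at z)" for z
    using differentiable_chain_at[OF shift[of z], of f] Suc.prems by (simp add: o_def)
  moreover have "pderiv_at (\<lambda>z. f (y + z)) j = (\<lambda>z. pderiv_at f j (y + z))" for j
    using pderiv_at_translate[of f y _ j] Suc.prems by auto
  ultimately show ?case using Suc by simp
qed

lemma Cb_imp_smooth_bounded:
  fixes f :: "real^'e \<Rightarrow> real^'n"
  shows "Cb k f \<Longrightarrow> \<exists>M. smooth_bounded k M (\<lambda>x. f x $ i)"
proof (induction k arbitrary: f)
  case 0
  then obtain B where "norm (f x) \<le> B" for x by (auto simp: bounded_iff)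
  then have "\<bar>f x $ i\<bar> \<le> B" for x using component_le_norm_cart order_trans by blast
  moreover have "continuous_on UNIV (\<lambda>x. f x $ i)" using 0 by (auto intro!: continuous_intros)
  ultimately show ?case by auto
next
  case (Suc k)
  then obtain B where "norm (f x) \<le> B" for x by (auto simp: bounded_iff)
  then have B: "\<bar>f x $ i\<bar> \<le> B" for x using component_le_norm_cart order_trans by blast
  have fr: "(f has_derivative frechet_derivative f (at x)) (at x)" for x
    using Suc.prems frechet_derivative_works by auto
  have d: "((\<lambda>x. f x $ i) has_derivative (\<lambda>v. frechet_derivative f (at x) v $ i)) (at x)" for x
    using fr bounded_linear.has_derivative[OF bounded_linear_vec_nth] by blast
  have eq: "pderiv_at (\<lambda>x. f x $ i) j = (\<lambda>x. frechet_derivative f (at x) (axis j 1) $ i)" for j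
    unfolding pderiv_at_def using frechet_derivative_at[OF d] by metis
  have "\<forall>j. \<exists>M. smooth_bounded k M (pderiv_at (\<lambda>x. f x $ i) j)"
    unfolding eq using Suc by auto
  then obtain M where M: "\<And>j. smooth_bounded k (M j) (pderiv_at (\<lambda>x. f x $ i) j)" by metis
  define M' where "M' = Max (insert B (range M))"
  have "B \<le> M'" "\<And>j. M j \<le> M'" unfolding M'_def by (rule Max_ge, simp, blast)+
  then have "smooth_bounded (Suc k) M' (\<lambda>x. f x $ i)"
    using B M d[THEN differentiableI] by (auto intro: order_trans smooth_bounded_weaken)
  then show ?case by blast
qed

text \<open>Differentiation under the integral sign produces one more factor \<open>\<theta>\<close>; carrying the power \<open>\<theta>\<^sup>n\<close>
  along is what lets the induction over the order of differentiability close.\<close>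

lemma smooth_bounded_radial_average:
  fixes g :: "real^'e \<Rightarrow> real"
  assumes "smooth_bounded k M g"
  shows "smooth_bounded k M (\<lambda>z. integral {0..1} (\<lambda>\<theta>. \<theta> ^ n * g (\<theta> *\<^sub>R z)))"
  using assms
proof (induction k arbitrary: g n)
  have bound: "\<bar>integral {0..1} (\<lambda>\<theta>. \<theta> ^ n * g (\<theta> *\<^sub>R z))\<bar> \<le> M"
    if "smooth_bounded k M g" for g :: "real^'e \<Rightarrow> real" and k n z
  proof -
    note [continuous_intros] = continuous_on_compose2[OF smooth_bounded_continuous[OF that] _ subset_UNIV]
    have "norm (integral {0..1} (\<lambda>\<theta>. \<theta> ^ n * g (\<theta> *\<^sub>R z))) \<le> M * (1 - 0)"
    proof (rule integral_bound)
      fix \<theta> :: real assume "\<theta> \<in> {0..1}"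
      then have "\<bar>\<theta> ^ n\<bar> \<le> 1" by (simp add: power_le_one power_abs)
      then have "\<bar>\<theta> ^ n\<bar> * \<bar>g (\<theta> *\<^sub>R z)\<bar> \<le> 1 * M"
        using smooth_bounded_bound[OF that] by (intro mult_mono) auto
      then show "norm (\<theta> ^ n * g (\<theta> *\<^sub>R z)) \<le> M" by (simp add: abs_mult)
    qed (auto intro!: continuous_intros)
    then show ?thesis by simp
  qed
  {
    case (0 g n)
    note [continuous_intros] = continuous_on_compose2[OF smooth_bounded_continuous[OF 0] _ subset_UNIV]
    have "continuous_on UNIV (\<lambda>z. integral (cbox 0 1) (\<lambda>\<theta>. \<theta> ^ n * g (\<theta> *\<^sub>R z)))"
      by (intro integral_continuous_on_param) (auto intro!: continuous_intros simp: split_beta)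
    then show ?case using bound[OF 0] by simp
  next
    case (Suc k g n)
    have k: "smooth_bounded k M (pderiv_at g j)" for j using Suc.prems by simp
    note [continuous_intros] = continuous_on_compose2[OF smooth_bounded_continuous[OF Suc.prems] _ subset_UNIV]
      continuous_on_compose2[OF smooth_bounded_continuous[OF k] _ subset_UNIV]
    define D where "D z \<theta> = (\<Sum>j\<in>UNIV. (\<theta> ^ Suc n * pderiv_at g j (\<theta> *\<^sub>R z)) *\<^sub>R blinfun_inner_right (axis j 1 :: real^'e))"
      for z :: "real^'e" and \<theta> :: real
    have Dapp: "blinfun_apply (D z \<theta>) v = (\<Sum>j\<in>UNIV. v $ j * (\<theta> ^ Suc n * pderiv_at g j (\<theta> *\<^sub>R z)))" for z \<theta> v
      by (simp add: D_def blinfun.sum_left blinfun.scaleR_left inner_axis' mult_ac)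
    have der: "((\<lambda>z. \<theta> ^ n * g (\<theta> *\<^sub>R z)) has_derivative blinfun_apply (D z \<theta>)) (at z)" for \<theta> z
    proof -
      have dil: "((\<lambda>z. \<theta> *\<^sub>R z) has_derivative (\<lambda>v. \<theta> *\<^sub>R v)) (at z)"
        by (auto intro!: derivative_eq_intros)
      have "((\<lambda>z. g (\<theta> *\<^sub>R z)) has_derivative (\<lambda>v. \<Sum>j\<in>UNIV. (\<theta> *\<^sub>R v) $ j * pderiv_at g j (\<theta> *\<^sub>R z))) (at z)"
        using has_derivative_compose[OF dil has_derivative_pderiv_at[of g "\<theta> *\<^sub>R z"]] Suc.prems by simp
      then have "((\<lambda>z. \<theta> ^ n * g (\<theta> *\<^sub>R z)) has_derivative (\<lambda>v. \<theta> ^ n * (\<Sum>j\<in>UNIV. (\<theta> *\<^sub>R v) $ j * pderiv_at g j (\<theta> *\<^sub>R z)))) (at z)"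
        by (rule has_derivative_mult_right)
      then show ?thesis
        by (rule has_derivative_eq_rhs) (auto simp: Dapp sum_distrib_left mult_ac)
    qed
    have Dc: "continuous_on (UNIV \<times> cbox 0 1) (\<lambda>(z, \<theta>). D z \<theta>)"
      unfolding D_def by (auto intro!: continuous_intros simp: split_beta)
    have intD: "(\<lambda>\<theta>. D z \<theta>) integrable_on cbox 0 1" for z
      unfolding D_def by (intro integrable_continuous) (auto intro!: continuous_intros)
    have leibniz: "((\<lambda>z. integral (cbox 0 1) (\<lambda>\<theta>. \<theta> ^ n * g (\<theta> *\<^sub>R z))) has_derivative integral (cbox 0 1) (D z)) (at z)" for z
      by (rule leibniz_rule[where U = UNIV and fx = D])
        (use Dc in \<open>auto intro!: der integrable_continuous_real continuous_intros\<close>)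
    have app: "blinfun_apply (integral (cbox 0 1) (D z)) v
        = (\<Sum>j\<in>UNIV. v $ j * integral {0..1} (\<lambda>\<theta>. \<theta> ^ Suc n * pderiv_at g j (\<theta> *\<^sub>R z)))" for z v
    proof -
      have "blinfun_apply (integral (cbox 0 1) (D z)) v = integral (cbox 0 1) (\<lambda>\<theta>. blinfun_apply (D z \<theta>) v)"
        using integral_linear[OF intD bounded_linear_apply_blinfun, of v z] by (simp add: o_def)
      also have "\<dots> = (\<Sum>j\<in>UNIV. integral {0..1} (\<lambda>\<theta>. v $ j * (\<theta> ^ Suc n * pderiv_at g j (\<theta> *\<^sub>R z))))"
        unfolding Dapp
        by (subst integral_sum) (auto intro!: integrable_continuous_real continuous_intros)
      finally show ?thesis by simp
    qed
    have d: "((\<lambda>z. integral {0..1} (\<lambda>\<theta>. \<theta> ^ n * g (\<theta> *\<^sub>R z))) has_derivative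
        (\<lambda>v. \<Sum>j\<in>UNIV. v $ j * integral {0..1} (\<lambda>\<theta>. \<theta> ^ Suc n * pderiv_at g j (\<theta> *\<^sub>R z)))) (at z)" for z
      using has_derivative_eq_rhs[OF leibniz[of z] ext[OF app]] unfolding cbox_interval .
    have "pderiv_at (\<lambda>z. integral {0..1} (\<lambda>\<theta>. \<theta> ^ n * g (\<theta> *\<^sub>R z))) j
        = (\<lambda>z. integral {0..1} (\<lambda>\<theta>. \<theta> ^ Suc n * pderiv_at g j (\<theta> *\<^sub>R z)))" for j
      using pderiv_at_eqI[OF d] by blast
    then show ?case
      unfolding smooth_bounded.simps using bound[OF Suc.prems] d[THEN differentiableI] Suc.IH[OF k, of "Suc n"]
      by auto
  }
qed

text \<open>The fundamental theorem of calculus along the segment from \<open>0\<close> to \<open>z\<close>, with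
  \<open>r\<^sub>j(z) = \<integral>\<^sub>0\<^sup>1 \<partial>\<^sub>jf(\<theta>z) d\<theta>\<close>.\<close>

lemma hadamard_first_order:
  fixes f :: "real^'e \<Rightarrow> real"
  assumes "smooth_bounded (Suc k) M f"
  shows "\<exists>r. (\<forall>j. smooth_bounded k M (r j)) \<and> (\<forall>z. f z = f 0 + (\<Sum>j\<in>UNIV. z $ j * r j z))"
proof -
  have k: "smooth_bounded k M (pderiv_at f j)" for j using assms by simp
  note [continuous_intros] = continuous_on_compose2[OF smooth_bounded_continuous[OF k] _ subset_UNIV]
  define r where "r j z = integral {0..1} (\<lambda>\<theta>. pderiv_at f j (\<theta> *\<^sub>R z))" for j z
  have "smooth_bounded k M (r j)" for j
    using smooth_bounded_radial_average[OF k, of 0 j] by (simp add: r_def[abs_def])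
  moreover have "f z = f 0 + (\<Sum>j\<in>UNIV. z $ j * r j z)" for z
  proof -
    have ray: "((\<lambda>\<theta>. \<theta> *\<^sub>R z) has_derivative (\<lambda>h. h *\<^sub>R z)) (at \<theta> within {0..1})" for \<theta> :: real
      by (auto intro!: derivative_eq_intros)
    have "((\<lambda>\<theta>. f (\<theta> *\<^sub>R z)) has_derivative (\<lambda>h. \<Sum>j\<in>UNIV. (h *\<^sub>R z) $ j * pderiv_at f j (\<theta> *\<^sub>R z))) (at \<theta> within {0..1})" for \<theta>
      using has_derivative_compose[OF ray has_derivative_pderiv_at[of f "\<theta> *\<^sub>R z"]] assms by simp
    then have "((\<lambda>\<theta>. f (\<theta> *\<^sub>R z)) has_vector_derivative (\<Sum>j\<in>UNIV. z $ j * pderiv_at f j (\<theta> *\<^sub>R z))) (at \<theta> within {0..1})" for \<theta>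
      unfolding has_vector_derivative_def
      by (rule has_derivative_eq_rhs) (auto simp: sum_distrib_left mult_ac)
    then have "((\<lambda>\<theta>. \<Sum>j\<in>UNIV. z $ j * pderiv_at f j (\<theta> *\<^sub>R z)) has_integral (f (1 *\<^sub>R z) - f (0 *\<^sub>R z))) {0..1}"
      by (intro fundamental_theorem_of_calculus) auto
    then have "f z - f 0 = integral {0..1} (\<lambda>\<theta>. \<Sum>j\<in>UNIV. z $ j * pderiv_at f j (\<theta> *\<^sub>R z))"
      by (simp add: integral_unique)
    also have "\<dots> = (\<Sum>j\<in>UNIV. z $ j * r j z)"
      unfolding r_def
      by (subst integral_sum) (auto intro!: integrable_continuous_real continuous_intros)
    finally show ?thesis by simp
  qed
  ultimately show ?thesis by (intro exI[of _ r] conjI allI)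
qed

lemma finite_words: "finite {js :: 'e::finite list. length js = n}"
  using finite_lists_length_eq[of "UNIV :: 'e set" n] by simp

lemma sum_words_Suc:
  fixes f :: "'e::finite list \<Rightarrow> 'b::comm_monoid_add"
  shows "(\<Sum>js | length js = Suc n. f js) = (\<Sum>js | length js = n. \<Sum>j\<in>UNIV. f (j # js))"
proof -
  have "(\<Sum>js | length js = n. \<Sum>j\<in>UNIV. f (j # js))
      = (\<Sum>(js, j)\<in>{js. length js = n} \<times> UNIV. f (j # js))"
    by (rule sum.cartesian_product)
  also have "\<dots> = (\<Sum>js | length js = Suc n. f js)"
    by (rule sum.reindex_bij_witness[of _ "\<lambda>js. (tl js, hd js)" "\<lambda>(js, j). j # js"])
      (auto simp: length_Suc_conv)
  finally show ?thesis by simp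
qed

text \<open>Iterating Hadamard's formula, monomials are indexed by words \<open>js\<close> of coordinates rather than by
  multi-indices. In contrast to the usual Taylor remainder, each remainder coefficient \<open>r js\<close> is
  again a smooth function of \<open>z\<close>, so that composing it with a controlled path gives a controlled path;
  and no symmetry of higher derivatives is involved.\<close>

lemma taylor_hadamard:
  fixes f :: "real^'e \<Rightarrow> real"
  assumes "smooth_bounded (N + k) M f"
  shows "\<exists>c r. (\<forall>js. \<bar>c js\<bar> \<le> M) \<and> (\<forall>js. smooth_bounded k M (r js)) \<and>
    (\<forall>z. f z = (\<Sum>n<N. \<Sum>js | length js = n. c js * (\<Prod>j\<leftarrow>js. z $ j))
            + (\<Sum>js | length js = N. (\<Prod>j\<leftarrow>js. z $ j) * r js z))"
  using assms
proof (induction N arbitrary: k)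
  case 0
  have "\<bar>0::real\<bar> \<le> M" using smooth_bounded_bound[OF 0, of 0] by linarith
  then show ?case using 0 by (intro exI[of _ "\<lambda>_. 0"] exI[of _ "\<lambda>_. f"]) auto
next
  case (Suc N)
  then obtain c r where c: "\<And>js. \<bar>c js\<bar> \<le> M" and r: "\<And>js. smooth_bounded (Suc k) M (r js)"
    and eq: "\<And>z. f z = (\<Sum>n<N. \<Sum>js | length js = n. c js * (\<Prod>j\<leftarrow>js. z $ j))
            + (\<Sum>js | length js = N. (\<Prod>j\<leftarrow>js. z $ j) * r js z)"
    using Suc.IH[of "Suc k"] by auto
  obtain r' where r': "\<And>js j. smooth_bounded k M (r' js j)"
    and r_eq: "\<And>js z. r js z = r js 0 + (\<Sum>j\<in>UNIV. z $ j * r' js j z)"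
    using hadamard_first_order[OF r] by metis
  define c' where "c' js = (if length js = N then r js 0 else c js)" for js
  define r'' where "r'' js = r' (tl js) (hd js)" for js
  have "f z = (\<Sum>n<Suc N. \<Sum>js | length js = n. c' js * (\<Prod>j\<leftarrow>js. z $ j))
            + (\<Sum>js | length js = Suc N. (\<Prod>j\<leftarrow>js. z $ j) * r'' js z)" for z
  proof -
    have "(\<Sum>js | length js = N. (\<Prod>j\<leftarrow>js. z $ j) * r js z)
        = (\<Sum>js | length js = N. c' js * (\<Prod>j\<leftarrow>js. z $ j) + (\<Sum>j\<in>UNIV. (\<Prod>j\<leftarrow>j # js. z $ j) * r'' (j # js) z))"
      by (intro sum.cong refl, subst r_eq) (simp add: c'_def r''_def algebra_simps sum_distrib_left)
    also have "\<dots> = (\<Sum>js | length js = N. c' js * (\<Prod>j\<leftarrow>js. z $ j)) + (\<Sum>js | length js = Suc N. (\<Prod>j\<leftarrow>js. z $ j) * r'' js z)"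
      by (simp only: sum.distrib sum_words_Suc)
    finally have *: "(\<Sum>js | length js = N. (\<Prod>j\<leftarrow>js. z $ j) * r js z) = \<dots>" .
    have "(\<Sum>n<N. \<Sum>js | length js = n. c js * (\<Prod>j\<leftarrow>js. z $ j)) = (\<Sum>n<N. \<Sum>js | length js = n. c' js * (\<Prod>j\<leftarrow>js. z $ j))"
      by (intro sum.cong refl) (auto simp: c'_def)
    with * show ?thesis unfolding eq[of z] by simp
  qed
  moreover have "\<bar>c' js\<bar> \<le> M" for js using c smooth_bounded_bound[OF r] by (simp add: c'_def)
  moreover have "smooth_bounded k M (r'' js)" for js using r' by (simp add: r''_def)
  ultimately show ?case by (intro exI[of _ c'] exI[of _ r''] conjI allI)
qed

section \<open>Picard iteration in a commutative algebra\<close>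

text \<open>The abstract setting of the argument. The set \<open>W\<close> indexes the intervals, \<open>lam w\<close> is the scale of
  the interval \<open>w\<close>, and \<open>bnd w C x\<close> says that \<open>x\<close> has size at most \<open>C\<close> on it. The operators \<open>J w a\<close> are
  linear only on elements of finite size, because a rough integral exists only for those.
  The functional \<open>D\<close> is meant to compare the two components of an element.\<close>

locale picard_algebra =
  fixes W :: "'w set" and lam :: "'w \<Rightarrow> real" and K \<Lambda> :: real
    and bnd :: "'w \<Rightarrow> real \<Rightarrow> 'x::{comm_ring_1,real_algebra_1} \<Rightarrow> bool"
    and J :: "'w \<Rightarrow> 'm::finite \<Rightarrow> 'x \<Rightarrow> 'x" and D :: "'w \<Rightarrow> 'x \<Rightarrow> real"
  assumes K_ge: "K \<ge> 0"
    and lam_pos: "w \<in> W \<Longrightarrow> 0 < lam w" and lam_le: "w \<in> W \<Longrightarrow> lam w \<le> \<Lambda>"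
    and bnd_mono: "w \<in> W \<Longrightarrow> bnd w C x \<Longrightarrow> C \<le> C' \<Longrightarrow> bnd w C' x"
    and bnd_one: "w \<in> W \<Longrightarrow> bnd w 1 1"
    and bnd_add: "w \<in> W \<Longrightarrow> bnd w C x \<Longrightarrow> bnd w C' y \<Longrightarrow> bnd w (C + C') (x + y)"
    and bnd_scaleR: "w \<in> W \<Longrightarrow> bnd w C x \<Longrightarrow> bnd w (\<bar>c\<bar> * C) (c *\<^sub>R x)"
    and bnd_mult: "w \<in> W \<Longrightarrow> bnd w C x \<Longrightarrow> bnd w C' y \<Longrightarrow> bnd w (K * C * C') (x * y)"
    and J_bnd: "w \<in> W \<Longrightarrow> bnd w C x \<Longrightarrow> bnd w (K * lam w * C) (J w a x)"
    and J_add: "w \<in> W \<Longrightarrow> bnd w C x \<Longrightarrow> bnd w C' y \<Longrightarrow> J w a (x + y) = J w a x + J w a y"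
    and J_scaleR: "w \<in> W \<Longrightarrow> bnd w C x \<Longrightarrow> J w a (c *\<^sub>R x) = c *\<^sub>R J w a x"
    and D_add: "D w (x + y) = D w x + D w y"
    and D_scaleR: "D w (c *\<^sub>R x) = c * D w x"
    and D_bnd: "w \<in> W \<Longrightarrow> bnd w C x \<Longrightarrow> \<bar>D w x\<bar> \<le> K * C"
begin

text \<open>Families of elements whose size on the interval \<open>w\<close> is of order \<open>lam w ^ k\<close>, uniformly in \<open>w\<close>.\<close>

definition small :: "nat \<Rightarrow> ('w \<Rightarrow> 'x) \<Rightarrow> bool" where
  "small k f \<longleftrightarrow> (\<exists>C\<ge>0. \<forall>w\<in>W. bnd w (C * lam w ^ k) (f w))"

lemma smallI:
  assumes "\<And>w. w \<in> W \<Longrightarrow> bnd w (C * lam w ^ k) (f w)"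
  shows "small k f"
proof -
  have "bnd w (max C 0 * lam w ^ k) (f w)" if w: "w \<in> W" for w
    by (rule bnd_mono[OF w assms[OF w]]) (use lam_pos[OF w] in \<open>auto intro: mult_right_mono\<close>)
  then show ?thesis unfolding small_def by (intro exI[of _ "max C 0"]) auto
qed

lemma small_cong: "(\<And>w. w \<in> W \<Longrightarrow> f w = g w) \<Longrightarrow> small k f \<longleftrightarrow> small k g"
  by (auto simp: small_def)

lemma small_regular: "small k f \<Longrightarrow> w \<in> W \<Longrightarrow> \<exists>C. bnd w C (f w)"
  by (auto simp: small_def)

lemma small_weaken:
  assumes "small l f" "k \<le> l"
  shows "small k f"
proof -
  obtain C where C: "C \<ge> 0" "\<And>w. w \<in> W \<Longrightarrow> bnd w (C * lam w ^ l) (f w)" using assms(1) unfolding small_def by blast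
  show ?thesis
  proof (rule smallI)
    fix w assume w: "w \<in> W"
    have "lam w ^ l = lam w ^ (l - k) * lam w ^ k" using assms(2) by (simp flip: power_add)
    also have "\<dots> \<le> \<Lambda> ^ (l - k) * lam w ^ k"
      using lam_pos[OF w] lam_le[OF w] by (intro mult_right_mono power_mono) auto
    finally have "C * lam w ^ l \<le> C * \<Lambda> ^ (l - k) * lam w ^ k"
      using C by (simp add: mult_left_mono mult.assoc)
    then show "bnd w (C * \<Lambda> ^ (l - k) * lam w ^ k) (f w)" using bnd_mono[OF w C(2)[OF w]] by simp
  qed
qed

lemma small_add:
  assumes "small k f" "small k g"
  shows "small k (\<lambda>w. f w + g w)"
proof -
  from assms(1) obtain C where C: "\<And>w. w \<in> W \<Longrightarrow> bnd w (C * lam w ^ k) (f w)" unfolding small_def by blast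
  from assms(2) obtain C' where C': "\<And>w. w \<in> W \<Longrightarrow> bnd w (C' * lam w ^ k) (g w)" unfolding small_def by blast
  then show ?thesis
    by (intro smallI[of "C + C'"]) (simp only: distrib_right bnd_add[OF _ C C'])
qed

lemma small_scaleR:
  assumes "small k f" "\<And>w. w \<in> W \<Longrightarrow> \<bar>c w\<bar> \<le> B"
  shows "small k (\<lambda>w. c w *\<^sub>R f w)"
proof -
  obtain C where C: "C \<ge> 0" "\<And>w. w \<in> W \<Longrightarrow> bnd w (C * lam w ^ k) (f w)" using assms(1) unfolding small_def by blast
  show ?thesis
  proof (rule smallI)
    fix w assume w: "w \<in> W"
    show "bnd w ((B * C) * lam w ^ k) (c w *\<^sub>R f w)"
      using bnd_scaleR[OF w C(2)[OF w], of "c w"]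
      by (rule bnd_mono[OF w])
        (use assms(2)[OF w] C(1) lam_pos[OF w] in \<open>auto simp: mult.assoc intro!: mult_right_mono\<close>)
  qed
qed

lemma small_mult:
  assumes "small k f" "small l g"
  shows "small (k + l) (\<lambda>w. f w * g w)"
proof -
  from assms(1) obtain C where C: "\<And>w. w \<in> W \<Longrightarrow> bnd w (C * lam w ^ k) (f w)" unfolding small_def by blast
  from assms(2) obtain C' where C': "\<And>w. w \<in> W \<Longrightarrow> bnd w (C' * lam w ^ l) (g w)" unfolding small_def by blast
  have "bnd w (K * (C * lam w ^ k) * (C' * lam w ^ l)) (f w * g w)" if "w \<in> W" for w
    using bnd_mult[OF that C[OF that] C'[OF that]] .
  then show ?thesis
    by (intro smallI[of "K * C * C'"]) (simp add: power_add mult_ac)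
qed

lemma small_one: "small 0 (\<lambda>_. 1)"
  using bnd_one by (intro smallI[of 1]) auto

lemma small_zero: "small k (\<lambda>_. 0)"
proof (rule smallI)
  fix w assume w: "w \<in> W"
  show "bnd w (0 * lam w ^ k) 0" using bnd_scaleR[OF w bnd_one[OF w], of 0] by simp
qed

lemma small_sum: "(\<And>i. i \<in> I \<Longrightarrow> small k (f i)) \<Longrightarrow> small k (\<lambda>w. \<Sum>i\<in>I. f i w)"
  by (induction I rule: infinite_finite_induct) (auto intro: small_zero small_add)

lemma small_J:
  assumes "small k f"
  shows "small (Suc k) (\<lambda>w. J w a (f w))"
proof -
  obtain C where C: "C \<ge> 0" "\<And>w. w \<in> W \<Longrightarrow> bnd w (C * lam w ^ k) (f w)" using assms(1) unfolding small_def by blast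
  have "K * lam w * (C * lam w ^ k) = (K * C) * lam w ^ Suc k" for w by simp
  then show ?thesis
    using J_bnd[OF _ C(2)] by (intro smallI[of "K * C"]) metis
qed

lemma small_prod_list:
  "(\<And>j. j \<in> set js \<Longrightarrow> small (n j) (f j)) \<Longrightarrow> small (\<Sum>j\<leftarrow>js. n j) (\<lambda>w. \<Prod>j\<leftarrow>js. f j w)"
  by (induction js) (auto intro: small_one small_mult)

lemma small_prod_list0:
  "(\<And>j. small 0 (f j)) \<Longrightarrow> small 0 (\<lambda>w. \<Prod>j\<leftarrow>js. f j w)"
  using small_prod_list[of js "\<lambda>_. 0" f] by (simp add: sum_list_triv)

text \<open>Telescoping: the factors are exchanged one at a time, each exchange costs an element of order \<open>k\<close>.\<close>

lemma small_prod_list_diff: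
  assumes "\<And>j. small 0 (f j)" "\<And>j. small 0 (g j)" "\<And>j. small k (\<lambda>w. f j w - g j w)"
  shows "small k (\<lambda>w. (\<Prod>j\<leftarrow>js. f j w) - (\<Prod>j\<leftarrow>js. g j w))"
proof (induction js)
  case (Cons j js)
  have "small k (\<lambda>w. (f j w - g j w) * (\<Prod>j\<leftarrow>js. f j w) + g j w * ((\<Prod>j\<leftarrow>js. f j w) - (\<Prod>j\<leftarrow>js. g j w)))"
    using small_mult[OF assms(3)[of j] small_prod_list0[OF assms(1)]] small_mult[OF assms(2)[of j] Cons.IH]
    by (intro small_add) auto
  then show ?case by (simp add: algebra_simps)
qed (simp add: small_zero)

lemma small_prod_mset:
  "(\<And>\<tau>. \<tau> \<in># \<eta> \<Longrightarrow> small (n \<tau>) (f \<tau>)) \<Longrightarrow> small (\<Sum>\<tau>\<in>#\<eta>. n \<tau>) (\<lambda>w. \<Prod>\<tau>\<in>#\<eta>. f \<tau> w)"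
  by (induction \<eta>) (auto intro: small_one small_mult)

lemma J_diff:
  assumes "w \<in> W" "bnd w C x" "bnd w C' y"
  shows "J w a (x - y) = J w a x - J w a y"
  using J_add[OF assms(1,2) bnd_scaleR[OF assms(1,3), of "-1"], of a] J_scaleR[OF assms(1,3), of a "-1"] by simp

lemma small_D:
  assumes "small k f"
  shows "\<exists>C. \<forall>w\<in>W. \<bar>D w (f w)\<bar> \<le> C * lam w ^ k"
proof -
  obtain C where C: "\<And>w. w \<in> W \<Longrightarrow> bnd w (C * lam w ^ k) (f w)" using assms(1) unfolding small_def by blast
  then have "\<forall>w\<in>W. \<bar>D w (f w)\<bar> \<le> K * C * lam w ^ k" using D_bnd[OF _ C] by (simp add: mult.assoc)
  then show ?thesis by blast
qed

text \<open>In the algebra of trajectories this becomes \<open>Z\<^sup>\<tau>\<close> in one component and the numerical coefficients of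
  \<open>\<tau>\<close> in the other.\<close>

primrec tree_val :: "'w \<Rightarrow> 'm rtree \<Rightarrow> 'x" where
  "tree_val w (Node a \<eta>) = J w a (\<Prod>x\<in>#image_mset (tree_val w) \<eta>. x)"

definition forest_val :: "'w \<Rightarrow> 'm rtree multiset \<Rightarrow> 'x" where
  "forest_val w \<eta> = (\<Prod>\<tau>\<in>#\<eta>. tree_val w \<tau>)"

lemma tree_val_Node: "tree_val w (Node a \<eta>) = J w a (forest_val w \<eta>)"
  by (simp add: forest_val_def)

lemma small_tree_val: "small (tree_size \<tau>) (\<lambda>w. tree_val w \<tau>)"
proof (induction \<tau>)
  case (Node a \<eta>)
  have "small (\<Sum>\<tau>\<in>#\<eta>. tree_size \<tau>) (\<lambda>w. forest_val w \<eta>)"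
    unfolding forest_val_def using Node by (rule small_prod_mset)
  then show ?case unfolding tree_val_Node tree_size.simps by (rule small_J)
qed

lemma small_forest_val: "small 0 (\<lambda>w. forest_val w \<eta>)"
  using small_prod_mset[of \<eta> tree_size "\<lambda>\<tau> w. tree_val w \<tau>"] small_tree_val small_weaken
  by (auto simp: forest_val_def)

text \<open>Finite linear combinations of forests with coefficients bounded uniformly over the intervals.
  Equality is required on \<open>W\<close> only, because nothing is known about \<open>J w\<close> for \<open>w\<close> outside \<open>W\<close>.\<close>

inductive forest_comb :: "('w \<Rightarrow> 'x) \<Rightarrow> bool" where
  forest_comb_zero: "(\<And>w. w \<in> W \<Longrightarrow> f w = 0) \<Longrightarrow> forest_comb f"
| forest_comb_step: "(\<And>w. w \<in> W \<Longrightarrow> \<bar>c w\<bar> \<le> B) \<Longrightarrow> forest_comb g \<Longrightarrow>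
    (\<And>w. w \<in> W \<Longrightarrow> f w = c w *\<^sub>R forest_val w \<eta> + g w) \<Longrightarrow> forest_comb f"

lemma forest_comb_cong:
  assumes "forest_comb f" "\<And>w. w \<in> W \<Longrightarrow> f w = f' w"
  shows "forest_comb f'"
  using assms(1)
proof cases
  case forest_comb_zero
  then show ?thesis using assms(2) by (intro forest_comb.forest_comb_zero) simp
next
  case (forest_comb_step c B g \<eta>)
  then show ?thesis using assms(2) by (intro forest_comb.forest_comb_step[of c B g f' \<eta>]) simp_all
qed

lemma forest_comb_small: "forest_comb f \<Longrightarrow> small 0 f"
proof (induction rule: forest_comb.induct)
  case (forest_comb_zero f)
  then show ?case using small_cong[of f "\<lambda>_. 0"] small_zero by simp
next
  case (forest_comb_step c B g f \<eta>)
  have "small 0 (\<lambda>w. c w *\<^sub>R forest_val w \<eta> + g w)"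
    by (intro small_add small_scaleR[of _ _ c B] small_forest_val forest_comb_step.hyps(1) forest_comb_step.IH)
  then show ?case using small_cong[of f "\<lambda>w. c w *\<^sub>R forest_val w \<eta> + g w"] forest_comb_step.hyps(3) by simp
qed

lemma forest_comb_forest:
  assumes "\<And>w. w \<in> W \<Longrightarrow> \<bar>c w\<bar> \<le> B"
  shows "forest_comb (\<lambda>w. c w *\<^sub>R forest_val w \<eta>)"
  by (rule forest_comb_step[of c B "\<lambda>_. 0" _ \<eta>]) (simp_all add: forest_comb_zero assms)

lemma forest_comb_add: "forest_comb f \<Longrightarrow> forest_comb g \<Longrightarrow> forest_comb (\<lambda>w. f w + g w)"
proof (induction rule: forest_comb.induct)
  case (forest_comb_zero f)
  then show ?case using forest_comb_cong[of g "\<lambda>w. f w + g w"] by simp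
next
  case (forest_comb_step c B h f \<eta>)
  show ?case
    by (rule forest_comb.forest_comb_step[of c B "\<lambda>w. h w + g w" _ \<eta>])
      (simp_all add: forest_comb_step.hyps forest_comb_step.IH[OF forest_comb_step.prems] add.assoc)
qed

lemma forest_comb_sum:
  assumes "\<And>i. i \<in> I \<Longrightarrow> forest_comb (f i)"
  shows "forest_comb (\<lambda>w. \<Sum>i\<in>I. f i w)"
  using assms
  by (induction I rule: infinite_finite_induct) (simp_all add: forest_comb_zero forest_comb_add)

lemma forest_comb_mult_forest:
  assumes "forest_comb g" and c: "\<And>w. w \<in> W \<Longrightarrow> \<bar>c w\<bar> \<le> B"
  shows "forest_comb (\<lambda>w. (c w *\<^sub>R forest_val w \<eta>) * g w)"
  using assms(1)
proof (induction rule: forest_comb.induct)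
  case (forest_comb_zero f)
  then show ?case by (intro forest_comb.forest_comb_zero) simp
next
  case (forest_comb_step d B' h f \<theta>)
  show ?case
  proof (rule forest_comb.forest_comb_step[of "\<lambda>w. c w * d w" "B * B'" "\<lambda>w. (c w *\<^sub>R forest_val w \<eta>) * h w" _ "\<eta> + \<theta>"])
    fix w assume w: "w \<in> W"
    have "0 \<le> B" using c[OF w] by linarith
    then show "\<bar>c w * d w\<bar> \<le> B * B'"
      unfolding abs_mult using forest_comb_step.hyps(1)[OF w] c[OF w] by (intro mult_mono) auto
    show "(c w *\<^sub>R forest_val w \<eta>) * f w
        = (c w * d w) *\<^sub>R forest_val w (\<eta> + \<theta>) + (c w *\<^sub>R forest_val w \<eta>) * h w"
      unfolding forest_comb_step.hyps(3)[OF w]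
      by (simp add: forest_val_def distrib_left mult.commute)
  qed (rule forest_comb_step.IH)
qed

text \<open>The product of two forests is the union of the forests.\<close>

lemma forest_comb_mult: "forest_comb f \<Longrightarrow> forest_comb g \<Longrightarrow> forest_comb (\<lambda>w. f w * g w)"
proof (induction rule: forest_comb.induct)
  case (forest_comb_zero f)
  then show ?case by (intro forest_comb.forest_comb_zero) simp
next
  case (forest_comb_step c B h f \<eta>)
  have "forest_comb (\<lambda>w. (c w *\<^sub>R forest_val w \<eta>) * g w + h w * g w)"
    by (intro forest_comb_add forest_comb_mult_forest[of _ c B] forest_comb_step.hyps(1)
        forest_comb_step.IH[OF forest_comb_step.prems] forest_comb_step.prems)
  then show ?case
    by (rule forest_comb_cong) (simp add: forest_comb_step.hyps(3) distrib_right)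
qed

lemma forest_comb_one: "forest_comb (\<lambda>_. 1)"
  using forest_comb_forest[of "\<lambda>_. 1" 1 "{#}"] by (simp add: forest_val_def)

lemma forest_comb_scaleR:
  assumes "forest_comb f" "\<And>w. w \<in> W \<Longrightarrow> \<bar>c w\<bar> \<le> B"
  shows "forest_comb (\<lambda>w. c w *\<^sub>R f w)"
  using forest_comb_mult[OF forest_comb_forest[of c B "{#}"] assms(1)] assms(2)
  by (simp add: forest_val_def)

lemma forest_comb_prod_list: "(\<And>j. forest_comb (f j)) \<Longrightarrow> forest_comb (\<lambda>w. \<Prod>j\<leftarrow>js. f j w)"
  by (induction js) (simp_all add: forest_comb_one forest_comb_mult)

text \<open>Grafting: \<open>J w a\<close> applied to a forest is the tree that joins it to a new root decorated by \<open>a\<close>.\<close>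

lemma forest_comb_J:
  assumes "forest_comb f"
  shows "forest_comb (\<lambda>w. J w a (f w))"
  using assms
proof (induction rule: forest_comb.induct)
  case (forest_comb_zero f)
  have "J w a (f w) = 0" if "w \<in> W" for w
    using J_scaleR[OF that bnd_one[OF that], of a 0] forest_comb_zero[OF that] by simp
  then show ?case by (rule forest_comb.forest_comb_zero)
next
  case (forest_comb_step c B g f \<eta>)
  have eq: "J w a (f w) = c w *\<^sub>R forest_val w {#Node a \<eta>#} + J w a (g w)" if w: "w \<in> W" for w
  proof -
    obtain C where C: "bnd w C (forest_val w \<eta>)" using small_regular[OF small_forest_val w] by blast
    obtain C' where C': "bnd w C' (g w)"
      using small_regular[OF forest_comb_small[OF forest_comb_step.hyps(2)] w] by blast
    show ?thesis unfolding forest_comb_step.hyps(3)[OF w]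
      using J_add[OF w bnd_scaleR[OF w C] C'] J_scaleR[OF w C]
      by (simp add: forest_val_def)
  qed
  show ?case by (rule forest_comb.forest_comb_step[OF _ forest_comb_step.IH eq]) (rule forest_comb_step.hyps(1))
qed

text \<open>After one application of \<open>J\<close> a combination of forests is a combination of trees. On these \<open>D\<close> either
  vanishes or the tree has more than \<open>p\<close> vertices and is small of order \<open>p + 1\<close>.\<close>

lemma tree_comb_defect:
  assumes "forest_comb f"
    and kill: "\<And>\<tau> w. tree_size \<tau> \<le> p \<Longrightarrow> w \<in> W \<Longrightarrow> D w (tree_val w \<tau>) = 0"
  shows "\<exists>C. \<forall>w\<in>W. \<bar>D w (J w a (f w))\<bar> \<le> C * lam w ^ Suc p"
  using assms(1)
proof (induction rule: forest_comb.induct)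
  case (forest_comb_zero f)
  have "D w (J w a 0) = 0" if "w \<in> W" for w
    using J_scaleR[OF that bnd_one[OF that], of a 0] D_scaleR[of w 0] by simp
  with forest_comb_zero show ?case by (intro exI[of _ 0]) simp
next
  case (forest_comb_step c B g f \<eta>)
  obtain C where C: "\<And>w. w \<in> W \<Longrightarrow> \<bar>D w (J w a (g w))\<bar> \<le> C * lam w ^ Suc p"
    using forest_comb_step.IH by blast
  have "\<exists>C'. \<forall>w\<in>W. \<bar>D w (tree_val w (Node a \<eta>))\<bar> \<le> C' * lam w ^ Suc p"
  proof (cases "tree_size (Node a \<eta>) \<le> p")
    case True
    then show ?thesis
      by (intro exI[of _ 0] ballI) (simp only: kill[OF True] abs_zero mult_zero_left order_refl)
  next
    case False
    then have "small (Suc p) (\<lambda>w. tree_val w (Node a \<eta>))"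
      using small_weaken[OF small_tree_val, of "Suc p" "Node a \<eta>"] by (simp del: tree_size.simps)
    then show ?thesis by (rule small_D)
  qed
  then obtain C' where C': "\<And>w. w \<in> W \<Longrightarrow> \<bar>D w (tree_val w (Node a \<eta>))\<bar> \<le> C' * lam w ^ Suc p" by auto
  have "\<bar>D w (J w a (f w))\<bar> \<le> (B * C' + C) * lam w ^ Suc p" if w: "w \<in> W" for w
  proof -
    obtain E where E: "bnd w E (forest_val w \<eta>)" using small_regular[OF small_forest_val w] by blast
    obtain E' where E': "bnd w E' (g w)"
      using small_regular[OF forest_comb_small[OF forest_comb_step.hyps(2)] w] by blast
    have eq: "D w (J w a (f w)) = c w * D w (tree_val w (Node a \<eta>)) + D w (J w a (g w))"
      unfolding forest_comb_step.hyps(3)[OF w]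
      using J_add[OF w bnd_scaleR[OF w E] E'] J_scaleR[OF w E]
      by (simp add: tree_val_Node D_add D_scaleR del: tree_val.simps)
    have "\<bar>c w * D w (tree_val w (Node a \<eta>))\<bar> \<le> B * (C' * lam w ^ Suc p)"
      unfolding abs_mult using forest_comb_step.hyps(1)[OF w]
      by (intro mult_mono C' w) (linarith, simp_all)
    then show ?thesis unfolding eq using C[OF w] by (auto simp: distrib_right mult.assoc)
  qed
  then show ?case by blast
qed

text \<open>The Picard iterates \<open>P k\<close> of the polynomial equation start from zero. The distance of \<open>\<delta>\<close> to \<open>P k\<close>
  is of order \<open>k + 1\<close>: the polynomial has bounded coefficients, so it preserves the order of the
  distance, \<open>J\<close> then raises it by one, and the remainder \<open>\<rho>\<close> of order \<open>p\<close> does not interfere as long as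
  \<open>k < p\<close>. As the iterates are combinations of trees, \<open>D\<close> is of order \<open>p + 1\<close> on \<open>P p\<close> as well.\<close>

theorem fixed_point_defect:
  fixes \<delta> :: "'e::finite \<Rightarrow> 'w \<Rightarrow> 'x" and c :: "'m \<Rightarrow> 'e \<Rightarrow> 'e list \<Rightarrow> 'w \<Rightarrow> real"
  assumes \<delta>: "\<And>i. small 1 (\<delta> i)"
    and c: "\<And>a i js w. w \<in> W \<Longrightarrow> \<bar>c a i js w\<bar> \<le> B"
    and rest: "\<And>a i. small p (\<rho> a i)"
    and eq: "\<And>i w. w \<in> W \<Longrightarrow> \<delta> i w = (\<Sum>a\<in>UNIV. J w a
        ((\<Sum>n<p. \<Sum>js | length js = n. c a i js w *\<^sub>R (\<Prod>j\<leftarrow>js. \<delta> j w)) + \<rho> a i w))"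
    and kill: "\<And>\<tau> w. tree_size \<tau> \<le> p \<Longrightarrow> w \<in> W \<Longrightarrow> D w (tree_val w \<tau>) = 0"
  shows "\<exists>C. \<forall>w\<in>W. \<forall>i. \<bar>D w (\<delta> i w)\<bar> \<le> C * lam w ^ Suc p"
proof -
  define tay where "tay a i f w = (\<Sum>n<p. \<Sum>js | length js = n. c a i js w *\<^sub>R (\<Prod>j\<leftarrow>js. f j w))"
    for a i and f :: "'e \<Rightarrow> 'w \<Rightarrow> 'x" and w
  define picard where "picard f i w = (\<Sum>a\<in>UNIV. J w a (tay a i f w))" for f i w
  define P where "P k = (picard ^^ k) (\<lambda>_ _. 0)" for k
  have tay_comb: "forest_comb (tay a i f)" if "\<And>j. forest_comb (f j)" for a i f
    unfolding tay_def[abs_def]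
    by (intro forest_comb_sum forest_comb_scaleR[where B = B] forest_comb_prod_list that c)
  have P_comb: "forest_comb (P k i)" for k i
  proof (induction k arbitrary: i)
    case 0
    then show ?case by (auto simp: P_def intro: forest_comb_zero)
  next
    case (Suc k)
    have "P (Suc k) = picard (P k)" by (simp add: P_def)
    then show ?case unfolding picard_def[abs_def]
      using Suc by (auto intro!: forest_comb_sum forest_comb_J tay_comb)
  qed
  have \<delta>0: "small 0 (\<delta> i)" for i using small_weaken[OF \<delta>] by simp
  have tay0: "small 0 (tay a i f)" if "\<And>j. small 0 (f j)" for a i f
    unfolding tay_def[abs_def]
    by (intro small_sum small_scaleR[where B = B] small_prod_list0 that c)
  have rest0: "small 0 (\<rho> a i)" for a i using small_weaken[OF rest] by simp
  have close: "small (Suc k) (\<lambda>w. \<delta> i w - P k i w)" if "k \<le> p" for k i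
    using that
  proof (induction k arbitrary: i)
    case 0
    then show ?case using \<delta> by (simp add: P_def)
  next
    case (Suc k)
    \<comment> \<open>The polynomial map preserves the order of the distance because its coefficients are bounded.\<close>
    have "small (Suc k) (\<lambda>w. tay a i \<delta> w - tay a i (P k) w)" for a
      unfolding tay_def sum_subtractf[symmetric] scaleR_diff_right[symmetric]
      by (intro small_sum small_scaleR[where B = B] small_prod_list_diff c \<delta>0 forest_comb_small[OF P_comb] Suc.IH)
        (use Suc.prems in simp)
    then have "small (Suc k) (\<lambda>w. (tay a i \<delta> w - tay a i (P k) w) + \<rho> a i w)" for a
      using small_weaken[OF rest Suc.prems] by (intro small_add)
    then have sm: "small (Suc (Suc k)) (\<lambda>w. \<Sum>a\<in>UNIV. J w a ((tay a i \<delta> w - tay a i (P k) w) + \<rho> a i w))"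
      by (intro small_sum small_J)
    have "(\<Sum>a\<in>UNIV. J w a ((tay a i \<delta> w - tay a i (P k) w) + \<rho> a i w)) = \<delta> i w - P (Suc k) i w"
      if w: "w \<in> W" for w
    proof -
      have "J w a ((tay a i \<delta> w - tay a i (P k) w) + \<rho> a i w) = J w a (tay a i \<delta> w + \<rho> a i w) - J w a (tay a i (P k) w)" for a
      proof -
        have "small 0 (\<lambda>w. tay a i \<delta> w + \<rho> a i w)" by (intro small_add tay0 \<delta>0 rest0)
        then obtain C where C: "bnd w C (tay a i \<delta> w + \<rho> a i w)" using small_regular w by blast
        have "small 0 (tay a i (P k))" by (intro tay0 forest_comb_small[OF P_comb])
        then obtain C' where C': "bnd w C' (tay a i (P k) w)" using small_regular w by blast
        from J_diff[OF w C C', of a] show ?thesis by (simp add: algebra_simps)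
      qed
      moreover have "\<delta> i w = (\<Sum>a\<in>UNIV. J w a (tay a i \<delta> w + \<rho> a i w))" unfolding tay_def by (rule eq[OF w])
      moreover have "P (Suc k) i w = (\<Sum>a\<in>UNIV. J w a (tay a i (P k) w))" by (simp add: P_def picard_def)
      ultimately show ?thesis by (simp add: sum_subtractf)
    qed
    then have "small (Suc (Suc k)) (\<lambda>w. \<Sum>a\<in>UNIV. J w a ((tay a i \<delta> w - tay a i (P k) w) + \<rho> a i w))
        \<longleftrightarrow> small (Suc (Suc k)) (\<lambda>w. \<delta> i w - P (Suc k) i w)"
      by (rule small_cong)
    with sm show ?case by blast
  qed
  have D_sum: "D w (\<Sum>a\<in>A. g a) = (\<Sum>a\<in>A. D w (g a))" for w A and g :: "'m \<Rightarrow> 'x"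
  proof -
    have "D w 0 = 0" using D_scaleR[of w 0 0] by simp
    then show ?thesis using D_add by (induction A rule: infinite_finite_induct) simp_all
  qed
  have DP: "\<exists>C. \<forall>w\<in>W. \<bar>D w (P k i w)\<bar> \<le> C * lam w ^ Suc p" for k i
  proof (cases k)
    case 0
    have "D w 0 = 0" for w using D_scaleR[of w 0 0] by simp
    then show ?thesis by (auto simp: 0 P_def intro: exI[of _ 0])
  next
    case (Suc l)
    have "\<exists>C. \<forall>w\<in>W. \<bar>D w (J w a (tay a i (P l) w))\<bar> \<le> C * lam w ^ Suc p" for a
      by (rule tree_comb_defect[OF tay_comb[OF P_comb] kill])
    then obtain C where C: "\<And>a w. w \<in> W \<Longrightarrow> \<bar>D w (J w a (tay a i (P l) w))\<bar> \<le> C a * lam w ^ Suc p" by metis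
    have "\<bar>D w (P k i w)\<bar> \<le> (\<Sum>a\<in>UNIV. C a) * lam w ^ Suc p" if w: "w \<in> W" for w
    proof -
      have "P k i w = (\<Sum>a\<in>UNIV. J w a (tay a i (P l) w))" by (simp add: Suc P_def picard_def)
      then have "\<bar>D w (P k i w)\<bar> \<le> (\<Sum>a\<in>UNIV. \<bar>D w (J w a (tay a i (P l) w))\<bar>)"
        by (simp only: D_sum sum_abs)
      also have "\<dots> \<le> (\<Sum>a\<in>UNIV. C a * lam w ^ Suc p)" using C[OF w] by (intro sum_mono)
      finally show ?thesis by (simp only: sum_distrib_right)
    qed
    then show ?thesis by blast
  qed
  have "\<exists>C. \<forall>w\<in>W. \<bar>D w (\<delta> i w)\<bar> \<le> C * lam w ^ Suc p" for i
  proof -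
    obtain C where C: "\<And>w. w \<in> W \<Longrightarrow> \<bar>D w (\<delta> i w - P p i w)\<bar> \<le> C * lam w ^ Suc p"
      using small_D[OF close[OF order_refl]] by blast
    obtain C' where C': "\<And>w. w \<in> W \<Longrightarrow> \<bar>D w (P p i w)\<bar> \<le> C' * lam w ^ Suc p" using DP by blast
    have "\<bar>D w (\<delta> i w)\<bar> \<le> (C + C') * lam w ^ Suc p" if "w \<in> W" for w
      using C[OF that] C'[OF that] D_add[of w "\<delta> i w - P p i w" "P p i w"] by (simp add: distrib_right)
    then show ?thesis by blast
  qed
  then obtain C where C: "\<And>i w. w \<in> W \<Longrightarrow> \<bar>D w (\<delta> i w)\<bar> \<le> C i * lam w ^ Suc p" by metis
  have "\<bar>D w (\<delta> i w)\<bar> \<le> Max (range C) * lam w ^ Suc p" if "w \<in> W" for w i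
  proof -
    have "C i \<le> Max (range C)" by (rule Max_ge) auto
    then have "C i * lam w ^ Suc p \<le> Max (range C) * lam w ^ Suc p"
      using lam_pos[OF that] by (intro mult_right_mono) auto
    with C[OF that, of i] show ?thesis by linarith
  qed
  then show ?thesis by blast
qed

end

section \<open>Trajectories\<close>

text \<open>A controlled path, given by \<open>path\<close> and its Gubinelli derivative \<open>gub\<close>, together with a vector \<open>stg\<close> of
  stage values. The multiplication below follows the Leibniz rule in the Gubinelli derivative and is
  componentwise on stages, which gives a commutative algebra.\<close>

datatype ('d::finite, 'q) trajectory =
  Trajectory (path: "real \<Rightarrow> real") (gub: "real \<Rightarrow> (real^'d) \<Rightarrow>\<^sub>L real") (stg: "'q \<Rightarrow> real")

lemma trajectory_eqI:
  assumes "\<And>t. path f t = path g t" "\<And>t. gub f t = gub g t" "\<And>i. stg f i = stg g i"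
  shows "f = g"
  using assms by (intro trajectory.expand) auto

instantiation trajectory :: (finite, type) comm_ring_1
begin

definition "0 = Trajectory (\<lambda>_. 0) (\<lambda>_. 0) (\<lambda>_. 0)"
definition "1 = Trajectory (\<lambda>_. 1) (\<lambda>_. 0) (\<lambda>_. 1)"
definition "f + g = Trajectory (\<lambda>t. path f t + path g t) (\<lambda>t. gub f t + gub g t) (\<lambda>i. stg f i + stg g i)"
definition "f - g = Trajectory (\<lambda>t. path f t - path g t) (\<lambda>t. gub f t - gub g t) (\<lambda>i. stg f i - stg g i)"
definition "- f = Trajectory (\<lambda>t. - path f t) (\<lambda>t. - gub f t) (\<lambda>i. - stg f i)"
definition "f * g = Trajectory (\<lambda>t. path f t * path g t)
   (\<lambda>t. path g t *\<^sub>R gub f t + path f t *\<^sub>R gub g t) (\<lambda>i. stg f i * stg g i)"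

lemma trajectory_ring_sel [simp]:
  "path 0 t = 0" "gub 0 t = 0" "stg 0 i = 0"
  "path 1 t = 1" "gub 1 t = 0" "stg 1 i = 1"
  "path (f + g) t = path f t + path g t" "gub (f + g) t = gub f t + gub g t" "stg (f + g) i = stg f i + stg g i"
  "path (f - g) t = path f t - path g t" "gub (f - g) t = gub f t - gub g t" "stg (f - g) i = stg f i - stg g i"
  "path (- f) t = - path f t" "gub (- f) t = - gub f t" "stg (- f) i = - stg f i"
  "path (f * g) t = path f t * path g t"
  "gub (f * g) t = path g t *\<^sub>R gub f t + path f t *\<^sub>R gub g t" "stg (f * g) i = stg f i * stg g i"
  by (simp_all add: zero_trajectory_def one_trajectory_def plus_trajectory_def minus_trajectory_def
      uminus_trajectory_def times_trajectory_def)

instance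
proof
  show "(0 :: ('a, 'b) trajectory) \<noteq> 1"
    using trajectory_ring_sel(1,4) by (metis zero_neq_one)
qed (rule trajectory_eqI; simp add: algebra_simps)+

end

instantiation trajectory :: (finite, type) real_algebra_1
begin

definition "c *\<^sub>R f = Trajectory (\<lambda>t. c * path f t) (\<lambda>t. c *\<^sub>R gub f t) (\<lambda>i. c * stg f i)"

lemma trajectory_scaleR_sel [simp]:
  "path (c *\<^sub>R f) t = c * path f t" "gub (c *\<^sub>R f) t = c *\<^sub>R gub f t" "stg (c *\<^sub>R f) i = c * stg f i"
  by (simp_all add: scaleR_trajectory_def)

instance
  by standard (rule trajectory_eqI; simp add: algebra_simps)+

end

lemma path_sum: "path (\<Sum>i\<in>I. f i) t = (\<Sum>i\<in>I. path (f i) t)"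
  by (induction I rule: infinite_finite_induct) auto
lemma gub_sum: "gub (\<Sum>i\<in>I. f i) t = (\<Sum>i\<in>I. gub (f i) t)"
  by (induction I rule: infinite_finite_induct) auto
lemma stg_sum: "stg (\<Sum>i\<in>I. f i) k = (\<Sum>i\<in>I. stg (f i) k)"
  by (induction I rule: infinite_finite_induct) auto

text \<open>Composition with a smooth function, by the chain rule for Gubinelli derivatives. It is an
  algebra homomorphism in \<open>f\<close>, so an identity between functions turns into one between trajectories.\<close>

definition traj_comp :: "(real^'e \<Rightarrow> real) \<Rightarrow> ('e \<Rightarrow> ('d::finite, 'q) trajectory) \<Rightarrow> ('d, 'q) trajectory" where
  "traj_comp f \<delta> = Trajectory (\<lambda>t. f (\<chi> i. path (\<delta> i) t))
     (\<lambda>t. \<Sum>j\<in>UNIV. pderiv_at f j (\<chi> i. path (\<delta> i) t) *\<^sub>R gub (\<delta> j) t)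
     (\<lambda>k. f (\<chi> i. stg (\<delta> i) k))"

lemma traj_comp_sel:
  "path (traj_comp f \<delta>) t = f (\<chi> i. path (\<delta> i) t)"
  "gub (traj_comp f \<delta>) t = (\<Sum>j\<in>UNIV. pderiv_at f j (\<chi> i. path (\<delta> i) t) *\<^sub>R gub (\<delta> j) t)"
  "stg (traj_comp f \<delta>) k = f (\<chi> i. stg (\<delta> i) k)"
  by (simp_all add: traj_comp_def)

lemma pderiv_at_const: "pderiv_at (\<lambda>_. c) j x = 0"
  by (rule pderiv_at_eqI) auto

lemma pderiv_at_coord: "pderiv_at (\<lambda>z. z $ i) j x = (if j = i then 1 else 0)"
  by (rule pderiv_at_eqI[where g = "\<lambda>j. if j = i then 1 else 0"])
    (auto simp: if_distrib[of "\<lambda>x. _ * x"] cong: if_cong intro!: derivative_eq_intros bounded_linear_imp_has_derivative bounded_linear_vec_nth)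

lemma pderiv_at_add:
  assumes "f differentiable (at x)" "g differentiable (at x)"
  shows "pderiv_at (\<lambda>z. f z + g z) j x = pderiv_at f j x + pderiv_at g j x"
  by (rule pderiv_at_eqI[where g = "\<lambda>j. pderiv_at f j x + pderiv_at g j x"])
    (rule has_derivative_eq_rhs[OF has_derivative_add[OF has_derivative_pderiv_at[OF assms(1)] has_derivative_pderiv_at[OF assms(2)]]],
      simp add: sum.distrib distrib_left)

lemma pderiv_at_mult:
  assumes "f differentiable (at x)" "g differentiable (at x)"
  shows "pderiv_at (\<lambda>z. f z * g z) j x = g x * pderiv_at f j x + f x * pderiv_at g j x"
  by (rule pderiv_at_eqI[where g = "\<lambda>j. g x * pderiv_at f j x + f x * pderiv_at g j x"])
    (rule has_derivative_eq_rhs[OF has_derivative_mult[OF has_derivative_pderiv_at[OF assms(1)] has_derivative_pderiv_at[OF assms(2)]]],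
      simp add: sum.distrib sum_distrib_left sum_distrib_right algebra_simps)

lemma traj_comp_const: "traj_comp (\<lambda>_. c) \<delta> = c *\<^sub>R 1"
  by (rule trajectory_eqI) (simp_all add: traj_comp_sel pderiv_at_const)

lemma traj_comp_coord: "traj_comp (\<lambda>z. z $ i) \<delta> = \<delta> i"
  by (rule trajectory_eqI) (simp_all add: traj_comp_sel pderiv_at_coord if_distrib[of "\<lambda>x. x *\<^sub>R _"] cong: if_cong)

lemma traj_comp_add:
  assumes "\<And>x. f differentiable (at x)" "\<And>x. g differentiable (at x)"
  shows "traj_comp (\<lambda>z. f z + g z) \<delta> = traj_comp f \<delta> + traj_comp g \<delta>"
  by (rule trajectory_eqI) (simp_all add: traj_comp_sel pderiv_at_add[OF assms] scaleR_add_left sum.distrib)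

lemma traj_comp_mult:
  assumes "\<And>x. f differentiable (at x)" "\<And>x. g differentiable (at x)"
  shows "traj_comp (\<lambda>z. f z * g z) \<delta> = traj_comp f \<delta> * traj_comp g \<delta>"
  by (rule trajectory_eqI)
    (simp_all add: traj_comp_sel pderiv_at_mult[OF assms] scaleR_add_left sum.distrib scaleR_sum_right)

lemma traj_comp_sum:
  assumes "\<And>i x. i \<in> I \<Longrightarrow> f i differentiable (at x)"
  shows "traj_comp (\<lambda>z. \<Sum>i\<in>I. f i z) \<delta> = (\<Sum>i\<in>I. traj_comp (f i) \<delta>)"
  using assms
proof (induction I rule: infinite_finite_induct)
  case (insert i I)
  then have "traj_comp (\<lambda>z. f i z + (\<Sum>i\<in>I. f i z)) \<delta> = traj_comp (f i) \<delta> + traj_comp (\<lambda>z. \<Sum>i\<in>I. f i z) \<delta>"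
    by (intro traj_comp_add differentiable_sum) auto
  with insert show ?case by simp
qed (simp_all add: traj_comp_const[of 0, simplified])

lemma differentiable_coord: "(\<lambda>z::real^'e. z $ i) differentiable (at x)"
  using bounded_linear_imp_has_derivative[OF bounded_linear_vec_nth] by (blast intro: differentiableI)

lemma differentiable_monomial: "(\<lambda>z::real^'e. \<Prod>j\<leftarrow>js. z $ j) differentiable (at x)"
  by (induction js) (auto intro: differentiable_coord differentiable_mult)

lemma traj_comp_monomial: "traj_comp (\<lambda>z. \<Prod>j\<leftarrow>js. z $ j) \<delta> = (\<Prod>j\<leftarrow>js. \<delta> j)"
proof (induction js)
  case Nil
  show ?case using traj_comp_const[of 1] by simp
next
  case (Cons j js)
  then show ?case
    using traj_comp_mult[OF differentiable_coord differentiable_monomial, of j js \<delta>]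
    by (simp add: traj_comp_coord)
qed

lemma smooth_bounded_mean_value:
  fixes f :: "real^'e \<Rightarrow> real"
  assumes "\<And>x. f differentiable (at x)"
  shows "\<exists>\<xi>\<in>{0<..<1}. f y - f x = (\<Sum>j\<in>UNIV. (y $ j - x $ j) * pderiv_at f j (x + \<xi> *\<^sub>R (y - x)))"
proof -
  have der: "((\<lambda>\<theta>. f (x + \<theta> *\<^sub>R (y - x))) has_real_derivative
      (\<Sum>j\<in>UNIV. (y $ j - x $ j) * pderiv_at f j (x + \<theta> *\<^sub>R (y - x)))) (at \<theta>)" for \<theta>
  proof -
    have ray: "((\<lambda>\<theta>. x + \<theta> *\<^sub>R (y - x)) has_derivative (\<lambda>h. h *\<^sub>R (y - x))) (at \<theta>)"
      by (auto intro!: derivative_eq_intros)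
    have "((\<lambda>\<theta>. f (x + \<theta> *\<^sub>R (y - x))) has_derivative
        (\<lambda>h. \<Sum>j\<in>UNIV. (h *\<^sub>R (y - x)) $ j * pderiv_at f j (x + \<theta> *\<^sub>R (y - x)))) (at \<theta>)"
      using has_derivative_compose[OF ray has_derivative_pderiv_at[OF assms]] .
    then show ?thesis
      unfolding has_field_derivative_def
      by (rule has_derivative_eq_rhs) (auto simp: sum_distrib_left sum_distrib_right mult_ac)
  qed
  have "\<exists>\<xi>>0. \<xi> < 1 \<and> f (x + 1 *\<^sub>R (y - x)) - f (x + 0 *\<^sub>R (y - x)) =
      (1 - 0) * (\<Sum>j\<in>UNIV. (y $ j - x $ j) * pderiv_at f j (x + \<xi> *\<^sub>R (y - x)))"
    by (rule MVT2) (use der in auto)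
  then show ?thesis by auto
qed

lemma smooth_bounded_increment:
  fixes f :: "real^'e \<Rightarrow> real"
  assumes "smooth_bounded (Suc 0) M f" "\<And>j. \<bar>y $ j - x $ j\<bar> \<le> e"
  shows "\<bar>f y - f x\<bar> \<le> real CARD('e) * M * e"
proof -
  obtain \<xi> where "f y - f x = (\<Sum>j\<in>UNIV. (y $ j - x $ j) * pderiv_at f j (x + \<xi> *\<^sub>R (y - x)))"
    using smooth_bounded_mean_value[of f y x] assms(1) by auto
  also have "\<bar>\<dots>\<bar> \<le> (\<Sum>j::'e\<in>UNIV. e * M)"
    by (intro order_trans[OF sum_abs] sum_mono, unfold abs_mult, intro mult_mono)
      (use assms in \<open>auto intro: order_trans[OF abs_ge_zero]\<close>)
  finally show ?thesis by (simp add: mult_ac)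
qed

lemma smooth_bounded_taylor2:
  fixes f :: "real^'e \<Rightarrow> real"
  assumes f: "smooth_bounded (Suc (Suc 0)) M f" and e: "\<And>j. \<bar>y $ j - x $ j\<bar> \<le> e"
  shows "\<bar>f y - f x - (\<Sum>j\<in>UNIV. (y $ j - x $ j) * pderiv_at f j x)\<bar> \<le> real CARD('e) ^ 2 * M * e ^ 2"
proof -
  obtain \<xi> where \<xi>: "0 < \<xi>" "\<xi> < 1"
    and eq: "f y - f x = (\<Sum>j\<in>UNIV. (y $ j - x $ j) * pderiv_at f j (x + \<xi> *\<^sub>R (y - x)))"
    using smooth_bounded_mean_value[of f y x] f by auto
  have e0: "0 \<le> e" using e[of undefined] by linarith
  have small: "\<bar>(x + \<xi> *\<^sub>R (y - x)) $ i - x $ i\<bar> \<le> e" for i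
  proof -
    have "\<xi> * \<bar>y $ i - x $ i\<bar> \<le> 1 * e" using \<xi> e by (intro mult_mono) auto
    then show ?thesis using \<xi> by (simp add: abs_mult)
  qed
  have "f y - f x - (\<Sum>j\<in>UNIV. (y $ j - x $ j) * pderiv_at f j x)
      = (\<Sum>j\<in>UNIV. (y $ j - x $ j) * (pderiv_at f j (x + \<xi> *\<^sub>R (y - x)) - pderiv_at f j x))"
    unfolding eq by (simp add: sum_subtractf right_diff_distrib)
  also have "\<bar>\<dots>\<bar> \<le> (\<Sum>j::'e\<in>UNIV. e * (real CARD('e) * M * e))"
    using f e e0 by (intro order_trans[OF sum_abs] sum_mono, unfold abs_mult)
      (intro mult_mono smooth_bounded_increment small, auto)
  finally show ?thesis by (simp add: mult_ac power2_eq_square)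
qed

text \<open>The products of pairs in the definition of the controlled coefficients are products in the
  algebra of trajectories.\<close>

lemma prod_path_add_mset: "prod_path (add_mset x M) t = fst x t * prod_path M t"
  by (simp add: prod_path_def)

lemma prod_path_deriv_add_mset:
  "prod_path_deriv (add_mset x M) t = prod_path M t *\<^sub>R snd x t + fst x t *\<^sub>R prod_path_deriv M t"
proof -
  have scale: "(\<Sum>p\<in>#N. c *\<^sub>R k p) = c *\<^sub>R (\<Sum>p\<in>#N. k p)" for c N and k :: "(real \<Rightarrow> real) \<times> (real \<Rightarrow> (real^'b) \<Rightarrow>\<^sub>L real) \<Rightarrow> (real^'b) \<Rightarrow>\<^sub>L real"
    by (induction N) (simp_all add: scaleR_add_right)
  have "(\<Sum>p\<in>#M. prod_path (add_mset x M - {#p#}) t *\<^sub>R snd p t) = (\<Sum>p\<in>#M. fst x t *\<^sub>R (prod_path (M - {#p#}) t *\<^sub>R snd p t))"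
  proof (intro arg_cong[where f = sum_mset] image_mset_cong)
    fix p assume "p \<in># M"
    then have "add_mset x M - {#p#} = add_mset x (M - {#p#})" by simp
    then show "prod_path (add_mset x M - {#p#}) t *\<^sub>R snd p t = fst x t *\<^sub>R (prod_path (M - {#p#}) t *\<^sub>R snd p t)"
      by (simp add: prod_path_add_mset)
  qed
  also have "\<dots> = fst x t *\<^sub>R prod_path_deriv M t"
    unfolding prod_path_deriv_def by (rule scale)
  finally show ?thesis by (simp add: prod_path_deriv_def)
qed

lemma trajectory_prod_mset:
  assumes "\<And>\<tau>. \<tau> \<in># \<eta> \<Longrightarrow> path (g \<tau>) t = fst (h \<tau>) t" "\<And>\<tau>. \<tau> \<in># \<eta> \<Longrightarrow> gub (g \<tau>) t = snd (h \<tau>) t"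
  shows "path (\<Prod>\<tau>\<in>#\<eta>. g \<tau>) t = prod_path (image_mset h \<eta>) t"
    and "gub (\<Prod>\<tau>\<in>#\<eta>. g \<tau>) t = prod_path_deriv (image_mset h \<eta>) t"
proof -
  have "path (\<Prod>\<tau>\<in>#\<eta>. g \<tau>) t = prod_path (image_mset h \<eta>) t \<and> gub (\<Prod>\<tau>\<in>#\<eta>. g \<tau>) t = prod_path_deriv (image_mset h \<eta>) t"
    using assms
  proof (induction \<eta>)
    case empty
    then show ?case by (simp add: prod_path_def prod_path_deriv_def)
  next
    case (add \<tau> \<eta>)
    then show ?case by (simp add: prod_path_add_mset prod_path_deriv_add_mset)
  qed
  then show "path (\<Prod>\<tau>\<in>#\<eta>. g \<tau>) t = prod_path (image_mset h \<eta>) t"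
    and "gub (\<Prod>\<tau>\<in>#\<eta>. g \<tau>) t = prod_path_deriv (image_mset h \<eta>) t" by auto
qed

lemma stg_prod_mset: "stg (\<Prod>\<tau>\<in>#\<eta>. g \<tau>) i = (\<Prod>\<tau>\<in>#\<eta>. stg (g \<tau>) i)"
  by (induction \<eta>) auto

section \<open>Size of trajectories on an interval\<close>

text \<open>The scalar case of \<^const>\<open>diamond\<close>, for a scalar integrand and a scalar integrator.\<close>

definition area_pairing :: "real^'d^'d \<Rightarrow> ((real^'d) \<Rightarrow>\<^sub>L real) \<Rightarrow> ((real^'d) \<Rightarrow>\<^sub>L real) \<Rightarrow> real" where
  "area_pairing M g h = (\<Sum>i\<in>UNIV. \<Sum>j\<in>UNIV. M $ i $ j * (blinfun_apply g (axis i 1) * blinfun_apply h (axis j 1)))"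

lemma area_pairing_add: "area_pairing (M + N) g h = area_pairing M g h + area_pairing N g h"
  by (simp add: area_pairing_def sum.distrib distrib_right)

lemma area_pairing_add_left: "area_pairing M (g + g') h = area_pairing M g h + area_pairing M g' h"
  by (simp add: area_pairing_def sum.distrib blinfun.add_left algebra_simps)

lemma area_pairing_diff_left: "area_pairing M (g - g') h = area_pairing M g h - area_pairing M g' h"
  by (simp add: area_pairing_def sum_subtractf blinfun.diff_left algebra_simps)

lemma area_pairing_diff_right: "area_pairing M g (h - h') = area_pairing M g h - area_pairing M g h'"
  by (simp add: area_pairing_def sum_subtractf blinfun.diff_left algebra_simps)

lemma area_pairing_scaleR_left: "area_pairing M (c *\<^sub>R g) h = c * area_pairing M g h"
  by (simp add: area_pairing_def sum_distrib_left blinfun.scaleR_left mult_ac)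

lemma blinfun_apply_basis_sum:
  fixes g :: "(real^'d) \<Rightarrow>\<^sub>L real"
  shows "blinfun_apply g x = (\<Sum>i\<in>UNIV. x $ i * blinfun_apply g (axis i 1))"
  by (subst basis_expansion[symmetric, of x])
    (simp only: blinfun.sum_right scalar_mult_eq_scaleR blinfun.scaleR_right real_scaleR_def)

lemma area_pairing_tensor: "area_pairing (tensor x y) g h = blinfun_apply g x * blinfun_apply h y"
proof -
  have "blinfun_apply g x * blinfun_apply h y
      = (\<Sum>i\<in>UNIV. \<Sum>j\<in>UNIV. (x $ i * blinfun_apply g (axis i 1)) * (y $ j * blinfun_apply h (axis j 1)))"
    by (subst blinfun_apply_basis_sum[of g], subst blinfun_apply_basis_sum[of h]) (rule sum_product)
  then show ?thesis by (simp add: area_pairing_def tensor_def mult_ac)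
qed

lemma abs_mult_le: "\<bar>x\<bar> \<le> a \<Longrightarrow> \<bar>y\<bar> \<le> b \<Longrightarrow> \<bar>x * y\<bar> \<le> a * (b::real)"
  unfolding abs_mult by (intro mult_mono) auto

lemma norm_scaleR_le: "\<bar>c\<bar> \<le> a \<Longrightarrow> norm x \<le> b \<Longrightarrow> norm (c *\<^sub>R x) \<le> a * b"
  unfolding norm_scaleR by (intro mult_mono) (auto intro: order_trans[OF abs_ge_zero])

lemma abs_blinfun_le:
  fixes g :: "'v::real_normed_vector \<Rightarrow>\<^sub>L real"
  assumes "norm g \<le> a" "norm x \<le> b"
  shows "\<bar>blinfun_apply g x\<bar> \<le> a * b"
proof -
  have "\<bar>blinfun_apply g x\<bar> \<le> norm g * norm x" using norm_blinfun[of g x] by simp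
  also have "\<dots> \<le> a * b" using assms by (intro mult_mono) (auto intro: order_trans[OF norm_ge_zero])
  finally show ?thesis .
qed

lemma area_pairing_bound:
  fixes M :: "real^'d^'d"
  assumes "norm M \<le> m" "norm g \<le> a" "norm h \<le> b"
  shows "\<bar>area_pairing M g h\<bar> \<le> real CARD('d) ^ 2 * (m * (a * b))"
proof -
  have entry: "\<bar>M $ i $ j\<bar> \<le> m" for i j
    using component_le_norm_cart[of "M $ i" j] Finite_Cartesian_Product.norm_nth_le[of M i] assms(1) by linarith
  have "\<bar>area_pairing M g h\<bar> \<le> (\<Sum>i::'d\<in>UNIV. \<Sum>j::'d\<in>UNIV. m * ((a * 1) * (b * 1)))"
    unfolding area_pairing_def
    by (intro order_trans[OF sum_abs] sum_mono abs_mult_le abs_blinfun_le entry assms(2,3)) simp_all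
  then show ?thesis by (simp add: power2_eq_square mult_ac)
qed

lemma scaled_bound: "x \<le> k * m \<Longrightarrow> k \<le> K \<Longrightarrow> 0 \<le> m \<Longrightarrow> x \<le> K * (m::real)"
  by (meson mult_right_mono order_trans)

lemma joint_field_apply: "blinfun_apply (joint_field F y) z = (\<Sum>a\<in>UNIV. z $ a *\<^sub>R F a y)"
  unfolding joint_field_def
  by (subst bounded_linear_Blinfun_apply)
    (auto intro!: bounded_linear_sum bounded_linear_scaleR_left[THEN bounded_linear_compose] bounded_linear_vec_nth)

text \<open>\<open>joint_field F y\<close> is a sum over \<open>a\<close> of fixed bounded linear images of \<open>F a y\<close>.\<close>

lemma joint_field_has_derivative:
  fixes F :: "'m::finite \<Rightarrow> real^'e \<Rightarrow> real^'e"
  assumes "\<And>a. F a differentiable (at y)"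
  shows "(joint_field F has_derivative (\<lambda>v. joint_field (\<lambda>a _. frechet_derivative (F a) (at y) v) y)) (at y)"
proof -
  define G where "G a w = blinfun_scaleR_left w o\<^sub>L (blinfun_inner_left (axis a 1) :: (real^'m) \<Rightarrow>\<^sub>L real)" for a and w :: "real^'e"
  have G: "bounded_linear (G a)" for a
    unfolding G_def[abs_def]
    by (rule bounded_linear_compose[OF bounded_bilinear.bounded_linear_left[OF bounded_bilinear_blinfun_compose] bounded_linear_blinfun_scaleR_left])
  have jf: "joint_field H x = (\<Sum>a\<in>UNIV. G a (H a x))" for H :: "'m \<Rightarrow> real^'e \<Rightarrow> real^'e" and x
    by (rule blinfun_eqI) (simp add: joint_field_apply G_def blinfun.sum_left inner_axis)
  have "((\<lambda>x. \<Sum>a\<in>UNIV. G a (F a x)) has_derivative (\<lambda>v. \<Sum>a\<in>UNIV. G a (frechet_derivative (F a) (at y) v))) (at y)"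
    using assms frechet_derivative_works by (intro has_derivative_sum bounded_linear.has_derivative[OF G]) blast
  then show ?thesis unfolding jf[abs_def] .
qed

definition blinfun_component :: "'e \<Rightarrow> ('v::real_normed_vector \<Rightarrow>\<^sub>L (real^'e)) \<Rightarrow> 'v \<Rightarrow>\<^sub>L real" where
  "blinfun_component i G = blinfun_inner_left (axis i 1) o\<^sub>L G"

lemma blinfun_component_apply: "blinfun_apply (blinfun_component i G) x = blinfun_apply G x $ i"
  by (simp add: blinfun_component_def inner_axis)

lemma blinfun_component_diff: "blinfun_component i (G - H) = blinfun_component i G - blinfun_component i H"
  by (rule blinfun_eqI) (simp add: blinfun_component_apply blinfun.diff_left)

lemma norm_blinfun_component: "norm (blinfun_component i G) \<le> norm G"
proof (rule norm_blinfun_bound)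
  fix x
  have "norm (blinfun_apply (blinfun_component i G) x) \<le> norm (blinfun_apply G x)"
    unfolding blinfun_component_apply by (simp add: component_le_norm_cart)
  also have "\<dots> \<le> norm G * norm x" by (rule norm_blinfun)
  finally show "norm (blinfun_apply (blinfun_component i G) x) \<le> norm G * norm x" .
qed simp

text \<open>All constants of the data are collected in one \<open>L\<close>. The function \<open>om s t = (t - s)\<^sup>\<alpha>\<close> turns every
  Hoelder estimate into one with natural exponents. As \<open>om s s = 0\<close>, the estimates may include \<open>s = t\<close>.\<close>

locale driven_method =
  fixes \<alpha> T L :: real and X :: "real \<Rightarrow> real^'d" and XX :: "real \<Rightarrow> real \<Rightarrow> real^'d^'d"
    and Z :: "real \<Rightarrow> real^'m" and Z' :: "real \<Rightarrow> (real^'d) \<Rightarrow>\<^sub>L (real^'m)"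
    and A :: "real \<Rightarrow> real \<Rightarrow> 'm \<Rightarrow> real^'q^'q" and b :: "real \<Rightarrow> real \<Rightarrow> 'm \<Rightarrow> real^'q"
    and om :: "real \<Rightarrow> real \<Rightarrow> real" and dZ :: "'m \<Rightarrow> real \<Rightarrow> (real^'d) \<Rightarrow>\<^sub>L real"
  defines "om s t \<equiv> (t - s) powr \<alpha>"
    and "dZ a r \<equiv> blinfun_inner_left (axis a 1) o\<^sub>L Z' r"
  assumes \<alpha>: "1/3 < \<alpha>" and T: "T > 0" and L: "L \<ge> 0"
    and X_incr: "0 \<le> s \<Longrightarrow> s \<le> t \<Longrightarrow> t \<le> T \<Longrightarrow> norm (X t - X s) \<le> L * om s t"
    and XX_bound: "0 \<le> s \<Longrightarrow> s \<le> t \<Longrightarrow> t \<le> T \<Longrightarrow> norm (XX s t) \<le> L * om s t ^ 2"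
    and chen: "0 \<le> s \<Longrightarrow> s \<le> r \<Longrightarrow> r \<le> t \<Longrightarrow> t \<le> T \<Longrightarrow>
        XX s t = XX s r + XX r t + tensor (X r - X s) (X t - X r)"
    and Z_incr: "0 \<le> s \<Longrightarrow> s \<le> t \<Longrightarrow> t \<le> T \<Longrightarrow> \<bar>Z t $ a - Z s $ a\<bar> \<le> L * om s t"
    and dZ_bound: "0 \<le> s \<Longrightarrow> s \<le> T \<Longrightarrow> norm (dZ a s) \<le> L"
    and dZ_incr: "0 \<le> s \<Longrightarrow> s \<le> t \<Longrightarrow> t \<le> T \<Longrightarrow> norm (dZ a t - dZ a s) \<le> L * om s t"
    and Z_rem: "0 \<le> s \<Longrightarrow> s \<le> t \<Longrightarrow> t \<le> T \<Longrightarrow>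
        \<bar>Z t $ a - Z s $ a - blinfun_apply (dZ a s) (X t - X s)\<bar> \<le> L * om s t ^ 2"
    and A_bound: "0 \<le> u \<Longrightarrow> u < v \<Longrightarrow> v \<le> T \<Longrightarrow> \<bar>A u v a $ i $ j\<bar> \<le> L * om u v"
    and b_bound: "0 \<le> u \<Longrightarrow> u < v \<Longrightarrow> v \<le> T \<Longrightarrow> \<bar>b u v a $ i\<bar> \<le> L * om u v"
begin

text \<open>The inverse of the scale \<open>\<lambda> = om u v\<close>. A derivative of a quantity of size one at scale \<open>\<lambda>\<close> has
  size \<open>mu u v\<close>; the relations \<open>mu u v * om s t \<le> 1\<close> and \<open>1 \<le> \<Lambda> * mu u v\<close> carry all estimates below.\<close>

definition mu :: "real \<Rightarrow> real \<Rightarrow> real" where "mu u v = 1 / om u v"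
definition \<Lambda> :: real where "\<Lambda> = T powr \<alpha>"
definition d2 :: real where "d2 = real CARD('d) ^ 2"

lemma om_nonneg [simp]: "0 \<le> om s t" by (simp add: om_def)
lemma om_mono: "r \<le> s \<Longrightarrow> s \<le> t \<Longrightarrow> t \<le> x \<Longrightarrow> om s t \<le> om r x"
  unfolding om_def using \<alpha> by (intro powr_mono2) auto
lemma om_pos: "s < t \<Longrightarrow> 0 < om s t" by (simp add: om_def)
lemma mu_pos: "u < v \<Longrightarrow> 0 < mu u v" by (simp add: mu_def om_pos)
lemma mu_om: "u < v \<Longrightarrow> mu u v * om u v = 1" using om_pos[of u v] by (simp add: mu_def)
lemma mu_om_le:
  assumes "u < v" "u \<le> s" "s \<le> t" "t \<le> v"
  shows "mu u v * om s t \<le> 1"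
proof -
  have "mu u v * om s t \<le> mu u v * om u v"
    using om_mono[of u s t v] mu_pos[of u v] assms by (intro mult_left_mono) auto
  then show ?thesis using mu_om[of u v] assms by simp
qed
lemma om_le_\<Lambda>: "0 \<le> s \<Longrightarrow> s \<le> t \<Longrightarrow> t \<le> T \<Longrightarrow> om s t \<le> \<Lambda>"
  unfolding om_def \<Lambda>_def using \<alpha> by (intro powr_mono2) auto
lemma \<Lambda>_mu:
  assumes "0 \<le> u" "u < v" "v \<le> T"
  shows "1 \<le> \<Lambda> * mu u v"
proof -
  have "om u v * mu u v \<le> \<Lambda> * mu u v"
    using om_le_\<Lambda>[of u v] mu_pos[of u v] assms by (intro mult_right_mono) auto
  then show ?thesis using mu_om[of u v] assms by (simp add: mult.commute)
qed
lemma \<Lambda>_pos: "0 < \<Lambda>" using T by (simp add: \<Lambda>_def)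
lemma d2_pos: "0 < d2" by (simp add: d2_def)

abbreviation remainder :: "('d, 'q option) trajectory \<Rightarrow> real \<Rightarrow> real \<Rightarrow> real" where
  "remainder f s t \<equiv> path f t - path f s - blinfun_apply (gub f s) (X t - X s)"

text \<open>The scale-invariant size on \<open>[u,v]\<close>: rescaling the interval to length one by \<open>om u v\<close> would turn
  these four path estimates into the sup norms and Hoelder norms of a controlled path and its
  remainder, each bounded by \<open>C\<close>. A \<open>k\<close>-fold iterated integral started at \<open>u\<close> then has size of order
  \<open>\<lambda>\<^sup>k\<close>.\<close>

definition ctrl_bound :: "real \<Rightarrow> real \<Rightarrow> real \<Rightarrow> ('d, 'q option) trajectory \<Rightarrow> bool" where
  "ctrl_bound u v C f \<longleftrightarrow>
     (\<forall>t. u \<le> t \<longrightarrow> t \<le> v \<longrightarrow> \<bar>path f t\<bar> \<le> C \<and> norm (gub f t) \<le> C * mu u v) \<and>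
     (\<forall>s t. u \<le> s \<longrightarrow> s \<le> t \<longrightarrow> t \<le> v \<longrightarrow>
        norm (gub f t - gub f s) \<le> C * (mu u v ^ 2 * om s t) \<and>
        \<bar>remainder f s t\<bar> \<le> C * (mu u v ^ 2 * om s t ^ 2)) \<and>
     (\<forall>i. \<bar>stg f i\<bar> \<le> C)"

lemma ctrl_boundD:
  assumes "ctrl_bound u v C f"
  shows "u \<le> t \<Longrightarrow> t \<le> v \<Longrightarrow> \<bar>path f t\<bar> \<le> C" "u \<le> t \<Longrightarrow> t \<le> v \<Longrightarrow> norm (gub f t) \<le> C * mu u v"
    "u \<le> s \<Longrightarrow> s \<le> t \<Longrightarrow> t \<le> v \<Longrightarrow> norm (gub f t - gub f s) \<le> C * (mu u v ^ 2 * om s t)"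
    "u \<le> s \<Longrightarrow> s \<le> t \<Longrightarrow> t \<le> v \<Longrightarrow>
      \<bar>remainder f s t\<bar> \<le> C * (mu u v ^ 2 * om s t ^ 2)"
    "\<bar>stg f i\<bar> \<le> C"
  using assms by (simp_all add: ctrl_bound_def)

lemma ctrl_bound_nonneg: "ctrl_bound u v C f \<Longrightarrow> 0 \<le> C"
  using ctrl_boundD(5)[of u v C f None] by linarith

lemma ctrl_bound_mono:
  assumes "u < v" "ctrl_bound u v C f" "C \<le> C'"
  shows "ctrl_bound u v C' f"
proof -
  have "C * m \<le> C' * m" if "m \<ge> 0" for m using assms(3) that by (rule mult_right_mono)
  then have "C * mu u v \<le> C' * mu u v" "C * (mu u v ^ 2 * om s t) \<le> C' * (mu u v ^ 2 * om s t)"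
    "C * (mu u v ^ 2 * om s t ^ 2) \<le> C' * (mu u v ^ 2 * om s t ^ 2)" for s t
    using mu_pos[OF assms(1)] by auto
  then show ?thesis using assms(2,3) unfolding ctrl_bound_def by (meson order_trans)
qed

lemma ctrl_bound_one: "u < v \<Longrightarrow> ctrl_bound u v 1 1"
  using mu_pos[of u v] by (simp add: ctrl_bound_def)

lemma ctrl_bound_add:
  assumes "ctrl_bound u v C f" "ctrl_bound u v C' g"
  shows "ctrl_bound u v (C + C') (f + g)"
  unfolding ctrl_bound_def
proof (intro conjI allI impI)
  fix s t assume st: "u \<le> s" "s \<le> t" "t \<le> v"
  note F = ctrl_boundD(3,4)[OF assms(1) st] and G = ctrl_boundD(3,4)[OF assms(2) st]
  have eq: "gub (f + g) t - gub (f + g) s = (gub f t - gub f s) + (gub g t - gub g s)" by simp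
  show "norm (gub (f + g) t - gub (f + g) s) \<le> (C + C') * (mu u v ^ 2 * om s t)"
    unfolding eq distrib_right by (rule norm_triangle_mono[OF F(1) G(1)])
  show "\<bar>remainder (f + g) s t\<bar>
      \<le> (C + C') * (mu u v ^ 2 * om s t ^ 2)"
    using F(2) G(2) by (simp add: distrib_right blinfun.add_left)
next
  fix t assume t: "u \<le> t" "t \<le> v"
  note F = ctrl_boundD(1,2)[OF assms(1) t] and G = ctrl_boundD(1,2)[OF assms(2) t]
  show "\<bar>path (f + g) t\<bar> \<le> C + C'" using F G by simp
  show "norm (gub (f + g) t) \<le> (C + C') * mu u v"
    using norm_triangle_mono[OF F(2) G(2)] by (simp add: distrib_right)
next
  fix i
  show "\<bar>stg (f + g) i\<bar> \<le> C + C'" using ctrl_boundD(5)[OF assms(1), of i] ctrl_boundD(5)[OF assms(2), of i] by simp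
qed

lemma ctrl_bound_scaleR:
  assumes "ctrl_bound u v C f"
  shows "ctrl_bound u v (\<bar>c\<bar> * C) (c *\<^sub>R f)"
  unfolding ctrl_bound_def
proof (intro conjI allI impI)
  fix s t assume st: "u \<le> s" "s \<le> t" "t \<le> v"
  note F = ctrl_boundD(3,4)[OF assms(1) st]
  have "gub (c *\<^sub>R f) t - gub (c *\<^sub>R f) s = c *\<^sub>R (gub f t - gub f s)" by (simp add: scaleR_diff_right)
  then show "norm (gub (c *\<^sub>R f) t - gub (c *\<^sub>R f) s) \<le> \<bar>c\<bar> * C * (mu u v ^ 2 * om s t)"
    using mult_left_mono[OF F(1), of "\<bar>c\<bar>"] by (simp add: mult.assoc)
  have "remainder (c *\<^sub>R f) s t
     = c * (remainder f s t)"
    by (simp add: blinfun.scaleR_left right_diff_distrib)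
  then show "\<bar>remainder (c *\<^sub>R f) s t\<bar>
      \<le> \<bar>c\<bar> * C * (mu u v ^ 2 * om s t ^ 2)"
    using mult_left_mono[OF F(2), of "\<bar>c\<bar>"] by (simp add: mult.assoc abs_mult)
next
  fix t assume t: "u \<le> t" "t \<le> v"
  note F = ctrl_boundD(1,2)[OF assms(1) t]
  show "\<bar>path (c *\<^sub>R f) t\<bar> \<le> \<bar>c\<bar> * C" "norm (gub (c *\<^sub>R f) t) \<le> \<bar>c\<bar> * C * mu u v"
    using mult_left_mono[OF F(1), of "\<bar>c\<bar>"] mult_left_mono[OF F(2), of "\<bar>c\<bar>"] by (simp_all add: abs_mult mult.assoc)
next
  fix i
  show "\<bar>stg (c *\<^sub>R f) i\<bar> \<le> \<bar>c\<bar> * C"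
    using mult_left_mono[OF ctrl_boundD(5)[OF assms(1), of i], of "\<bar>c\<bar>"] by (simp add: abs_mult)
qed

lemma ctrl_bound_increment:
  assumes uv: "0 \<le> u" "u < v" "v \<le> T" and f: "ctrl_bound u v C f" and st: "u \<le> s" "s \<le> t" "t \<le> v"
  shows "\<bar>path f t - path f s\<bar> \<le> (1 + L) * C * (mu u v * om s t)"
proof -
  have C: "0 \<le> C" using f by (rule ctrl_bound_nonneg)
  have "\<bar>blinfun_apply (gub f s) (X t - X s)\<bar> \<le> C * mu u v * (L * om s t)"
    using ctrl_boundD(2)[OF f] X_incr uv st by (intro abs_blinfun_le) auto
  moreover have "C * (mu u v ^ 2 * om s t ^ 2) \<le> C * (mu u v * om s t)"
  proof -
    have "(mu u v * om s t) * (mu u v * om s t) \<le> (mu u v * om s t) * 1"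
      using mu_om_le[OF uv(2) st] mu_pos[OF uv(2)] by (intro mult_left_mono) auto
    then show ?thesis using C by (intro mult_left_mono) (simp_all add: power2_eq_square mult_ac)
  qed
  ultimately have "\<bar>path f t - path f s\<bar> \<le> C * mu u v * (L * om s t) + C * (mu u v * om s t)"
    using ctrl_boundD(4)[OF f st] by linarith
  then show ?thesis by (simp add: algebra_simps)
qed

definition K_mult :: real where "K_mult = 4 + 2 * L + (1 + L) ^ 2"

lemma K_mult: "1 \<le> K_mult" "2 \<le> K_mult" "4 + 2 * L \<le> K_mult" "2 + (1 + L) ^ 2 \<le> K_mult"
  using L by (simp_all add: K_mult_def)

text \<open>The remainder of a product is \<open>R\<^sup>f g + f R\<^sup>g\<close> plus the product of the two increments, which is of
  second order; \<open>ctrl_bound_increment\<close> supplies the increments.\<close>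

lemma ctrl_bound_mult:
  assumes uv: "0 \<le> u" "u < v" "v \<le> T" and f: "ctrl_bound u v C f" and g: "ctrl_bound u v C' g"
  shows "ctrl_bound u v (K_mult * C * C') (f * g)"
  unfolding ctrl_bound_def
proof (intro conjI allI impI)
  have C: "0 \<le> C" "0 \<le> C'" using f g by (auto dest: ctrl_bound_nonneg)
  have m: "0 < mu u v" using mu_pos uv by simp
  have CC: "x \<le> C * C' \<Longrightarrow> x \<le> K_mult * C * C'" for x
    using scaled_bound[of x 1 "C * C'" K_mult] K_mult C by (simp add: mult.assoc)
  {
    fix i show "\<bar>stg (f * g) i\<bar> \<le> K_mult * C * C'"
      using abs_mult_le[OF ctrl_boundD(5)[OF f] ctrl_boundD(5)[OF g]] by (intro CC) simp
  }
  {
    fix t assume t: "u \<le> t" "t \<le> v"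
    note F = ctrl_boundD(1,2)[OF f t] and G = ctrl_boundD(1,2)[OF g t]
    show "\<bar>path (f * g) t\<bar> \<le> K_mult * C * C'" using abs_mult_le[OF F(1) G(1)] by (intro CC) simp
    have n: "norm (path g t *\<^sub>R gub f t) \<le> C' * (C * mu u v)" "norm (path f t *\<^sub>R gub g t) \<le> C * (C' * mu u v)"
      unfolding norm_scaleR using F G C m by (auto intro!: mult_mono)
    have "norm (gub (f * g) t) \<le> C' * (C * mu u v) + C * (C' * mu u v)"
      unfolding trajectory_ring_sel by (rule norm_triangle_mono[OF n])
    then have "norm (gub (f * g) t) \<le> 2 * (C * C' * mu u v)" by (simp add: mult_ac)
    from scaled_bound[OF this K_mult(2)] show "norm (gub (f * g) t) \<le> K_mult * C * C' * mu u v"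
      using C m by (simp add: mult.assoc)
  }
  fix s t assume st: "u \<le> s" "s \<le> t" "t \<le> v"
  then have s: "u \<le> s" "s \<le> v" and t: "u \<le> t" "t \<le> v" by auto
  note F = ctrl_boundD(3,4)[OF f st] ctrl_boundD(1,2)[OF f s] ctrl_boundD(1)[OF f t]
    and G = ctrl_boundD(3,4)[OF g st] ctrl_boundD(1,2)[OF g s] ctrl_boundD(1)[OF g t]
  note dF = ctrl_bound_increment[OF uv f st] and dG = ctrl_bound_increment[OF uv g st]
  show "norm (gub (f * g) t - gub (f * g) s) \<le> K_mult * C * C' * (mu u v ^ 2 * om s t)"
  proof -
    have "gub (f * g) t - gub (f * g) s = (path g t *\<^sub>R (gub f t - gub f s) + (path g t - path g s) *\<^sub>R gub f s)
        + (path f t *\<^sub>R (gub g t - gub g s) + (path f t - path f s) *\<^sub>R gub g s)"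
      by (simp add: algebra_simps)
    also have "norm \<dots> \<le> (C' * (C * (mu u v ^ 2 * om s t)) + ((1 + L) * C' * (mu u v * om s t)) * (C * mu u v))
        + (C * (C' * (mu u v ^ 2 * om s t)) + ((1 + L) * C * (mu u v * om s t)) * (C' * mu u v))"
      by (intro norm_triangle_mono norm_scaleR_le F G dF dG)
    also have "\<dots> = (4 + 2 * L) * (C * C' * (mu u v ^ 2 * om s t))" by (simp add: algebra_simps power2_eq_square)
    finally show ?thesis
      using scaled_bound[OF _ K_mult(3)] C m by (simp add: mult.assoc)
  qed
  show "\<bar>remainder (f * g) s t\<bar>
      \<le> K_mult * C * C' * (mu u v ^ 2 * om s t ^ 2)"
  proof -
    have "remainder (f * g) s t
       = (remainder f s t) * path g s
       + path f s * (remainder g s t)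
       + (path f t - path f s) * (path g t - path g s)"
      by (simp add: algebra_simps blinfun.add_left blinfun.scaleR_left)
    moreover note abs_mult_le[OF F(2) G(3)] abs_mult_le[OF F(3) G(2)] abs_mult_le[OF dF dG]
    ultimately have "\<bar>remainder (f * g) s t\<bar>
        \<le> C * (mu u v ^ 2 * om s t ^ 2) * C' + C * (C' * (mu u v ^ 2 * om s t ^ 2))
          + ((1 + L) * C * (mu u v * om s t)) * ((1 + L) * C' * (mu u v * om s t))"
      by linarith
    also have "\<dots> = (2 + (1 + L) ^ 2) * (C * C' * (mu u v ^ 2 * om s t ^ 2))"
      by (simp add: algebra_simps power2_eq_square)
    finally show ?thesis
      using scaled_bound[OF _ K_mult(4)] C m by (simp add: mult.assoc)
  qed
qed

text \<open>Two bounded derivatives of \<open>r\<close> suffice: the first controls the value and the Gubinelli derivative,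
  the second the increments of the latter and the remainder. Subtracting \<open>r 0\<close> leaves something of
  first order in the scale. The terms that are quadratic in the displacement are not multiplied by
  \<open>mu u v\<close>; they are absorbed with \<open>1 \<le> \<Lambda> * mu u v\<close>.\<close>

lemma ctrl_bound_comp:
  assumes M: "0 \<le> M" and B: "0 \<le> B"
  shows "\<exists>C\<ge>0. \<forall>u v r \<delta>. 0 \<le> u \<longrightarrow> u < v \<longrightarrow> v \<le> T \<longrightarrow> smooth_bounded 2 M r \<longrightarrow>
      (\<forall>i::'e::finite. ctrl_bound u v (B * om u v) (\<delta> i)) \<longrightarrow>
      ctrl_bound u v (C * om u v) (traj_comp r \<delta> - r 0 *\<^sub>R 1)"
proof -
  define N where "N = real CARD('e)"
  have N: "N \<ge> 1" unfolding N_def by (simp add: Suc_leI)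
  define D where "D = (1 + L) * B"
  have D: "D \<ge> 0" using L B by (simp add: D_def)
  define C where "C = N * M * B + \<Lambda> * (N * (N * M * D) * B + N ^ 2 * M * D ^ 2)"
  have C0: "0 \<le> C" using N M B D \<Lambda>_pos by (auto simp: C_def intro!: add_nonneg_nonneg mult_nonneg_nonneg)
  have C1: "N * M * B \<le> C" using N M B D \<Lambda>_pos by (auto simp: C_def intro!: add_nonneg_nonneg mult_nonneg_nonneg)
  have "ctrl_bound u v (C * om u v) (traj_comp r \<delta> - r 0 *\<^sub>R 1)"
    if uv: "0 \<le> u" "u < v" "v \<le> T" and r: "smooth_bounded 2 M r"
      and \<delta>: "\<And>i::'e. ctrl_bound u v (B * om u v) (\<delta> i)" for u v r \<delta>
  proof -
    define l where "l = om u v"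
    define m where "m = mu u v"
    have l: "l > 0" and m: "m > 0" and lm: "l * m = 1" and \<Lambda>m: "1 \<le> \<Lambda> * m"
      using om_pos mu_pos mu_om \<Lambda>_mu uv by (auto simp: l_def m_def mult.commute)
    note \<delta>D = ctrl_boundD[OF \<delta>, folded l_def m_def]
    have r2: "smooth_bounded (Suc (Suc 0)) M r" using r by (simp only: numeral_2_eq_2)
    have r1: "smooth_bounded (Suc 0) M r" using smooth_bounded_lower[OF r2] .
    have rp: "smooth_bounded (Suc 0) M (pderiv_at r j)" for j
      using r2 smooth_bounded.simps(2)[of "Suc 0" M r] by blast
    have pM: "\<bar>pderiv_at r j x\<bar> \<le> M" for j x using smooth_bounded_bound[OF rp] .
    define P where "P t = (\<chi> i. path (\<delta> i) t)" for t
    define S where "S k = (\<chi> i. stg (\<delta> i) k)" for k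
    have Bl: "B * l * m = B" using lm by (simp add: mult.assoc)
    have Blm2: "B * l * (m ^ 2 * x) = B * (m * x)" for x
    proof -
      have "B * l * (m ^ 2 * x) = (l * m) * (B * (m * x))" by (simp add: power2_eq_square)
      then show ?thesis unfolding lm by simp
    qed
    have incr: "\<bar>P t $ j - P s $ j\<bar> \<le> D * om s t" if st: "u \<le> s" "s \<le> t" "t \<le> v" for s t j
    proof -
      have "(1 + L) * (B * l) * (m * om s t) = (l * m) * (D * om s t)" by (simp add: D_def)
      then have eq: "(1 + L) * (B * l) * (m * om s t) = D * om s t" unfolding lm by simp
      show ?thesis
        using ctrl_bound_increment[OF uv \<delta>[of j] st, folded l_def m_def, unfolded eq] by (simp add: P_def)
    qed
    have "\<bar>r (P t) - r 0\<bar> \<le> N * M * (B * l)" if "u \<le> t" "t \<le> v" for t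
      unfolding N_def using \<delta>D(1)[OF that] by (intro smooth_bounded_increment r1) (simp add: P_def)
    then have b1: "\<bar>r (P t) - r 0\<bar> \<le> C * l" if "u \<le> t" "t \<le> v" for t
      using scaled_bound[OF _ C1, of _ l] that l by (simp add: mult.assoc)
    have "\<bar>r (S k) - r 0\<bar> \<le> N * M * (B * l)" for k
      unfolding N_def using \<delta>D(5) by (intro smooth_bounded_increment r1) (simp add: S_def)
    then have b2: "\<bar>r (S k) - r 0\<bar> \<le> C * l" for k
      using scaled_bound[OF _ C1, of _ l] l by (simp add: mult.assoc)
    have b3: "norm (\<Sum>j\<in>UNIV. pderiv_at r j (P t) *\<^sub>R gub (\<delta> j) t) \<le> C * l * m" if "u \<le> t" "t \<le> v" for t
    proof -
      have "norm (\<Sum>j\<in>UNIV. pderiv_at r j (P t) *\<^sub>R gub (\<delta> j) t) \<le> (\<Sum>j::'e\<in>UNIV. M * (B * l * m))"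
        using \<delta>D(2)[OF that] by (intro sum_norm_le norm_scaleR_le pM)
      also have "\<dots> = N * M * B" using Bl by (simp add: N_def)
      finally show ?thesis using C1 lm by (simp add: mult.assoc)
    qed
    have up: "x \<le> C * (m * y)" if "x \<le> N * M * B * (m * y) + (N * (N * M * D) * B + N ^ 2 * M * D ^ 2) * y" "0 \<le> y" for x y
    proof -
      have "(N * (N * M * D) * B + N ^ 2 * M * D ^ 2) * y * 1 \<le> (N * (N * M * D) * B + N ^ 2 * M * D ^ 2) * y * (\<Lambda> * m)"
        using N M B D that \<Lambda>m by (intro mult_left_mono) auto
      with that show ?thesis by (simp add: C_def algebra_simps)
    qed
    have b4: "norm ((\<Sum>j\<in>UNIV. pderiv_at r j (P t) *\<^sub>R gub (\<delta> j) t) - (\<Sum>j\<in>UNIV. pderiv_at r j (P s) *\<^sub>R gub (\<delta> j) s))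
        \<le> C * (m * om s t)" if st: "u \<le> s" "s \<le> t" "t \<le> v" for s t
    proof -
      have eq: "(\<Sum>j\<in>UNIV. pderiv_at r j (P t) *\<^sub>R gub (\<delta> j) t) - (\<Sum>j\<in>UNIV. pderiv_at r j (P s) *\<^sub>R gub (\<delta> j) s)
        = (\<Sum>j\<in>UNIV. pderiv_at r j (P t) *\<^sub>R (gub (\<delta> j) t - gub (\<delta> j) s) + (pderiv_at r j (P t) - pderiv_at r j (P s)) *\<^sub>R gub (\<delta> j) s)"
        by (simp add: sum_subtractf sum.distrib algebra_simps)
      have "norm ((\<Sum>j\<in>UNIV. pderiv_at r j (P t) *\<^sub>R gub (\<delta> j) t) - (\<Sum>j\<in>UNIV. pderiv_at r j (P s) *\<^sub>R gub (\<delta> j) s)) \<le> (\<Sum>j::'e\<in>UNIV. M * (B * l * (m ^ 2 * om s t)) + (N * M * (D * om s t)) * (B * l * m))"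
        unfolding N_def eq using \<delta>D(2)[of s] st
        by (intro sum_norm_le norm_triangle_mono norm_scaleR_le pM \<delta>D(3) smooth_bounded_increment rp incr) auto
      also have "\<dots> = N * M * B * (m * om s t) + N * (N * M * D) * B * om s t"
      proof -
        have "M * (B * l * (m ^ 2 * om s t)) = M * (B * (m * om s t))" unfolding Blm2 ..
        moreover have "(N * M * (D * om s t)) * (B * l * m) = (N * M * (D * om s t)) * B" unfolding Bl ..
        ultimately show ?thesis unfolding sum_constant N_def[symmetric] by algebra
      qed
      also have "\<dots> \<le> N * M * B * (m * om s t) + (N * (N * M * D) * B + N ^ 2 * M * D ^ 2) * om s t"
        using N M D by (intro add_left_mono mult_right_mono) auto
      finally show ?thesis by (rule up) simp
    qed
    have b5: "\<bar>r (P t) - r (P s) - (\<Sum>j\<in>UNIV. pderiv_at r j (P s) * blinfun_apply (gub (\<delta> j) s) (X t - X s))\<bar>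
        \<le> C * (m * om s t ^ 2)" if st: "u \<le> s" "s \<le> t" "t \<le> v" for s t
    proof -
      have "\<bar>\<Sum>j\<in>UNIV. pderiv_at r j (P s) * (remainder (\<delta> j) s t)\<bar>
          \<le> (\<Sum>j::'e\<in>UNIV. M * (B * l * (m ^ 2 * om s t ^ 2)))"
        by (intro order_trans[OF sum_abs] sum_mono abs_mult_le pM \<delta>D(4) st)
      also have "\<dots> = N * M * B * (m * om s t ^ 2)" unfolding Blm2 by (simp add: N_def)
      finally have 1: "\<bar>\<Sum>j\<in>UNIV. pderiv_at r j (P s) * (remainder (\<delta> j) s t)\<bar>
          \<le> N * M * B * (m * om s t ^ 2)" .
      have 2: "\<bar>r (P t) - r (P s) - (\<Sum>j\<in>UNIV. (P t $ j - P s $ j) * pderiv_at r j (P s))\<bar> \<le> N ^ 2 * M * (D * om s t) ^ 2"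
        unfolding N_def by (intro smooth_bounded_taylor2 r2 incr st)
      have "r (P t) - r (P s) - (\<Sum>j\<in>UNIV. pderiv_at r j (P s) * blinfun_apply (gub (\<delta> j) s) (X t - X s))
          = (r (P t) - r (P s) - (\<Sum>j\<in>UNIV. (P t $ j - P s $ j) * pderiv_at r j (P s)))
          + (\<Sum>j\<in>UNIV. pderiv_at r j (P s) * (remainder (\<delta> j) s t))"
        by (simp add: P_def sum_subtractf sum.distrib algebra_simps)
      then have "\<bar>r (P t) - r (P s) - (\<Sum>j\<in>UNIV. pderiv_at r j (P s) * blinfun_apply (gub (\<delta> j) s) (X t - X s))\<bar>
          \<le> N * M * B * (m * om s t ^ 2) + N ^ 2 * M * (D * om s t) ^ 2" using 1 2 by linarith
      also have "\<dots> \<le> N * M * B * (m * om s t ^ 2) + (N * (N * M * D) * B + N ^ 2 * M * D ^ 2) * om s t ^ 2"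
        unfolding power_mult_distrib mult.assoc[symmetric, of "N ^ 2 * M"]
        using N M D B by (intro add_left_mono mult_right_mono) auto
      finally show ?thesis by (rule up) simp
    qed
    have Clm2: "C * l * (m ^ 2 * x) = C * (m * x)" for x
    proof -
      have "C * l * (m ^ 2 * x) = (l * m) * (C * (m * x))" by (simp add: power2_eq_square)
      then show ?thesis unfolding lm by simp
    qed
    show ?thesis
      unfolding ctrl_bound_def l_def[symmetric] m_def[symmetric] Clm2
      using b1 b2 b3 b4 b5
      by (simp add: traj_comp_sel P_def[symmetric] S_def[symmetric] blinfun.sum_left blinfun.scaleR_left)
  qed
  then show ?thesis using C0 by blast
qed

section \<open>Integration gains one power of the scale\<close>

text \<open>The local approximation of \<open>\<integral>\<^sub>s\<^sup>t f d\<^bold>Z\<^sup>a\<close> whose sums define the rough integral.\<close>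

definition germ :: "'m \<Rightarrow> ('d, 'q option) trajectory \<Rightarrow> real \<Rightarrow> real \<Rightarrow> real" where
  "germ a f s t = path f s * (Z t $ a - Z s $ a) + area_pairing (XX s t) (gub f s) (dZ a s)"

abbreviation germ_sum :: "'m \<Rightarrow> ('d, 'q option) trajectory \<Rightarrow> nat \<times> (nat \<Rightarrow> real) \<Rightarrow> real" where
  "germ_sum a f \<equiv> \<lambda>P. \<Sum>i<fst P. germ a f (snd P i) (snd P (Suc i))"

definition K_germ :: real where "K_germ = L + \<Lambda> * (L ^ 2 + L ^ 3) + d2 * L ^ 2 + \<Lambda> * (d2 * L ^ 2)"

lemma K_germ_nonneg: "0 \<le> K_germ"
  using L \<Lambda>_pos d2_pos by (simp add: K_germ_def)

text \<open>By Chen's relation the first-order part of \<open>f\<^sub>s\<^sub>,\<^sub>r Z\<^sub>r\<^sub>,\<^sub>t\<close> cancels against the tensor term. Every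
  remaining term is a product of increments and remainders of total order three in \<open>om\<close>.\<close>

lemma germ_defect:
  assumes uv: "0 \<le> u" "u < v" "v \<le> T" and f: "ctrl_bound u v C f"
    and st: "u \<le> s" "s \<le> r" "r \<le> t" "t \<le> v"
  shows "\<bar>germ a f s t - germ a f s r - germ a f r t\<bar> \<le> K_germ * C * (mu u v ^ 2 * om s t ^ 3)"
proof -
  define w where "w = om s t"
  define m where "m = mu u v"
  have C: "0 \<le> C" using f by (rule ctrl_bound_nonneg)
  have m: "0 < m" and w: "0 \<le> w" and \<Lambda>m: "1 \<le> \<Lambda> * m" using mu_pos \<Lambda>_mu uv by (simp_all add: m_def w_def)
  have sr: "om s r \<le> w" and rt: "om r t \<le> w" unfolding w_def using om_mono st by auto
  have sq: "om s r ^ 2 \<le> w ^ 2" "om r t ^ 2 \<le> w ^ 2" using sr rt by (auto intro: power_mono)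
  have Lm: "L * om s r \<le> L * w" "L * om r t \<le> L * w" "L * om r t ^ 2 \<le> L * w ^ 2"
    using sr rt sq L by (auto intro: mult_left_mono)
  have 0: "0 \<le> s" "0 \<le> r" "r \<le> T" "s \<le> T" "t \<le> T" using uv st by auto
  define dZf where "dZf = Z t $ a - Z r $ a"
  define Rf where "Rf = path f r - path f s - blinfun_apply (gub f s) (X r - X s)"
  define RZ where "RZ = dZf - blinfun_apply (dZ a s) (X t - X r)"
  have bX: "norm (X r - X s) \<le> L * w" "norm (X t - X r) \<le> L * w" "norm (XX r t) \<le> L * w ^ 2"
    using X_incr[of s r] X_incr[of r t] XX_bound[of r t] 0 st Lm by auto
  have bdZ: "\<bar>dZf\<bar> \<le> L * w" unfolding dZf_def using Z_incr[of r t a] 0 st Lm by auto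
  have bdz: "norm (dZ a r - dZ a s) \<le> L * w" using dZ_incr[of s r a] 0 st Lm by auto
  have bRf: "\<bar>Rf\<bar> \<le> C * (m ^ 2 * w ^ 2)"
  proof -
    have "\<bar>Rf\<bar> \<le> C * (m ^ 2 * om s r ^ 2)" unfolding Rf_def m_def using ctrl_boundD(4)[OF f] st by simp
    also have "\<dots> \<le> C * (m ^ 2 * w ^ 2)" using sq C by (intro mult_left_mono) auto
    finally show ?thesis .
  qed
  have bRZ: "\<bar>RZ\<bar> \<le> L * w ^ 2 + (L * w) * (L * w)"
  proof -
    have "RZ = (Z t $ a - Z r $ a - blinfun_apply (dZ a r) (X t - X r)) + blinfun_apply (dZ a r - dZ a s) (X t - X r)"
      by (simp add: RZ_def dZf_def blinfun.diff_left)
    moreover have "\<bar>Z t $ a - Z r $ a - blinfun_apply (dZ a r) (X t - X r)\<bar> \<le> L * w ^ 2"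
      using Z_rem[of r t a] 0 st Lm by auto
    moreover have "\<bar>blinfun_apply (dZ a r - dZ a s) (X t - X r)\<bar> \<le> (L * w) * (L * w)"
      by (intro abs_blinfun_le bdz bX)
    ultimately show ?thesis by linarith
  qed
  have gs: "norm (gub f s) \<le> C * m" unfolding m_def using ctrl_boundD(2)[OF f] st by simp
  have dg: "norm (gub f r - gub f s) \<le> C * (m ^ 2 * w)"
  proof -
    have "norm (gub f r - gub f s) \<le> C * (m ^ 2 * om s r)" unfolding m_def using ctrl_boundD(3)[OF f] st by simp
    also have "\<dots> \<le> C * (m ^ 2 * w)" using sr C by (intro mult_left_mono) auto
    finally show ?thesis .
  qed
  have "area_pairing (XX s t) (gub f s) (dZ a s) = area_pairing (XX s r) (gub f s) (dZ a s)
      + area_pairing (XX r t) (gub f s) (dZ a s)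
      + blinfun_apply (gub f s) (X r - X s) * blinfun_apply (dZ a s) (X t - X r)"
    using chen[of s r t] 0 st by (simp add: area_pairing_add area_pairing_tensor)
  then have "germ a f s t - germ a f s r - germ a f r t
     = - (Rf * dZf) - blinfun_apply (gub f s) (X r - X s) * RZ
       - area_pairing (XX r t) (gub f r - gub f s) (dZ a r) - area_pairing (XX r t) (gub f s) (dZ a r - dZ a s)"
    by (simp add: germ_def Rf_def RZ_def dZf_def area_pairing_diff_left area_pairing_diff_right algebra_simps)
  moreover have "\<bar>Rf * dZf\<bar> \<le> C * (m ^ 2 * w ^ 2) * (L * w)" by (intro abs_mult_le bRf bdZ)
  moreover have "\<bar>blinfun_apply (gub f s) (X r - X s) * RZ\<bar> \<le> (C * m * (L * w)) * (L * w ^ 2 + (L * w) * (L * w))"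
    by (intro abs_mult_le abs_blinfun_le gs bX bRZ)
  moreover have "\<bar>area_pairing (XX r t) (gub f r - gub f s) (dZ a r)\<bar> \<le> d2 * (L * w ^ 2 * (C * (m ^ 2 * w) * L))"
    unfolding d2_def by (intro area_pairing_bound bX dg dZ_bound 0)
  moreover have "\<bar>area_pairing (XX r t) (gub f s) (dZ a r - dZ a s)\<bar> \<le> d2 * (L * w ^ 2 * (C * m * (L * w)))"
    unfolding d2_def by (intro area_pairing_bound bX gs bdz)
  ultimately have "\<bar>germ a f s t - germ a f s r - germ a f r t\<bar>
     \<le> C * (m ^ 2 * w ^ 2) * (L * w) + (C * m * (L * w)) * (L * w ^ 2 + (L * w) * (L * w))
       + d2 * (L * w ^ 2 * (C * (m ^ 2 * w) * L)) + d2 * (L * w ^ 2 * (C * m * (L * w)))"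
    by linarith
  also have "\<dots> = (L + d2 * L ^ 2) * C * (m ^ 2 * w ^ 3) + (L ^ 2 + L ^ 3 + d2 * L ^ 2) * C * (m * w ^ 3) * 1"
    by (simp add: algebra_simps power2_eq_square power3_eq_cube)
  also have "\<dots> \<le> (L + d2 * L ^ 2) * C * (m ^ 2 * w ^ 3) + (L ^ 2 + L ^ 3 + d2 * L ^ 2) * C * (m * w ^ 3) * (\<Lambda> * m)"
    using L C m w d2_pos \<Lambda>m by (intro add_left_mono mult_left_mono) auto
  also have "\<dots> = K_germ * C * (m ^ 2 * w ^ 3)"
    by (simp add: K_germ_def algebra_simps power2_eq_square)
  finally show ?thesis by (simp add: m_def w_def)
qed

definition K_sew :: real where "K_sew = 2 * K_germ / (1 - 2 powr (1 - 3 * \<alpha>))"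

lemma K_sew_nonneg: "0 \<le> K_sew"
proof -
  have "2 powr (1 - 3 * \<alpha>) < (1::real)" using \<alpha> by (simp add: powr_less_one)
  then show ?thesis using K_germ_nonneg by (simp add: K_sew_def)
qed

lemma om_cube: "om s t ^ 3 = (t - s) powr (3 * \<alpha>)"
  by (simp add: om_def power3_eq_cube powr_add[symmetric])

text \<open>One function \<open>I\<close> serves all subintervals, which later relates integrals with different left
  endpoints.\<close>

lemma sewn_integral:
  assumes uv: "0 \<le> u" "u < v" "v \<le> T" and f: "ctrl_bound u v C f"
  obtains I where
    "\<And>s t. u \<le> s \<Longrightarrow> s \<le> t \<Longrightarrow> t \<le> v \<Longrightarrow> \<bar>I t - I s - germ a f s t\<bar> \<le> K_sew * C * (mu u v ^ 2 * om s t ^ 3)"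
    "\<And>s t. u \<le> s \<Longrightarrow> s \<le> t \<Longrightarrow> t \<le> v \<Longrightarrow>
      (germ_sum a f \<longlongrightarrow> I t - I s) (mesh_filter s t)"
proof -
  define K where "K = K_germ * C * mu u v ^ 2"
  have \<theta>: "3 * \<alpha> > 1" using \<alpha> by simp
  have C: "0 \<le> C" using f by (rule ctrl_bound_nonneg)
  have K: "K \<ge> 0" unfolding K_def using K_germ_nonneg C by simp
  have defect: "norm (germ a f s t - germ a f s r - germ a f r t) \<le> K * (t - s) powr (3 * \<alpha>)"
    if "u \<le> s" "s \<le> r" "r \<le> t" "t \<le> v" for s r t
    using germ_defect[OF uv f that] by (simp add: K_def om_cube[symmetric] mult.assoc)
  obtain I where I: "\<And>s t. u \<le> s \<Longrightarrow> s \<le> t \<Longrightarrow> t \<le> v \<Longrightarrow>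
      norm (I t - I s - germ a f s t) \<le> 2 * K / (1 - 2 powr (1 - 3 * \<alpha>)) * (t - s) powr (3 * \<alpha>)"
    using sewing[OF \<theta> K less_imp_le[OF uv(2)] defect] by blast
  show ?thesis
  proof (rule that)
    fix s t assume st: "u \<le> s" "s \<le> t" "t \<le> v"
    have "2 * K / (1 - 2 powr (1 - 3 * \<alpha>)) * (t - s) powr (3 * \<alpha>) = K_sew * C * (mu u v ^ 2 * om s t ^ 3)"
      by (simp add: K_def K_sew_def om_cube)
    then show "\<bar>I t - I s - germ a f s t\<bar> \<le> K_sew * C * (mu u v ^ 2 * om s t ^ 3)" using I[OF st] by simp
    show "(germ_sum a f \<longlongrightarrow> I t - I s) (mesh_filter s t)"
    proof (rule sewn_limit[OF \<theta> st(2), where J = I])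
      fix x y assume "s \<le> x" "x \<le> y" "y \<le> t"
      with st show "norm (I y - I x - germ a f x y) \<le> 2 * K / (1 - 2 powr (1 - 3 * \<alpha>)) * (y - x) powr (3 * \<alpha>)"
        by (intro I) auto
    qed
  qed
qed

abbreviation component_sum ::
    "(real \<Rightarrow> real) \<Rightarrow> (real \<Rightarrow> (real^'d) \<Rightarrow>\<^sub>L real) \<Rightarrow> 'm \<Rightarrow> nat \<times> (nat \<Rightarrow> real) \<Rightarrow> real" where
  "component_sum p g a \<equiv> rough_sum XX (\<lambda>r. blinfun_scaleR_right (p r))
     (\<lambda>r. Blinfun (\<lambda>x. blinfun_scaleR_right (blinfun_apply (g r) x))) (\<lambda>r. Z r $ a) (dZ a)"

lemma rough_sum_eq_germ_sum:
  assumes P: "P \<in> partitions s t" and eq: "\<And>r. s \<le> r \<Longrightarrow> r \<le> t \<Longrightarrow> path f r = p r \<and> gub f r = g r"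
  shows "component_sum p g a P
    = germ_sum a f P"
  unfolding rough_sum_def Let_def
proof (intro sum.cong refl)
  fix i assume i: "i \<in> {..<fst P}"
  have bl: "bounded_linear (\<lambda>x. blinfun_scaleR_right (blinfun_apply (g r) x) :: real \<Rightarrow>\<^sub>L real)" for r
    by (rule bounded_linear_compose[OF bounded_linear_blinfun_scaleR_right blinfun.bounded_linear_right])
  have r: "s \<le> snd P i" "snd P i \<le> t" using partition_points[of "fst P" "snd P" s t i] P i by auto
  show "blinfun_apply (blinfun_scaleR_right (p (snd P i))) (Z (snd P (Suc i)) $ a - Z (snd P i) $ a) +
      diamond (Blinfun (\<lambda>x. blinfun_scaleR_right (blinfun_apply (g (snd P i)) x))) (dZ a (snd P i)) (XX (snd P i) (snd P (Suc i)))
    = germ a f (snd P i) (snd P (Suc i))"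
    using eq[OF r] by (simp add: germ_def diamond_def area_pairing_def bounded_linear_Blinfun_apply[OF bl])
qed

text \<open>The operator \<open>I\<^sub>a\<close>: rough integration in the path component, the matrix \<open>A u v a\<close> in the stage
  component. The extra stage \<open>None\<close> carries the row \<open>b u v a\<close>, so that the final update of the method is
  a stage too. Outside \<open>[u,v]\<close> the path is set to zero, since the rough integral is
  meaningful only inside; without this the operator would not be linear.\<close>

definition integrate :: "real \<Rightarrow> real \<Rightarrow> 'm \<Rightarrow> ('d, 'q option) trajectory \<Rightarrow> ('d, 'q option) trajectory" where
  "integrate u v a f = Trajectory
     (\<lambda>t. if u \<le> t \<and> t \<le> v then rough_integral XX (\<lambda>r. blinfun_scaleR_right (path f r))
        (\<lambda>r. Blinfun (\<lambda>x. blinfun_scaleR_right (blinfun_apply (gub f r) x))) (\<lambda>r. Z r $ a) (dZ a) u t else 0)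
     (\<lambda>t. if u \<le> t \<and> t \<le> v then path f t *\<^sub>R dZ a t else 0)
     (\<lambda>k. case k of None \<Rightarrow> \<Sum>j\<in>UNIV. b u v a $ j * stg f (Some j)
        | Some i \<Rightarrow> \<Sum>j\<in>UNIV. A u v a $ i $ j * stg f (Some j))"

lemma integrate_sel:
  "\<not> (u \<le> t \<and> t \<le> v) \<Longrightarrow> path (integrate u v a f) t = 0"
  "gub (integrate u v a f) t = (if u \<le> t \<and> t \<le> v then path f t *\<^sub>R dZ a t else 0)"
  "stg (integrate u v a f) None = (\<Sum>j\<in>UNIV. b u v a $ j * stg f (Some j))"
  "stg (integrate u v a f) (Some i) = (\<Sum>j\<in>UNIV. A u v a $ i $ j * stg f (Some j))"
  by (auto simp: integrate_def)

lemma integrate_limit: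
  assumes uv: "0 \<le> u" "u < v" "v \<le> T" and f: "ctrl_bound u v C f" and t: "u \<le> t" "t \<le> v"
  shows "(germ_sum a f \<longlongrightarrow> path (integrate u v a f) t) (mesh_filter u t)"
proof -
  obtain I where "\<And>s t. u \<le> s \<Longrightarrow> s \<le> t \<Longrightarrow> t \<le> v \<Longrightarrow> \<bar>I t - I s - germ a f s t\<bar> \<le> K_sew * C * (mu u v ^ 2 * om s t ^ 3)"
    and I: "\<And>s t. u \<le> s \<Longrightarrow> s \<le> t \<Longrightarrow> t \<le> v \<Longrightarrow>
      (germ_sum a f \<longlongrightarrow> I t - I s) (mesh_filter s t)"
    by (rule sewn_integral[OF uv f, of a]) blast
  have "has_rough_integral XX (\<lambda>r. blinfun_scaleR_right (path f r))
        (\<lambda>r. Blinfun (\<lambda>x. blinfun_scaleR_right (blinfun_apply (gub f r) x))) (\<lambda>r. Z r $ a) (dZ a) u t (I t - I u)"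
    unfolding has_rough_integral_def
  proof (rule Lim_transform_eventually[OF I])
    show "\<forall>\<^sub>F P in mesh_filter u t. germ_sum a f P
       = component_sum (path f) (gub f) a P"
      unfolding eventually_mesh_filter
    proof (intro exI[of _ 1] conjI ballI impI)
      fix P assume P: "P \<in> partitions u t"
      show "germ_sum a f P
       = component_sum (path f) (gub f) a P"
        by (rule rough_sum_eq_germ_sum[OF P, symmetric]) simp
    qed simp
  qed (use t in auto)
  from rough_integral_eqI[OF t(1) this] have "path (integrate u v a f) t = I t - I u"
    using t by (simp add: integrate_def)
  then show ?thesis using I[of u t] t by simp
qed

text \<open>Any trajectory that agrees with \<open>(p, g)\<close> on \<open>[u,t]\<close> computes the rough integral of \<open>(p, g)\<close>, because
  the points of a partition of \<open>[u,t]\<close> lie in \<open>[u,t]\<close>. This is the bridge to the integrals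
  in the definition of the controlled coefficients.\<close>

lemma integrate_has_rough_integral:
  assumes uv: "0 \<le> u" "u < v" "v \<le> T" and f: "ctrl_bound u v C f" and t: "u \<le> t" "t \<le> v"
    and eq: "\<And>r. u \<le> r \<Longrightarrow> r \<le> t \<Longrightarrow> path f r = p r \<and> gub f r = g r"
  shows "has_rough_integral XX (\<lambda>r. blinfun_scaleR_right (p r))
        (\<lambda>r. Blinfun (\<lambda>x. blinfun_scaleR_right (blinfun_apply (g r) x))) (\<lambda>r. Z r $ a) (dZ a) u t (path (integrate u v a f) t)"
  unfolding has_rough_integral_def
proof (rule Lim_transform_eventually[OF integrate_limit[OF uv f t]])
  show "\<forall>\<^sub>F P in mesh_filter u t. germ_sum a f P
     = component_sum p g a P"
    unfolding eventually_mesh_filter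
  proof (intro exI[of _ 1] conjI ballI impI)
    fix P assume P: "P \<in> partitions u t"
    show "germ_sum a f P
     = component_sum p g a P"
      by (rule rough_sum_eq_germ_sum[OF P eq, symmetric])
  qed simp
qed

lemma integrate_pathI:
  assumes uv: "0 \<le> u" "u < v" "v \<le> T" and f: "ctrl_bound u v C f" and t: "u \<le> t" "t \<le> v"
    and "(germ_sum a f \<longlongrightarrow> x) (mesh_filter u t)"
  shows "path (integrate u v a f) t = x"
  using tendsto_unique[OF mesh_filter_neq_bot[OF t(1)] integrate_limit[OF uv f t] assms(7)] .

lemma integrate_add:
  assumes uv: "0 \<le> u" "u < v" "v \<le> T" and f: "ctrl_bound u v C f" and g: "ctrl_bound u v C' g"
  shows "integrate u v a (f + g) = integrate u v a f + integrate u v a g"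
proof (rule trajectory_eqI)
  fix t
  show "path (integrate u v a (f + g)) t = path (integrate u v a f + integrate u v a g) t"
  proof (cases "u \<le> t \<and> t \<le> v")
    case True
    then have t: "u \<le> t" "t \<le> v" by auto
    have germ: "germ a (f + g) r s = germ a f r s + germ a g r s" for r s
      by (simp add: germ_def area_pairing_add_left distrib_right)
    show ?thesis
      by (rule integrate_pathI[OF uv ctrl_bound_add[OF f g] t])
        (simp add: germ sum.distrib tendsto_add[OF integrate_limit[OF uv f t] integrate_limit[OF uv g t]])
  qed (simp add: integrate_sel)
  show "gub (integrate u v a (f + g)) t = gub (integrate u v a f + integrate u v a g) t"
    by (simp add: integrate_sel scaleR_add_left)
next
  fix k
  show "stg (integrate u v a (f + g)) k = stg (integrate u v a f + integrate u v a g) k"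
    by (cases k) (simp_all add: integrate_sel sum.distrib distrib_left)
qed

lemma integrate_scaleR:
  assumes uv: "0 \<le> u" "u < v" "v \<le> T" and f: "ctrl_bound u v C f"
  shows "integrate u v a (c *\<^sub>R f) = c *\<^sub>R integrate u v a f"
proof (rule trajectory_eqI)
  fix t
  show "path (integrate u v a (c *\<^sub>R f)) t = path (c *\<^sub>R integrate u v a f) t"
  proof (cases "u \<le> t \<and> t \<le> v")
    case True
    then have t: "u \<le> t" "t \<le> v" by auto
    have germ: "germ a (c *\<^sub>R f) r s = c * germ a f r s" for r s
      by (simp add: germ_def area_pairing_scaleR_left distrib_left)
    show ?thesis
      unfolding trajectory_scaleR_sel
      by (rule integrate_pathI[OF uv ctrl_bound_scaleR[OF f] t],
          unfold germ sum_distrib_left[symmetric], rule tendsto_mult_left[OF integrate_limit[OF uv f t]])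
  qed (simp add: integrate_sel)
  show "gub (integrate u v a (c *\<^sub>R f)) t = gub (c *\<^sub>R integrate u v a f) t"
    by (simp add: integrate_sel)
next
  fix k
  show "stg (integrate u v a (c *\<^sub>R f)) k = stg (c *\<^sub>R integrate u v a f) k"
    by (cases k) (simp_all add: integrate_sel sum_distrib_left mult_ac)
qed

definition K_int :: real where
  "K_int = K_sew + L + d2 * L ^ 2 + (1 + L) * L + \<Lambda> * L + real CARD('q) * L"

text \<open>The gain \<open>om u v\<close> in the value comes from integrating over \<open>[u,t]\<close>, which kills the integral at \<open>u\<close>.
  The Gubinelli derivative \<open>f Z'\<close> gains as well, since it is of the size of \<open>f\<close> and not of a derivative
  of \<open>f\<close>. On stages the gain is the assumed bound on the coefficients.\<close>

lemma ctrl_bound_integrate: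
  assumes uv: "0 \<le> u" "u < v" "v \<le> T" and f: "ctrl_bound u v C f"
  shows "ctrl_bound u v (K_int * om u v * C) (integrate u v a f)"
proof -
  obtain I where I: "\<And>s t. u \<le> s \<Longrightarrow> s \<le> t \<Longrightarrow> t \<le> v \<Longrightarrow> \<bar>I t - I s - germ a f s t\<bar> \<le> K_sew * C * (mu u v ^ 2 * om s t ^ 3)"
    and lim: "\<And>s t. u \<le> s \<Longrightarrow> s \<le> t \<Longrightarrow> t \<le> v \<Longrightarrow>
      (germ_sum a f \<longlongrightarrow> I t - I s) (mesh_filter s t)"
    by (rule sewn_integral[OF uv f, of a]) blast
  have path: "path (integrate u v a f) t = I t - I u" if "u \<le> t" "t \<le> v" for t
    using that by (intro integrate_pathI[OF uv f] lim) auto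
  define l where "l = om u v"
  define m where "m = mu u v"
  have l: "l > 0" and m: "m > 0" and lm: "l * m = 1" and \<Lambda>m: "1 \<le> \<Lambda> * m"
    using om_pos mu_pos mu_om \<Lambda>_mu uv by (auto simp: l_def m_def mult.commute)
  have C: "0 \<le> C" using f by (rule ctrl_bound_nonneg)
  note nonneg = K_sew_nonneg L C less_imp_le[OF d2_pos] less_imp_le[OF \<Lambda>_pos]
  note I' = I[folded m_def] and fD = ctrl_boundD[OF f, folded m_def]
  \<comment> \<open>The claimed size \<open>K_int * l * C\<close> contains the scale \<open>l\<close>, which cancels one factor \<open>m = 1 / l\<close> in each estimate for derivatives and remainders.\<close>
  have Klm: "K_int * l * C * m = K_int * C" using lm by (metis mult.assoc mult.commute mult_1)
  have Klm2: "K_int * l * C * (m ^ 2 * x) = K_int * C * (m * x)" for x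
  proof -
    have "K_int * l * C * (m ^ 2 * x) = (l * m) * (K_int * C * (m * x))" by (simp add: power2_eq_square)
    then show ?thesis unfolding lm by simp
  qed
  have germ_bound: "\<bar>area_pairing (XX s t) (gub f s) (dZ a s)\<bar> \<le> d2 * L ^ 2 * (C * (m * om s t ^ 2))"
    if "u \<le> s" "s \<le> t" "t \<le> v" for s t
  proof -
    have "\<bar>area_pairing (XX s t) (gub f s) (dZ a s)\<bar> \<le> d2 * (L * om s t ^ 2 * (C * m * L))"
      unfolding d2_def using that uv by (intro area_pairing_bound XX_bound dZ_bound fD) auto
    then show ?thesis by (simp add: mult_ac power2_eq_square)
  qed
  have mo: "m * om s t \<le> 1" if "u \<le> s" "s \<le> t" "t \<le> v" for s t
    unfolding m_def using mu_om_le[OF uv(2) that] .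
  show ?thesis
    unfolding ctrl_bound_def l_def[symmetric] m_def[symmetric] Klm Klm2
  proof (intro conjI allI impI)
    fix k
    have "\<bar>\<Sum>j\<in>UNIV. c j * stg f (Some j)\<bar> \<le> K_int * l * C" if "\<And>j::'q. \<bar>c j\<bar> \<le> L * l" for c
    proof -
      have "\<bar>\<Sum>j\<in>UNIV. c j * stg f (Some j)\<bar> \<le> (\<Sum>j::'q\<in>UNIV. (L * l) * C)"
        by (intro order_trans[OF sum_abs] sum_mono abs_mult_le that fD)
      also have "\<dots> = real CARD('q) * L * (l * C)" by simp
      also have "\<dots> \<le> K_int * (l * C)"
        using nonneg l by (intro mult_right_mono) (auto simp: K_int_def)
      finally show ?thesis by (simp add: mult.assoc)
    qed
    then show "\<bar>stg (integrate u v a f) k\<bar> \<le> K_int * l * C"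
      using A_bound b_bound uv by (cases k) (auto simp: integrate_sel l_def)
  next
    fix t assume t: "u \<le> t" "t \<le> v"
    have "norm (path f t *\<^sub>R dZ a t) \<le> C * L"
      unfolding norm_scaleR using fD(1)[OF t] dZ_bound[of t a] uv t C by (intro mult_mono) auto
    also have "\<dots> \<le> C * K_int" using nonneg by (intro mult_left_mono) (auto simp: K_int_def)
    finally show "norm (gub (integrate u v a f) t) \<le> K_int * C" using t by (simp add: integrate_sel mult.commute)
    define w where "w = om u t"
    have w: "0 \<le> w" "w \<le> l" unfolding w_def l_def using om_mono t by auto
    have mw2: "m * w ^ 2 \<le> l"
    proof -
      have "m * w * w \<le> 1 * l" using mo[of u t] t w m by (intro mult_mono) (auto simp: w_def)
      then show ?thesis by (simp add: power2_eq_square mult.assoc)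
    qed
    have mw3: "m ^ 2 * w ^ 3 \<le> l"
    proof -
      have "(m * w) * (m * w ^ 2) \<le> 1 * l" using mo[of u t] t w m mw2 by (intro mult_mono) (auto simp: w_def)
      then show ?thesis by (simp add: power2_eq_square power3_eq_cube mult_ac)
    qed
    have "\<bar>path f u * (Z t $ a - Z u $ a)\<bar> \<le> C * (L * w)"
      unfolding w_def using t uv by (intro abs_mult_le fD Z_incr) auto
    also have "\<dots> \<le> C * (L * l)" using w nonneg by (intro mult_left_mono) auto
    finally have 1: "\<bar>path f u * (Z t $ a - Z u $ a)\<bar> \<le> C * (L * l)" .
    have 2: "\<bar>area_pairing (XX u t) (gub f u) (dZ a u)\<bar> \<le> d2 * L ^ 2 * (C * l)"
      using germ_bound[of u t] t mult_left_mono[OF mw2, of "d2 * L ^ 2 * C"] nonneg by (simp add: w_def mult.assoc)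
    have 3: "\<bar>I t - I u - germ a f u t\<bar> \<le> K_sew * C * l"
      using I'[of u t] t mult_left_mono[OF mw3, of "K_sew * C"] nonneg by (simp add: w_def)
    have "\<bar>I t - I u\<bar> \<le> K_sew * C * l + C * (L * l) + d2 * L ^ 2 * (C * l)"
      using 1 2 3 unfolding germ_def by linarith
    also have "\<dots> = (K_sew + L + d2 * L ^ 2) * (l * C)" by (simp add: algebra_simps)
    also have "\<dots> \<le> K_int * (l * C)" using nonneg l by (intro mult_right_mono) (auto simp: K_int_def)
    finally show "\<bar>path (integrate u v a f) t\<bar> \<le> K_int * l * C" using path t by (simp add: mult.assoc)
  next
    fix s t assume st: "u \<le> s" "s \<le> t" "t \<le> v"
    define w where "w = om s t"
    have w: "0 \<le> w" by (simp add: w_def)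
    have up: "L * C * x \<le> \<Lambda> * L * C * (m * x)" if "0 \<le> x" for x
      using mult_left_mono[OF \<Lambda>m, of "L * C * x"] nonneg that by (simp add: mult_ac)
    have eq: "gub (integrate u v a f) t - gub (integrate u v a f) s
        = path f t *\<^sub>R (dZ a t - dZ a s) + (path f t - path f s) *\<^sub>R dZ a s"
      using st by (simp add: integrate_sel algebra_simps)
    have "norm (gub (integrate u v a f) t - gub (integrate u v a f) s) \<le> C * (L * w) + ((1 + L) * C * (m * w)) * L"
      unfolding eq w_def m_def using st uv
      by (intro norm_triangle_mono norm_scaleR_le fD dZ_incr dZ_bound ctrl_bound_increment[OF uv f]) auto
    also have "\<dots> \<le> (\<Lambda> * L + (1 + L) * L) * (C * (m * w))" using up[OF w] by (simp add: algebra_simps)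
    also have "\<dots> \<le> K_int * (C * (m * w))" using nonneg m w by (intro mult_right_mono) (auto simp: K_int_def)
    finally show "norm (gub (integrate u v a f) t - gub (integrate u v a f) s) \<le> K_int * C * (m * om s t)"
      by (simp add: mult.assoc w_def)
    have mw3: "m ^ 2 * w ^ 3 \<le> m * w ^ 2"
    proof -
      have "(m * w) * (m * w ^ 2) \<le> 1 * (m * w ^ 2)" using mo[OF st] w m by (intro mult_right_mono) (auto simp: w_def)
      then show ?thesis by (simp add: power2_eq_square power3_eq_cube mult_ac)
    qed
    have 1: "\<bar>path f s * (Z t $ a - Z s $ a - blinfun_apply (dZ a s) (X t - X s))\<bar> \<le> C * (L * w ^ 2)"
      unfolding w_def using st uv by (intro abs_mult_le fD Z_rem) auto
    have 2: "\<bar>area_pairing (XX s t) (gub f s) (dZ a s)\<bar> \<le> d2 * L ^ 2 * (C * (m * w ^ 2))"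
      unfolding w_def using germ_bound[OF st] .
    have 3: "\<bar>I t - I s - germ a f s t\<bar> \<le> K_sew * C * (m * w ^ 2)"
      using I'[OF st] mult_left_mono[OF mw3, of "K_sew * C"] nonneg by (simp add: w_def)
    have "remainder (integrate u v a f) s t
       = (I t - I s - germ a f s t) + path f s * (Z t $ a - Z s $ a - blinfun_apply (dZ a s) (X t - X s))
         + area_pairing (XX s t) (gub f s) (dZ a s)"
      using st path[of s] path[of t] by (simp add: integrate_sel germ_def blinfun.scaleR_left algebra_simps)
    then have "\<bar>remainder (integrate u v a f) s t\<bar>
        \<le> K_sew * C * (m * w ^ 2) + L * C * w ^ 2 + d2 * L ^ 2 * (C * (m * w ^ 2))"
      using 1 2 3 by (simp add: mult_ac)
    also have "\<dots> \<le> (K_sew + \<Lambda> * L + d2 * L ^ 2) * (C * (m * w ^ 2))"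
      using up[of "w ^ 2"] by (simp add: algebra_simps)
    also have "\<dots> \<le> K_int * (C * (m * w ^ 2))" using nonneg m w by (intro mult_right_mono) (auto simp: K_int_def)
    finally show "\<bar>remainder (integrate u v a f) s t\<bar>
        \<le> K_int * C * (m * om s t ^ 2)" by (simp add: mult.assoc w_def)
  qed
qed

definition intervals :: "(real \<times> real) set" where "intervals = {(u, v). 0 \<le> u \<and> u < v \<and> v \<le> T}"

definition defect :: "real \<Rightarrow> ('d, 'q option) trajectory \<Rightarrow> real" where
  "defect v f = path f v - stg f None"

definition K_all :: real where "K_all = K_mult + K_int + 2"

lemma K_int_nonneg: "0 \<le> K_int"
  using K_sew_nonneg L d2_pos \<Lambda>_pos by (simp add: K_int_def)

text \<open>Exact and numerical components are treated jointly: the functional \<open>defect v\<close> subtracts the last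
  stage from the value of the path at \<open>v\<close>.\<close>

sublocale joint: picard_algebra intervals "\<lambda>(u, v). om u v" K_all \<Lambda>
  "\<lambda>(u, v). ctrl_bound u v" "\<lambda>(u, v). integrate u v" "\<lambda>(u, v). defect v"
proof unfold_locales
  have K: "0 \<le> K_int" "1 \<le> K_mult" using K_int_nonneg K_mult by auto
  show "0 \<le> K_all" using K by (simp add: K_all_def)
  fix w assume "w \<in> intervals"
  then obtain u v where w: "w = (u, v)" and uv: "0 \<le> u" "u < v" "v \<le> T" by (auto simp: intervals_def)
  show "0 < (case w of (u, v) \<Rightarrow> om u v)" "(case w of (u, v) \<Rightarrow> om u v) \<le> \<Lambda>"
    using om_pos om_le_\<Lambda> uv by (auto simp: w)
  show "(case w of (u, v) \<Rightarrow> ctrl_bound u v) 1 1" using ctrl_bound_one uv by (simp add: w)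
  fix C f assume "(case w of (u, v) \<Rightarrow> ctrl_bound u v) C f"
  then have f: "ctrl_bound u v C f" by (simp add: w)
  have C: "0 \<le> C" using ctrl_bound_nonneg[OF f] .
  show "(case w of (u, v) \<Rightarrow> ctrl_bound u v) C' f" if "C \<le> C'" for C'
    using ctrl_bound_mono[OF uv(2) f that] by (simp add: w)
  show "(case w of (u, v) \<Rightarrow> ctrl_bound u v) (\<bar>c\<bar> * C) (c *\<^sub>R f)" for c
    using ctrl_bound_scaleR[OF f] by (simp add: w)
  show "(case w of (u, v) \<Rightarrow> ctrl_bound u v) (K_all * (case w of (u, v) \<Rightarrow> om u v) * C) ((case w of (u, v) \<Rightarrow> integrate u v) a f)" for a
  proof -
    have "K_int * om u v * C \<le> K_all * om u v * C"
      using K C by (intro mult_right_mono) (auto simp: K_all_def)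
    from ctrl_bound_mono[OF uv(2) ctrl_bound_integrate[OF uv f] this] show ?thesis by (simp add: w)
  qed
  show "(case w of (u, v) \<Rightarrow> integrate u v) a (c *\<^sub>R f) = c *\<^sub>R (case w of (u, v) \<Rightarrow> integrate u v) a f" for a c
    using integrate_scaleR[OF uv f] by (simp add: w)
  show "\<bar>(case w of (u, v) \<Rightarrow> defect v) f\<bar> \<le> K_all * C"
  proof -
    have "\<bar>defect v f\<bar> \<le> 2 * C"
      using ctrl_boundD(1)[OF f, of v] ctrl_boundD(5)[OF f, of None] uv unfolding defect_def by simp
    also have "\<dots> \<le> K_all * C" using K C by (intro mult_right_mono) (auto simp: K_all_def)
    finally show ?thesis by (simp add: w)
  qed
  fix C' g assume "(case w of (u, v) \<Rightarrow> ctrl_bound u v) C' g"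
  then have g: "ctrl_bound u v C' g" by (simp add: w)
  have C': "0 \<le> C'" using ctrl_bound_nonneg[OF g] .
  show "(case w of (u, v) \<Rightarrow> ctrl_bound u v) (C + C') (f + g)" using ctrl_bound_add[OF f g] by (simp add: w)
  show "(case w of (u, v) \<Rightarrow> ctrl_bound u v) (K_all * C * C') (f * g)"
  proof -
    have "K_mult * C * C' \<le> K_all * C * C'" using K C C' by (intro mult_right_mono) (auto simp: K_all_def)
    from ctrl_bound_mono[OF uv(2) ctrl_bound_mult[OF uv f g] this] show ?thesis by (simp add: w)
  qed
  show "(case w of (u, v) \<Rightarrow> integrate u v) a (f + g) = (case w of (u, v) \<Rightarrow> integrate u v) a f + (case w of (u, v) \<Rightarrow> integrate u v) a g" for a
    using integrate_add[OF uv f g] by (simp add: w)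
qed (auto simp: defect_def algebra_simps)

lemma tree_val_components:
  assumes uv: "0 \<le> u" "u < v" "v \<le> T"
  shows "(\<forall>t. u \<le> t \<longrightarrow> t \<le> v \<longrightarrow> path (joint.tree_val (u, v) \<tau>) t = fst (ctrl_coeff_pair XX Z Z' u \<tau>) t
      \<and> gub (joint.tree_val (u, v) \<tau>) t = snd (ctrl_coeff_pair XX Z Z' u \<tau>) t)
    \<and> (\<forall>i. stg (joint.tree_val (u, v) \<tau>) (Some i) = stage_coeff (A u v) \<tau> $ i)
    \<and> stg (joint.tree_val (u, v) \<tau>) None = num_coeff (A u v) (b u v) \<tau>"
proof (induction \<tau>)
  case (Node a \<eta>)
  let ?f = "joint.forest_val (u, v) \<eta>"
  let ?M = "image_mset (ctrl_coeff_pair XX Z Z' u) \<eta>"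
  have val: "joint.tree_val (u, v) (Node a \<eta>) = integrate u v a ?f"
    by (simp add: joint.tree_val_Node del: joint.tree_val.simps)
  have "(u, v) \<in> intervals" using uv by (simp add: intervals_def)
  then obtain C where C: "ctrl_bound u v C ?f"
    using joint.small_regular[OF joint.small_forest_val] by fastforce
  have prod: "path ?f t = prod_path ?M t \<and> gub ?f t = prod_path_deriv ?M t" if "u \<le> t" "t \<le> v" for t
    unfolding joint.forest_val_def
    using trajectory_prod_mset[of \<eta> "joint.tree_val (u, v)" t "ctrl_coeff_pair XX Z Z' u"] Node that by auto
  have stages: "(\<chi> i. \<Prod>w\<in>#image_mset (stage_coeff (A u v)) \<eta>. w $ i) = (\<chi> i. stg ?f (Some i))"
    unfolding joint.forest_val_def stg_prod_mset using Node
    by (simp add: vec_eq_iff image_mset.compositionality o_def cong: image_mset_cong)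
  have "path (integrate u v a ?f) t = fst (ctrl_coeff_pair XX Z Z' u (Node a \<eta>)) t" if t: "u \<le> t" "t \<le> v" for t
  proof -
    have "has_rough_integral XX (\<lambda>r. blinfun_scaleR_right (prod_path ?M r))
        (\<lambda>r. Blinfun (\<lambda>x. blinfun_scaleR_right (blinfun_apply (prod_path_deriv ?M r) x))) (\<lambda>r. Z r $ a) (dZ a) u t
        (path (integrate u v a ?f) t)"
      using prod t by (intro integrate_has_rough_integral[OF uv C t]) auto
    from rough_integral_eqI[OF t(1) this] show ?thesis by (simp add: Let_def dZ_def[abs_def])
  qed
  moreover have "gub (integrate u v a ?f) t = snd (ctrl_coeff_pair XX Z Z' u (Node a \<eta>)) t" if t: "u \<le> t" "t \<le> v" for t
    using prod[OF t] t by (simp add: integrate_sel Let_def dZ_def)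
  moreover have "stg (integrate u v a ?f) (Some i) = stage_coeff (A u v) (Node a \<eta>) $ i" for i
    unfolding stage_coeff.simps stages by (simp add: integrate_sel matrix_vector_mult_def)
  moreover have "stg (integrate u v a ?f) None = num_coeff (A u v) (b u v) (Node a \<eta>)"
    unfolding num_coeff.simps stages by (simp add: integrate_sel inner_vec_def)
  ultimately show ?case unfolding val by blast
qed

end

section \<open>Displacements of the exact solution and of the method\<close>

text \<open>For each interval, \<open>k u v\<close> are the stages of the method that starts in \<open>Y u\<close>.\<close>

locale rde_and_method = driven_method \<alpha> T L X XX Z Z' A b om dZ
  for \<alpha> T L :: real and X :: "real \<Rightarrow> real^'d" and XX :: "real \<Rightarrow> real \<Rightarrow> real^'d^'d"
    and Z :: "real \<Rightarrow> real^'m" and Z' :: "real \<Rightarrow> (real^'d) \<Rightarrow>\<^sub>L (real^'m)"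
    and A :: "real \<Rightarrow> real \<Rightarrow> 'm \<Rightarrow> real^'q^'q" and b :: "real \<Rightarrow> real \<Rightarrow> 'm \<Rightarrow> real^'q"
    and om :: "real \<Rightarrow> real \<Rightarrow> real" and dZ :: "'m \<Rightarrow> real \<Rightarrow> (real^'d) \<Rightarrow>\<^sub>L real" +
  fixes F :: "'m \<Rightarrow> real^'e \<Rightarrow> real^'e" and Y :: "real \<Rightarrow> real^'e" and Y' :: "real \<Rightarrow> (real^'d) \<Rightarrow>\<^sub>L (real^'e)"
    and k :: "real \<Rightarrow> real \<Rightarrow> 'q \<Rightarrow> real^'e" and y\<^sub>0 :: "real^'e" and p :: nat and M B :: real
  assumes p: "p \<ge> 1"
    and F_diff: "F a differentiable (at y)"
    and F_smooth: "smooth_bounded (Suc p) M (\<lambda>y. F a y $ i)"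
    and B: "B \<ge> 0"
    and Y_incr: "0 \<le> s \<Longrightarrow> s \<le> t \<Longrightarrow> t \<le> T \<Longrightarrow> norm (Y t - Y s) \<le> B * om s t"
    and Y'_bound: "0 \<le> s \<Longrightarrow> s \<le> T \<Longrightarrow> norm (Y' s) \<le> B"
    and Y'_incr: "0 \<le> s \<Longrightarrow> s \<le> t \<Longrightarrow> t \<le> T \<Longrightarrow> norm (Y' t - Y' s) \<le> B * om s t"
    and Y_rem: "0 \<le> s \<Longrightarrow> s \<le> t \<Longrightarrow> t \<le> T \<Longrightarrow>
        norm (Y t - Y s - blinfun_apply (Y' s) (X t - X s)) \<le> B * om s t ^ 2"
    and Y'_eq: "0 \<le> t \<Longrightarrow> t \<le> T \<Longrightarrow> Y' t = joint_field F (Y t) o\<^sub>L Z' t"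
    and solution: "0 \<le> t \<Longrightarrow> t \<le> T \<Longrightarrow> has_rough_integral XX (\<lambda>r. joint_field F (Y r))
        (\<lambda>r. Blinfun (frechet_derivative (joint_field F) (at (Y r))) o\<^sub>L Y' r) Z Z' 0 t (Y t - y\<^sub>0)"
    and stages: "0 \<le> u \<Longrightarrow> u < v \<Longrightarrow> v \<le> T \<Longrightarrow> crk_stages (A u v) F (Y u) (k u v)"
    and order: "tree_order p T XX Z Z' A b"
begin

lemma F_bound: "\<bar>F a y $ i\<bar> \<le> M"
  using smooth_bounded_bound[OF F_smooth] .

lemma M_nonneg: "0 \<le> M"
  using F_bound[of undefined 0 undefined] by linarith

text \<open>The trajectory of the deviations from \<open>Y u\<close>, with path \<open>Y t - Y u\<close> and stages \<open>k u v j - Y u\<close>; the stage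
  \<open>None\<close> is the result of the step. The path is cut off outside \<open>[u,v]\<close> to match \<^const>\<open>integrate\<close>.\<close>

definition displacement :: "'e \<Rightarrow> real \<times> real \<Rightarrow> ('d, 'q option) trajectory" where
  "displacement i = (\<lambda>(u, v). Trajectory (\<lambda>t. if u \<le> t \<and> t \<le> v then Y t $ i - Y u $ i else 0)
     (\<lambda>t. if u \<le> t \<and> t \<le> v then blinfun_component i (Y' t) else 0)
     (\<lambda>j. case j of None \<Rightarrow> crk_step (b u v) F (Y u) (k u v) $ i - Y u $ i | Some j \<Rightarrow> k u v j $ i - Y u $ i))"

lemma displacement_sel:
  "path (displacement i (u, v)) t = (if u \<le> t \<and> t \<le> v then Y t $ i - Y u $ i else 0)"
  "gub (displacement i (u, v)) t = (if u \<le> t \<and> t \<le> v then blinfun_component i (Y' t) else 0)"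
  "stg (displacement i (u, v)) None = crk_step (b u v) F (Y u) (k u v) $ i - Y u $ i"
  "stg (displacement i (u, v)) (Some j) = k u v j $ i - Y u $ i"
  by (simp_all add: displacement_def)

text \<open>The trajectory \<open>F\<^sub>a(Y\<^sub>u + \<delta>)\<close>. In the path component it is \<open>F\<^sub>a(Y)\<close>, whatever the left endpoint \<open>u\<close>.\<close>

definition field_along :: "'m \<Rightarrow> 'e \<Rightarrow> real \<times> real \<Rightarrow> ('d, 'q option) trajectory" where
  "field_along a i w = traj_comp (\<lambda>z. F a (Y (fst w) + z) $ i) (\<lambda>j. displacement j w)"

lemma field_along_path: "u \<le> t \<Longrightarrow> t \<le> v \<Longrightarrow> path (field_along a i (u, v)) t = F a (Y t) $ i"
proof -
  assume "u \<le> t" "t \<le> v"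
  then have "(\<chi> j. path (displacement j (u, v)) t) = Y t - Y u" by (simp add: vec_eq_iff displacement_sel)
  then show ?thesis by (simp add: field_along_def traj_comp_sel)
qed

lemma field_along_gub:
  assumes "u \<le> t" "t \<le> v"
  shows "gub (field_along a i (u, v)) t = (\<Sum>j\<in>UNIV. pderiv_at (\<lambda>y. F a y $ i) j (Y t) *\<^sub>R blinfun_component j (Y' t))"
proof -
  have "(\<chi> j. path (displacement j (u, v)) t) = Y t - Y u" using assms by (simp add: vec_eq_iff displacement_sel)
  moreover have "pderiv_at (\<lambda>z. F a (Y u + z) $ i) j (Y t - Y u) = pderiv_at (\<lambda>y. F a y $ i) j (Y t)" for j
    using pderiv_at_translate[of "\<lambda>y. F a y $ i" "Y u" "Y t - Y u" j] F_smooth[of a i] by simp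
  ultimately show ?thesis using assms by (simp add: field_along_def traj_comp_sel displacement_sel)
qed

lemma field_along_gub_apply:
  assumes "u \<le> t" "t \<le> v"
  shows "blinfun_apply (gub (field_along a i (u, v)) t) x = frechet_derivative (F a) (at (Y t)) (blinfun_apply (Y' t) x) $ i"
proof -
  have d1: "((\<lambda>y. F a y $ i) has_derivative (\<lambda>v. frechet_derivative (F a) (at (Y t)) v $ i)) (at (Y t))"
    using F_diff[of a "Y t"] frechet_derivative_works
    by (intro bounded_linear.has_derivative[OF bounded_linear_vec_nth]) blast
  have d2: "((\<lambda>y. F a y $ i) has_derivative (\<lambda>v. \<Sum>j\<in>UNIV. v $ j * pderiv_at (\<lambda>y. F a y $ i) j (Y t))) (at (Y t))"
    using F_smooth[of a i] by (intro has_derivative_pderiv_at) simp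
  show ?thesis
    using has_derivative_unique[OF d1 d2, THEN fun_cong, of "blinfun_apply (Y' t) x"]
    by (simp add: field_along_gub[OF assms] blinfun.sum_left blinfun.scaleR_left blinfun_component_apply mult.commute)
qed

lemma field_along_stg: "stg (field_along a i (u, v)) (Some j) = F a (k u v j) $ i"
proof -
  have "(\<chi> i. stg (displacement i (u, v)) (Some j)) = k u v j - Y u" by (simp add: vec_eq_iff displacement_sel)
  then show ?thesis by (simp add: field_along_def traj_comp_sel)
qed

definition B_disp :: real where "B_disp = B + \<Lambda> * B + real CARD('m) * (real CARD('q) * (L * M))"

lemma B_disp_nonneg: "0 \<le> B_disp"
  using B \<Lambda>_pos L M_nonneg by (simp add: B_disp_def)

lemma ctrl_bound_displacement:
  assumes uv: "0 \<le> u" "u < v" "v \<le> T"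
  shows "ctrl_bound u v (B_disp * om u v) (displacement i (u, v))"
proof -
  define l where "l = om u v"
  define m where "m = mu u v"
  have l: "l > 0" and m: "m > 0" and lm: "l * m = 1" and \<Lambda>m: "1 \<le> \<Lambda> * m"
    using om_pos mu_pos mu_om \<Lambda>_mu uv by (auto simp: l_def m_def mult.commute)
  note nonneg = B less_imp_le[OF \<Lambda>_pos] L M_nonneg
  have Klm: "B_disp * l * m = B_disp" using lm by (simp add: mult.assoc)
  have Klm2: "B_disp * l * (m ^ 2 * x) = B_disp * (m * x)" for x
  proof -
    have "B_disp * l * (m ^ 2 * x) = (l * m) * (B_disp * (m * x))" by (simp add: power2_eq_square)
    then show ?thesis unfolding lm by simp
  qed
  have up: "x \<le> B_disp * (m * y)" if "x \<le> B * y" "0 \<le> y" for x y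
  proof -
    have "B * y * 1 \<le> B * y * (\<Lambda> * m)" using \<Lambda>m B that by (intro mult_left_mono) auto
    also have "\<dots> = \<Lambda> * B * (m * y)" by simp
    also have "\<dots> \<le> B_disp * (m * y)" using nonneg m that by (intro mult_right_mono) (auto simp: B_disp_def)
    finally show ?thesis using that by simp
  qed
  show ?thesis
    unfolding ctrl_bound_def l_def[symmetric] m_def[symmetric] Klm Klm2
  proof (intro conjI allI impI)
    fix t assume t: "u \<le> t" "t \<le> v"
    have "\<bar>Y t $ i - Y u $ i\<bar> \<le> norm (Y t - Y u)" using component_le_norm_cart[of "Y t - Y u" i] by simp
    also have "\<dots> \<le> B * om u t" using Y_incr uv t by simp
    also have "\<dots> \<le> B * l" unfolding l_def using om_mono[of u u t v] t B by (intro mult_left_mono) auto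
    also have "\<dots> \<le> B_disp * l" using nonneg l by (intro mult_right_mono) (auto simp: B_disp_def)
    finally show "\<bar>path (displacement i (u, v)) t\<bar> \<le> B_disp * l" using t by (simp add: displacement_sel)
    have "norm (blinfun_component i (Y' t)) \<le> B" using norm_blinfun_component[of i "Y' t"] Y'_bound[of t] uv t by simp
    also have "\<dots> \<le> B_disp" using nonneg by (simp add: B_disp_def)
    finally show "norm (gub (displacement i (u, v)) t) \<le> B_disp" using t by (simp add: displacement_sel)
  next
    fix s t assume st: "u \<le> s" "s \<le> t" "t \<le> v"
    have "norm (blinfun_component i (Y' t - Y' s)) \<le> B * om s t"
      using norm_blinfun_component[of i "Y' t - Y' s"] Y'_incr[of s t] uv st by simp
    then show "norm (gub (displacement i (u, v)) t - gub (displacement i (u, v)) s) \<le> B_disp * (m * om s t)"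
      using st by (intro up) (simp_all add: displacement_sel blinfun_component_diff)
    have "\<bar>(Y t - Y s - blinfun_apply (Y' s) (X t - X s)) $ i\<bar> \<le> B * om s t ^ 2"
      using component_le_norm_cart[of "Y t - Y s - blinfun_apply (Y' s) (X t - X s)" i] Y_rem[of s t] uv st by linarith
    then show "\<bar>remainder (displacement i (u, v)) s t\<bar>
        \<le> B_disp * (m * om s t ^ 2)"
      using st by (intro up) (simp_all add: displacement_sel blinfun_component_apply)
  next
    fix j
    have row: "\<bar>\<Sum>a\<in>UNIV. \<Sum>j\<in>UNIV. c a j * F a (k u v j) $ i\<bar> \<le> B_disp * l" if "\<And>a (j::'q). \<bar>c a j\<bar> \<le> L * l" for c
    proof -
      have "\<bar>\<Sum>a\<in>UNIV. \<Sum>j\<in>UNIV. c a j * F a (k u v j) $ i\<bar> \<le> (\<Sum>a::'m\<in>UNIV. \<Sum>j::'q\<in>UNIV. (L * l) * M)"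
        by (intro order_trans[OF sum_abs] sum_mono abs_mult_le that F_bound)
      also have "\<dots> = real CARD('m) * (real CARD('q) * (L * M)) * l" by simp
      also have "\<dots> \<le> B_disp * l" using nonneg l by (intro mult_right_mono) (auto simp: B_disp_def)
      finally show ?thesis .
    qed
    show "\<bar>stg (displacement i (u, v)) j\<bar> \<le> B_disp * l"
    proof (cases j)
      case None
      have "stg (displacement i (u, v)) j = (\<Sum>a\<in>UNIV. \<Sum>j\<in>UNIV. b u v a $ j * F a (k u v j) $ i)"
        by (simp add: None displacement_sel crk_step_def)
      then show ?thesis using row[of "\<lambda>a j. b u v a $ j"] b_bound[OF uv] by (simp add: l_def)
    next
      case (Some j')
      have "k u v j' = Y u + (\<Sum>a\<in>UNIV. \<Sum>j\<in>UNIV. (A u v a $ j' $ j) *\<^sub>R F a (k u v j))"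
        using stages[OF uv] unfolding crk_stages_def by blast
      then have "k u v j' $ i = (Y u + (\<Sum>a\<in>UNIV. \<Sum>j\<in>UNIV. (A u v a $ j' $ j) *\<^sub>R F a (k u v j))) $ i"
        by (rule arg_cong)
      then have "stg (displacement i (u, v)) j = (\<Sum>a\<in>UNIV. \<Sum>j\<in>UNIV. A u v a $ j' $ j * F a (k u v j) $ i)"
        by (simp add: Some displacement_sel)
      then show ?thesis using row[of "\<lambda>a j. A u v a $ j' $ j"] A_bound[OF uv] by (simp add: l_def)
    qed
  qed
qed

lemma small_displacement: "joint.small 1 (displacement i)"
  by (rule joint.smallI[of B_disp]) (auto simp: intervals_def ctrl_bound_displacement)

lemma comp_displacement_bound:
  obtains C where "\<And>u v r. 0 \<le> u \<Longrightarrow> u < v \<Longrightarrow> v \<le> T \<Longrightarrow> smooth_bounded 2 M r \<Longrightarrow>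
      ctrl_bound u v (C * om u v) (traj_comp r (\<lambda>j. displacement j (u, v)) - r 0 *\<^sub>R 1)"
proof -
  from ctrl_bound_comp[OF M_nonneg B_disp_nonneg, where ?'e = 'e]
  obtain C where C: "\<forall>u v r \<delta>. 0 \<le> u \<longrightarrow> u < v \<longrightarrow> v \<le> T \<longrightarrow> smooth_bounded 2 M r \<longrightarrow>
      (\<forall>i::'e. ctrl_bound u v (B_disp * om u v) (\<delta> i)) \<longrightarrow> ctrl_bound u v (C * om u v) (traj_comp r \<delta> - r 0 *\<^sub>R 1)"
    by (elim exE conjE)
  show ?thesis
  proof (rule that)
    fix u v :: real and r :: "real^'e \<Rightarrow> real"
    assume uv: "0 \<le> u" "u < v" "v \<le> T" and r: "smooth_bounded 2 M r"
    have "\<forall>i. ctrl_bound u v (B_disp * om u v) (displacement i (u, v))" using ctrl_bound_displacement[OF uv] by simp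
    with C[rule_format, OF uv r] show "ctrl_bound u v (C * om u v) (traj_comp r (\<lambda>j. displacement j (u, v)) - r 0 *\<^sub>R 1)"
      by simp
  qed
qed

lemma field_along_regular:
  assumes uv: "0 \<le> u" "u < v" "v \<le> T"
  shows "\<exists>C. ctrl_bound u v C (field_along a i (u, v))"
proof -
  obtain C where C: "\<And>u v r. 0 \<le> u \<Longrightarrow> u < v \<Longrightarrow> v \<le> T \<Longrightarrow> smooth_bounded 2 M r \<Longrightarrow>
      ctrl_bound u v (C * om u v) (traj_comp r (\<lambda>j. displacement j (u, v)) - r 0 *\<^sub>R 1)"
    by (rule comp_displacement_bound) blast
  have lower: "smooth_bounded n M f" if "n \<le> m" "smooth_bounded m M f" for n m and f :: "real^'e \<Rightarrow> real"
    using that by (induction m rule: dec_induct) (simp_all add: smooth_bounded_lower del: smooth_bounded.simps)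
  have "smooth_bounded 2 M (\<lambda>z. F a (Y u + z) $ i)"
    by (rule lower[OF _ smooth_bounded_translate[OF F_smooth]]) (use p in simp)
  from ctrl_bound_add[OF C[OF uv this] ctrl_bound_scaleR[OF ctrl_bound_one[OF uv(2)], of "F a (Y u + 0) $ i"]]
  show ?thesis unfolding field_along_def by auto
qed

text \<open>The expansion stops at words of length \<open>p - 1\<close>, where the remainder coefficients \<open>r js\<close> still have two
  bounded derivatives, as composition requires. Splitting \<open>r js\<close> into its value at zero and the rest
  completes the polynomial of degree \<open>p - 1\<close>; the rest gains one factor of the scale and so
  contributes a total order \<open>(p - 1) + 1\<close>.\<close>

lemma field_along_taylor:
  obtains c \<rho> where "\<And>a i js w. \<bar>c a i js w\<bar> \<le> M" "\<And>a i. joint.small p (\<rho> a i)"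
    "\<And>a i w. field_along a i w = (\<Sum>n<p. \<Sum>js | length js = n. c a i js w *\<^sub>R (\<Prod>j\<leftarrow>js. displacement j w)) + \<rho> a i w"
proof -
  define N where "N = p - 1"
  have p_eq: "p = Suc N" using p by (simp add: N_def)
  define P where "P a i y cr \<longleftrightarrow> (\<forall>js. \<bar>fst cr js\<bar> \<le> M) \<and> (\<forall>js. smooth_bounded 2 M (snd cr js)) \<and>
    (\<forall>z. F a (y + z) $ i = (\<Sum>n<N. \<Sum>js | length js = n. fst cr js * (\<Prod>j\<leftarrow>js. z $ j))
            + (\<Sum>js | length js = N. (\<Prod>j\<leftarrow>js. z $ j) * snd cr js z))"
    for a i y and cr :: "('e list \<Rightarrow> real) \<times> ('e list \<Rightarrow> real^'e \<Rightarrow> real)"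
  have "\<exists>cr. P a i y cr" for a i y
  proof -
    have "smooth_bounded (N + 2) M (\<lambda>z. F a (y + z) $ i)"
      using smooth_bounded_translate[OF F_smooth[of a i], of y] by (simp add: p_eq)
    then show ?thesis unfolding P_def using taylor_hadamard[of N 2 M "\<lambda>z. F a (y + z) $ i"] by auto
  qed
  then have "P a i y (SOME cr. P a i y cr)" for a i y by (rule someI_ex)
  then obtain cr where cr: "\<And>a i y. P a i y (cr a i y)" by (rule that)
  \<comment> \<open>Words of length \<open>N = p - 1\<close> get the value of their remainder coefficient at zero as coefficient.\<close>
  define c where "c a i js w = (if length js = N then snd (cr a i (Y (fst w))) js 0 else fst (cr a i (Y (fst w))) js)"
    for a i js and w :: "real \<times> real"
  define r where "r a i js w = snd (cr a i (Y (fst w))) js" for a i js and w :: "real \<times> real"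
  have r: "smooth_bounded 2 M (r a i js w)" for a i js w using cr by (simp add: P_def r_def)
  define \<rho> where "\<rho> a i w = (\<Sum>js | length js = N. (\<Prod>j\<leftarrow>js. displacement j w) *
      (traj_comp (r a i js w) (\<lambda>j. displacement j w) - r a i js w 0 *\<^sub>R 1))" for a i w
  have c_bound: "\<bar>c a i js w\<bar> \<le> M" for a i js w
    using cr smooth_bounded_bound[OF r] by (simp add: c_def P_def r_def)
  have \<rho>_small: "joint.small p (\<rho> a i)" for a i
  proof -
    obtain C where C: "\<And>u v r. 0 \<le> u \<Longrightarrow> u < v \<Longrightarrow> v \<le> T \<Longrightarrow> smooth_bounded 2 M r \<Longrightarrow>
      ctrl_bound u v (C * om u v) (traj_comp r (\<lambda>j. displacement j (u, v)) - r 0 *\<^sub>R 1)"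
      by (rule comp_displacement_bound) blast
    have "joint.small 1 (\<lambda>w. traj_comp (r a i js w) (\<lambda>j. displacement j w) - r a i js w 0 *\<^sub>R 1)" for js
    proof (rule joint.smallI[of C])
      fix w assume "w \<in> intervals"
      then obtain u v where w: "w = (u, v)" and uv: "0 \<le> u" "u < v" "v \<le> T" by (auto simp: intervals_def)
      show "(case w of (u, v) \<Rightarrow> ctrl_bound u v) (C * (case w of (u, v) \<Rightarrow> om u v) ^ 1)
          (traj_comp (r a i js w) (\<lambda>j. displacement j w) - r a i js w 0 *\<^sub>R 1)"
        using C[OF uv r[of a i js w]] by (simp add: w)
    qed
    then have sm: "joint.small ((\<Sum>j\<leftarrow>js. 1) + 1) (\<lambda>w. (\<Prod>j\<leftarrow>js. displacement j w) *
      (traj_comp (r a i js w) (\<lambda>j. displacement j w) - r a i js w 0 *\<^sub>R 1))" for js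
      by (intro joint.small_mult joint.small_prod_list small_displacement)
    show ?thesis unfolding \<rho>_def[abs_def]
    proof (rule joint.small_sum)
      fix js :: "'e list" assume "js \<in> {js. length js = N}"
      then have "(\<Sum>j\<leftarrow>js. 1) + 1 = p" by (simp add: sum_list_triv p_eq)
      with sm[of js] show "joint.small p (\<lambda>w. (\<Prod>j\<leftarrow>js. displacement j w) *
        (traj_comp (r a i js w) (\<lambda>j. displacement j w) - r a i js w 0 *\<^sub>R 1))" by (simp only:)
    qed
  qed
  have eq: "field_along a i w = (\<Sum>n<p. \<Sum>js | length js = n. c a i js w *\<^sub>R (\<Prod>j\<leftarrow>js. displacement j w)) + \<rho> a i w" for a i w
  proof -
    let ?\<delta> = "\<lambda>j. displacement j w"
    define c0 where "c0 = fst (cr a i (Y (fst w)))"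
    have f_eq: "(\<lambda>z. F a (Y (fst w) + z) $ i) = (\<lambda>z. (\<Sum>n<N. \<Sum>js | length js = n. c0 js * (\<Prod>j\<leftarrow>js. z $ j))
            + (\<Sum>js | length js = N. (\<Prod>j\<leftarrow>js. z $ j) * r a i js w z))"
      using cr[of a i "Y (fst w)"] by (simp add: P_def c0_def r_def fun_eq_iff)
    have rd: "r a i js w differentiable (at x)" for js x using r[of a i js w] by (simp add: numeral_2_eq_2)
    have d1: "(\<lambda>z. c0 js * (\<Prod>j\<leftarrow>js. z $ j)) differentiable (at x)" for js and x :: "real^'e"
      by (intro differentiable_mult differentiable_const differentiable_monomial)
    have d2: "(\<lambda>z. (\<Prod>j\<leftarrow>js. z $ j) * r a i js w z) differentiable (at x)" for js x
      by (intro differentiable_mult rd differentiable_monomial)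
    have s1: "(\<lambda>z. \<Sum>js | length js = n. c0 js * (\<Prod>j\<leftarrow>js. z $ j)) differentiable (at x)" for n and x :: "real^'e"
      by (intro differentiable_sum finite_words ballI d1)
    have s2: "(\<lambda>z. \<Sum>n<N. \<Sum>js | length js = n. c0 js * (\<Prod>j\<leftarrow>js. z $ j)) differentiable (at x)" for x :: "real^'e"
      by (intro differentiable_sum finite_lessThan ballI s1)
    have s3: "(\<lambda>z. \<Sum>js | length js = N. (\<Prod>j\<leftarrow>js. z $ j) * r a i js w z) differentiable (at x)" for x
      by (intro differentiable_sum finite_words ballI d2)
    have t1: "traj_comp (\<lambda>z. c0 js * (\<Prod>j\<leftarrow>js. z $ j)) ?\<delta> = c0 js *\<^sub>R (\<Prod>j\<leftarrow>js. displacement j w)" for js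
      using traj_comp_mult[OF differentiable_const differentiable_monomial, of "c0 js" js ?\<delta>]
      by (simp add: traj_comp_const traj_comp_monomial)
    have t2: "traj_comp (\<lambda>z. (\<Prod>j\<leftarrow>js. z $ j) * r a i js w z) ?\<delta> = (\<Prod>j\<leftarrow>js. displacement j w) * traj_comp (r a i js w) ?\<delta>" for js
      using traj_comp_mult[OF differentiable_monomial rd, of js js ?\<delta>] by (simp add: traj_comp_monomial)
    have "field_along a i w = (\<Sum>n<N. \<Sum>js | length js = n. traj_comp (\<lambda>z. c0 js * (\<Prod>j\<leftarrow>js. z $ j)) ?\<delta>)
        + (\<Sum>js | length js = N. traj_comp (\<lambda>z. (\<Prod>j\<leftarrow>js. z $ j) * r a i js w z) ?\<delta>)"
      unfolding field_along_def f_eq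
      by (simp only: traj_comp_add[OF s2 s3] traj_comp_sum[OF s1] traj_comp_sum[OF d1] traj_comp_sum[OF d2])
    also have "\<dots> = (\<Sum>n<N. \<Sum>js | length js = n. c0 js *\<^sub>R (\<Prod>j\<leftarrow>js. displacement j w))
        + (\<Sum>js | length js = N. (\<Prod>j\<leftarrow>js. displacement j w) * traj_comp (r a i js w) ?\<delta>)"
      unfolding t1 t2 ..
    also have "(\<Sum>n<N. \<Sum>js | length js = n. c0 js *\<^sub>R (\<Prod>j\<leftarrow>js. displacement j w)) = (\<Sum>n<N. \<Sum>js | length js = n. c a i js w *\<^sub>R (\<Prod>j\<leftarrow>js. displacement j w))"
      by (intro sum.cong refl) (auto simp: c_def c0_def)
    also have "(\<Sum>js | length js = N. (\<Prod>j\<leftarrow>js. displacement j w) * traj_comp (r a i js w) ?\<delta>)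
       = (\<Sum>js | length js = N. c a i js w *\<^sub>R (\<Prod>j\<leftarrow>js. displacement j w)) + \<rho> a i w"
      unfolding \<rho>_def sum.distrib[symmetric]
      by (intro sum.cong refl) (simp add: c_def r_def algebra_simps)
    finally show ?thesis by (simp add: p_eq add.assoc)
  qed
  show ?thesis by (rule that[OF c_bound \<rho>_small eq])
qed

section \<open>The common fixed-point equation\<close>

abbreviation rde_sum :: "nat \<times> (nat \<Rightarrow> real) \<Rightarrow> real^'e" where
  "rde_sum \<equiv> rough_sum XX (\<lambda>r. joint_field F (Y r))
     (\<lambda>r. Blinfun (frechet_derivative (joint_field F) (at (Y r))) o\<^sub>L Y' r) Z Z'"

lemma rough_sum_component:
  assumes P: "P \<in> partitions 0 t" and t: "t \<le> T"
  shows "rde_sum P $ i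
    = (\<Sum>a\<in>UNIV. germ_sum a (field_along a i (0, T)) P)"
proof -
  have step: "(blinfun_apply (joint_field F (Y r)) (Z s - Z r) +
      diamond (Blinfun (frechet_derivative (joint_field F) (at (Y r))) o\<^sub>L Y' r) (Z' r) (XX r s)) $ i
    = (\<Sum>a\<in>UNIV. germ a (field_along a i (0, T)) r s)" if r: "0 \<le> r" "r \<le> T" for r s
  proof -
    have D: "(joint_field F has_derivative (\<lambda>v. joint_field (\<lambda>a _. frechet_derivative (F a) (at (Y r)) v) (Y r))) (at (Y r))"
      by (intro joint_field_has_derivative F_diff)
    have fd: "frechet_derivative (joint_field F) (at (Y r)) = (\<lambda>v. joint_field (\<lambda>a _. frechet_derivative (F a) (at (Y r)) v) (Y r))"
      using frechet_derivative_at[OF D] by simp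
    have bl: "bounded_linear (\<lambda>v. joint_field (\<lambda>a _. frechet_derivative (F a) (at (Y r)) v) (Y r))"
      using D by (rule has_derivative_bounded_linear)
    have "diamond (Blinfun (frechet_derivative (joint_field F) (at (Y r))) o\<^sub>L Y' r) (Z' r) (XX r s) $ i
      = (\<Sum>x\<in>UNIV. \<Sum>y\<in>UNIV. \<Sum>a\<in>UNIV. XX r s $ x $ y *
          (frechet_derivative (F a) (at (Y r)) (blinfun_apply (Y' r) (axis x 1)) $ i * blinfun_apply (Z' r) (axis y 1) $ a))"
      unfolding diamond_def fd
      by (simp add: bounded_linear_Blinfun_apply[OF bl] joint_field_apply sum_distrib_left mult_ac)
    also have "\<dots> = (\<Sum>a\<in>UNIV. area_pairing (XX r s) (gub (field_along a i (0, T)) r) (dZ a r))"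
      unfolding area_pairing_def
      by (subst sum.swap[of _ UNIV "UNIV :: 'm set"], subst sum.swap[of _ "UNIV :: 'm set"])
        (simp add: field_along_gub_apply r dZ_def inner_axis)
    finally have "diamond (Blinfun (frechet_derivative (joint_field F) (at (Y r))) o\<^sub>L Y' r) (Z' r) (XX r s) $ i
      = (\<Sum>a\<in>UNIV. area_pairing (XX r s) (gub (field_along a i (0, T)) r) (dZ a r))" .
    then show ?thesis
      by (simp add: germ_def field_along_path r joint_field_apply sum.distrib mult.commute)
  qed
  have "rde_sum P $ i
      = (\<Sum>n<fst P. \<Sum>a\<in>UNIV. germ a (field_along a i (0, T)) (snd P n) (snd P (Suc n)))"
    unfolding rough_sum_def Let_def sum_component
  proof (intro sum.cong refl step)
    fix n assume "n \<in> {..<fst P}"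
    then show "0 \<le> snd P n" "snd P n \<le> T"
      using partition_points[of "fst P" "snd P" 0 t n] P t by auto
  qed
  also have "\<dots> = (\<Sum>a\<in>UNIV. germ_sum a (field_along a i (0, T)) P)" by (rule sum.swap)
  finally show ?thesis .
qed

text \<open>The solution is given by integrals starting at \<open>0\<close>. Sewing on the whole of \<open>[0,T]\<close> produces one
  additive function per direction whose increments are the integrals over all subintervals, so
  differences of integrals from \<open>0\<close> are integrals from \<open>u\<close>.\<close>

lemma solution_increment:
  assumes uv: "0 \<le> u" "u < v" "v \<le> T" and t: "u \<le> t" "t \<le> v"
  shows "Y t $ i - Y u $ i = (\<Sum>a\<in>UNIV. path (integrate u v a (field_along a i (u, v))) t)"
proof -
  have full: "0 \<le> (0::real)" "0 < T" "T \<le> T" using T by auto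
  \<comment> \<open>\<open>additive a I\<close>: the increments of \<open>I\<close> are the integrals in direction \<open>a\<close> over all subintervals of \<open>[0,T]\<close>.\<close>
  define additive where "additive a I \<longleftrightarrow> (\<forall>s t. 0 \<le> s \<longrightarrow> s \<le> t \<longrightarrow> t \<le> T \<longrightarrow>
      (germ_sum a (field_along a i (0, T)) \<longlongrightarrow> I t - I s) (mesh_filter s t))"
    for a and I :: "real \<Rightarrow> real"
  have "\<exists>I. additive a I" for a
  proof -
    obtain C where C: "ctrl_bound 0 T C (field_along a i (0, T))" using field_along_regular[OF full] by blast
    obtain I where "\<And>s t. 0 \<le> s \<Longrightarrow> s \<le> t \<Longrightarrow> t \<le> T \<Longrightarrow> \<bar>I t - I s - germ a (field_along a i (0, T)) s t\<bar> \<le> K_sew * C * (mu 0 T ^ 2 * om s t ^ 3)"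
      and I: "\<And>s t. 0 \<le> s \<Longrightarrow> s \<le> t \<Longrightarrow> t \<le> T \<Longrightarrow>
        (germ_sum a (field_along a i (0, T)) \<longlongrightarrow> I t - I s) (mesh_filter s t)"
      by (rule sewn_integral[OF full C, of a]) blast
    then show ?thesis unfolding additive_def by (intro exI[of _ I] allI impI I)
  qed
  then obtain I where "\<And>a. additive a (I a)" by metis
  then have I: "0 \<le> s \<Longrightarrow> s \<le> t \<Longrightarrow> t \<le> T \<Longrightarrow>
      (germ_sum a (field_along a i (0, T)) \<longlongrightarrow> I a t - I a s) (mesh_filter s t)" for a s t
    unfolding additive_def by simp
  have sol: "Y s $ i - y\<^sub>0 $ i = (\<Sum>a\<in>UNIV. I a s - I a 0)" if s: "0 \<le> s" "s \<le> T" for s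
  proof (rule tendsto_unique[OF mesh_filter_neq_bot[OF s(1)]])
    show "((\<lambda>P. \<Sum>a\<in>UNIV. germ_sum a (field_along a i (0, T)) P) \<longlongrightarrow> (\<Sum>a\<in>UNIV. I a s - I a 0)) (mesh_filter 0 s)"
      using s by (intro tendsto_sum I) auto
    have "((\<lambda>P. rde_sum P $ i)
        \<longlongrightarrow> (Y s - y\<^sub>0) $ i) (mesh_filter 0 s)"
      using solution[OF s] unfolding has_rough_integral_def by (rule tendsto_vec_nth)
    moreover have "\<forall>\<^sub>F P in mesh_filter 0 s.
        rde_sum P $ i
        = (\<Sum>a\<in>UNIV. germ_sum a (field_along a i (0, T)) P)"
      unfolding eventually_mesh_filter
      by (intro exI[of _ 1] conjI ballI impI rough_sum_component[OF _ s(2)]) auto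
    ultimately show "((\<lambda>P. \<Sum>a\<in>UNIV. germ_sum a (field_along a i (0, T)) P) \<longlongrightarrow> Y s $ i - y\<^sub>0 $ i) (mesh_filter 0 s)"
      using Lim_transform_eventually by fastforce
  qed
  have "path (integrate u v a (field_along a i (u, v))) t = I a t - I a u" for a
  proof -
    obtain C where C: "ctrl_bound u v C (field_along a i (u, v))" using field_along_regular[OF uv] by blast
    show ?thesis
    proof (rule integrate_pathI[OF uv C t], rule Lim_transform_eventually[OF I])
      show "0 \<le> u" "u \<le> t" "t \<le> T" using uv t by auto
      have "germ_sum a (field_along a i (0, T)) P = germ_sum a (field_along a i (u, v)) P"
        if "P \<in> partitions u t" for P
      proof (intro sum.cong refl)
        fix n assume "n \<in> {..<fst P}"
        then have r: "u \<le> snd P n" "snd P n \<le> v" "0 \<le> snd P n" "snd P n \<le> T"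
          using partition_points[of "fst P" "snd P" u t n] that uv t by auto
        show "germ a (field_along a i (0, T)) (snd P n) (snd P (Suc n)) = germ a (field_along a i (u, v)) (snd P n) (snd P (Suc n))"
          unfolding germ_def field_along_path[OF r(1,2)] field_along_path[OF r(3,4)] field_along_gub[OF r(1,2)] field_along_gub[OF r(3,4)] ..
      qed
      then show "\<forall>\<^sub>F P in mesh_filter u t. germ_sum a (field_along a i (0, T)) P
          = germ_sum a (field_along a i (u, v)) P"
        unfolding eventually_mesh_filter by (intro exI[of _ 1]) simp
    qed
  qed
  then show ?thesis using sol[of t] sol[of u] uv t by (simp add: sum_subtractf)
qed

text \<open>The rough equation for \<open>Y\<close>, the identity \<open>Y' = F(Y) Z'\<close>, the stage equations and the definition of the
  step are four components of one equation.\<close>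

lemma displacement_fixed_point:
  assumes uv: "0 \<le> u" "u < v" "v \<le> T"
  shows "displacement i (u, v) = (\<Sum>a\<in>UNIV. integrate u v a (field_along a i (u, v)))"
proof (rule trajectory_eqI)
  fix t
  show "path (displacement i (u, v)) t = path (\<Sum>a\<in>UNIV. integrate u v a (field_along a i (u, v))) t"
    using solution_increment[OF uv, of t i] by (cases "u \<le> t \<and> t \<le> v") (auto simp: path_sum displacement_sel integrate_sel)
  show "gub (displacement i (u, v)) t = gub (\<Sum>a\<in>UNIV. integrate u v a (field_along a i (u, v))) t"
  proof (cases "u \<le> t \<and> t \<le> v")
    case True
    then have "Y' t = joint_field F (Y t) o\<^sub>L Z' t" using uv by (intro Y'_eq) auto
    then have "blinfun_component i (Y' t) = (\<Sum>a\<in>UNIV. F a (Y t) $ i *\<^sub>R dZ a t)"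
      by (intro blinfun_eqI)
        (simp add: blinfun_component_apply joint_field_apply blinfun.sum_left blinfun.scaleR_left dZ_def inner_axis mult.commute)
    with True show ?thesis by (simp add: gub_sum displacement_sel integrate_sel field_along_path)
  qed (auto simp: gub_sum displacement_sel integrate_sel)
next
  fix j
  show "stg (displacement i (u, v)) j = stg (\<Sum>a\<in>UNIV. integrate u v a (field_along a i (u, v))) j"
  proof (cases j)
    case None
    then show ?thesis by (simp add: stg_sum displacement_sel integrate_sel field_along_stg crk_step_def)
  next
    case (Some j')
    have "k u v j' = Y u + (\<Sum>a\<in>UNIV. \<Sum>j\<in>UNIV. (A u v a $ j' $ j) *\<^sub>R F a (k u v j))"
      using stages[OF uv] unfolding crk_stages_def by blast
    then have "k u v j' $ i = (Y u + (\<Sum>a\<in>UNIV. \<Sum>j\<in>UNIV. (A u v a $ j' $ j) *\<^sub>R F a (k u v j))) $ i"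
      by (rule arg_cong)
    then show ?thesis by (simp add: Some stg_sum displacement_sel integrate_sel field_along_stg)
  qed
qed

theorem one_step_defect:
  "\<exists>C. \<forall>u v i. 0 \<le> u \<longrightarrow> u < v \<longrightarrow> v \<le> T \<longrightarrow>
     \<bar>Y v $ i - crk_step (b u v) F (Y u) (k u v) $ i\<bar> \<le> C * om u v ^ Suc p"
proof -
  obtain c \<rho> where c: "\<And>a i js w. \<bar>c a i js w\<bar> \<le> M" and \<rho>: "\<And>a i. joint.small p (\<rho> a i)"
    and eq: "\<And>a i w. field_along a i w = (\<Sum>n<p. \<Sum>js | length js = n. c a i js w *\<^sub>R (\<Prod>j\<leftarrow>js. displacement j w)) + \<rho> a i w"
    by (rule field_along_taylor) blast
  have "\<exists>C. \<forall>w\<in>intervals. \<forall>i. \<bar>(case w of (u, v) \<Rightarrow> defect v) (displacement i w)\<bar> \<le> C * (case w of (u, v) \<Rightarrow> om u v) ^ Suc p"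
  proof (rule joint.fixed_point_defect[where c = c and \<rho> = \<rho> and B = M])
    show "joint.small 1 (displacement i)" for i by (rule small_displacement)
    show "\<bar>c a i js w\<bar> \<le> M" for a i js w by (rule c)
    show "joint.small p (\<rho> a i)" for a i by (rule \<rho>)
    fix i w assume "w \<in> intervals"
    then obtain u v where w: "w = (u, v)" and uv: "0 \<le> u" "u < v" "v \<le> T" by (auto simp: intervals_def)
    show "displacement i w = (\<Sum>a\<in>UNIV. (case w of (u, v) \<Rightarrow> integrate u v) a
        ((\<Sum>n<p. \<Sum>js | length js = n. c a i js w *\<^sub>R (\<Prod>j\<leftarrow>js. displacement j w)) + \<rho> a i w))"
      unfolding eq[symmetric] using displacement_fixed_point[OF uv] by (simp add: w)
  next
    fix \<tau> :: "'m rtree" and w assume \<tau>: "tree_size \<tau> \<le> p" and "w \<in> intervals"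
    then obtain u v where w: "w = (u, v)" and uv: "0 \<le> u" "u < v" "v \<le> T" by (auto simp: intervals_def)
    have "num_coeff (A u v) (b u v) \<tau> = ctrl_coeff XX Z Z' u v \<tau>"
      using order \<tau> uv unfolding tree_order_def by simp
    then show "(case w of (u, v) \<Rightarrow> defect v) (joint.tree_val w \<tau>) = 0"
      using tree_val_components[OF uv, of \<tau>] uv by (simp add: w defect_def ctrl_coeff_def)
  qed
  then obtain C where C: "\<And>w i. w \<in> intervals \<Longrightarrow>
      \<bar>(case w of (u, v) \<Rightarrow> defect v) (displacement i w)\<bar> \<le> C * (case w of (u, v) \<Rightarrow> om u v) ^ Suc p" by blast
  have "\<bar>Y v $ i - crk_step (b u v) F (Y u) (k u v) $ i\<bar> \<le> C * om u v ^ Suc p"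
    if "0 \<le> u" "u < v" "v \<le> T" for u v i
    using C[of "(u, v)" i] that by (simp add: intervals_def defect_def displacement_sel)
  then show ?thesis by blast
qed

end

section \<open>The local error\<close>

text \<open>An entry is a component of the image of a basis vector, which has max norm one. The supremum in the
  definition is over a bounded set of values, as it must be to be an upper bound.\<close>

lemma abs_entry_le_matrix_infnorm:
  fixes A :: "real^'q^'q"
  shows "\<bar>A $ i $ j\<bar> \<le> matrix_infnorm A"
proof -
  have bdd: "bdd_above ((\<lambda>x. infnorm (A *v x)) ` {x. infnorm x \<le> 1})"
  proof (rule bdd_aboveI2)
    fix x :: "real^'q" assume "x \<in> {x. infnorm x \<le> 1}"
    then have x: "\<bar>x $ j\<bar> \<le> 1" for j using component_le_infnorm_cart[of x j] by simp
    have "infnorm (A *v x) \<le> norm (A *v x)" by (rule infnorm_le_norm)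
    also have "\<dots> \<le> (\<Sum>i\<in>UNIV. \<bar>(A *v x) $ i\<bar>)" by (rule norm_le_l1_cart)
    also have "\<dots> \<le> (\<Sum>i\<in>UNIV. \<Sum>j\<in>UNIV. \<bar>A $ i $ j\<bar> * 1)"
      unfolding matrix_vector_mult_def
      by (intro sum_mono, simp only: vec_lambda_beta) (intro order_trans[OF sum_abs] sum_mono, use x in \<open>simp add: abs_mult mult_left_le\<close>)
    finally show "infnorm (A *v x) \<le> (\<Sum>i\<in>UNIV. \<Sum>j\<in>UNIV. \<bar>A $ i $ j\<bar> * 1)" .
  qed
  have "infnorm (axis j 1 :: real^'q) \<le> norm (axis j 1 :: real^'q)" by (rule infnorm_le_norm)
  then have "axis j 1 \<in> {x :: real^'q. infnorm x \<le> 1}" by simp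
  from cSUP_upper[OF this bdd] have "infnorm (A *v axis j 1) \<le> matrix_infnorm A" by (simp add: matrix_infnorm_def)
  moreover have "(A *v axis j 1) $ i = A $ i $ j" by (simp add: matrix_vector_mult_basis column_def)
  ultimately show ?thesis using component_le_infnorm_cart[of "A *v axis j 1" i] by simp
qed

text \<open>Hoelder estimates for \<open>s < t\<close> extend to \<open>s = t\<close> and to larger constants.\<close>

lemma holder_bound:
  assumes "\<forall>s t. 0 \<le> s \<and> s < t \<and> t \<le> T \<longrightarrow> norm (f s t) \<le> C * (t - s) powr \<gamma>"
    and "\<And>s. 0 \<le> s \<Longrightarrow> s \<le> T \<Longrightarrow> f s s = 0" "0 \<le> s" "s \<le> t" "t \<le> T" "C \<le> D"
  shows "norm (f s t) \<le> D * (t - s) powr \<gamma>"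
proof (cases "s = t")
  case False
  then have "norm (f s t) \<le> C * (t - s) powr \<gamma>" using assms by auto
  also have "\<dots> \<le> D * (t - s) powr \<gamma>" using assms by (intro mult_right_mono) auto
  finally show ?thesis .
qed (use assms in simp)

theorem theorem4p8:
  fixes \<alpha> T C_CRK :: real and p :: nat
    and X :: "real \<Rightarrow> real^'d" and XX :: "real \<Rightarrow> real \<Rightarrow> real^'d^'d"
    and Z :: "real \<Rightarrow> real^'m" and Z' :: "real \<Rightarrow> (real^'d) \<Rightarrow>\<^sub>L (real^'m)"
    and F :: "'m \<Rightarrow> real^'e \<Rightarrow> real^'e" and y\<^sub>0 :: "real^'e"
    and Y :: "real \<Rightarrow> real^'e" and Y' :: "real \<Rightarrow> (real^'d) \<Rightarrow>\<^sub>L (real^'e)"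
    and A :: "real \<Rightarrow> real \<Rightarrow> 'm \<Rightarrow> real^'q^'q" and b :: "real \<Rightarrow> real \<Rightarrow> 'm \<Rightarrow> real^'q"
    and stage :: "real \<Rightarrow> real \<Rightarrow> real^'e \<Rightarrow> 'q \<Rightarrow> real^'e"
  assumes "1 / 3 < \<alpha>" "\<alpha> \<le> 1 / 2" "T > 0"
    and "p \<ge> 1" "(real p + 1) * \<alpha> > 1"
    and "rough_path \<alpha> T X XX"
    and "controlled \<alpha> T X Z Z'"
    and "\<And>a. Cb (p + 1) (F a)"
    and "rde_solution \<alpha> T X XX Z Z' F y\<^sub>0 Y Y'"
    and "C_CRK > 0"
    and "\<And>u v a. 0 \<le> u \<Longrightarrow> u \<le> v \<Longrightarrow> v \<le> T \<Longrightarrow>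
           matrix_infnorm (A u v a) + infnorm (b u v a) \<le> C_CRK * (v - u) powr \<alpha>"
    and "\<And>u v y. 0 \<le> u \<Longrightarrow> u \<le> v \<Longrightarrow> v \<le> T \<Longrightarrow> crk_stages (A u v) F y (stage u v y)"
    and "tree_order p T XX Z Z' A b"
  shows "\<exists>C>0. \<exists>\<delta>>0. \<forall>u v. 0 \<le> u \<and> u \<le> v \<and> v \<le> T \<and> v - u \<le> \<delta> \<longrightarrow>
           norm (Y v - crk_step (b u v) F (Y u) (stage u v (Y u)))
             \<le> C * (v - u) powr ((real p + 1) * \<alpha>)"
proof -
  have sq: "x powr (2 * \<alpha>) = (x powr \<alpha>) ^ 2" for x :: real
    by (simp add: power2_eq_square powr_add[symmetric])
  have sup: "\<exists>D. \<forall>s. 0 \<le> s \<longrightarrow> s \<le> T \<longrightarrow> norm (f s) \<le> D"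
    if f: "\<forall>s t. 0 \<le> s \<and> s < t \<and> t \<le> T \<longrightarrow> norm (f t - f s) \<le> C * (t - s) powr \<alpha>"
    for f :: "real \<Rightarrow> 'z::real_normed_vector" and C
  proof (intro exI allI impI)
    fix s assume s: "0 \<le> s" "s \<le> T"
    have "norm (f s - f 0) \<le> max C 0 * (s - 0) powr \<alpha>"
      by (rule holder_bound[OF f]) (use s in auto)
    also have "\<dots> \<le> max C 0 * T powr \<alpha>" using s assms(1) by (intro mult_left_mono powr_mono2) auto
    finally show "norm (f s) \<le> norm (f 0) + max C 0 * T powr \<alpha>" using norm_triangle_sub[of "f s" "f 0"] by linarith
  qed
  obtain C1 C2 where X1: "\<forall>s t. 0 \<le> s \<and> s < t \<and> t \<le> T \<longrightarrow> norm (X t - X s) \<le> C1 * (t - s) powr \<alpha>"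
    and X2: "\<forall>s t. 0 \<le> s \<and> s < t \<and> t \<le> T \<longrightarrow> norm (XX s t) \<le> C2 * (t - s) powr (2 * \<alpha>)"
    and chen: "\<And>s u t. 0 \<le> s \<Longrightarrow> s \<le> u \<Longrightarrow> u \<le> t \<Longrightarrow> t \<le> T \<Longrightarrow>
        XX s t = XX s u + XX u t + tensor (X u - X s) (X t - X u)"
    using assms(6) unfolding rough_path_def holder_path_def by blast
  obtain C3 C4 C5 where Z1: "\<forall>s t. 0 \<le> s \<and> s < t \<and> t \<le> T \<longrightarrow> norm (Z t - Z s) \<le> C3 * (t - s) powr \<alpha>"
    and Z2: "\<forall>s t. 0 \<le> s \<and> s < t \<and> t \<le> T \<longrightarrow> norm (Z' t - Z' s) \<le> C4 * (t - s) powr \<alpha>"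
    and Z3: "\<forall>s t. 0 \<le> s \<and> s < t \<and> t \<le> T \<longrightarrow>
        norm (Z t - Z s - blinfun_apply (Z' s) (X t - X s)) \<le> C5 * (t - s) powr (2 * \<alpha>)"
    using assms(7) unfolding controlled_def holder_path_def by blast
  have "controlled \<alpha> T X Y Y'" using assms(9) by (simp add: rde_solution_def)
  then obtain B1 B2 B3 where Y1: "\<forall>s t. 0 \<le> s \<and> s < t \<and> t \<le> T \<longrightarrow> norm (Y t - Y s) \<le> B1 * (t - s) powr \<alpha>"
    and Y2: "\<forall>s t. 0 \<le> s \<and> s < t \<and> t \<le> T \<longrightarrow> norm (Y' t - Y' s) \<le> B2 * (t - s) powr \<alpha>"
    and Y3: "\<forall>s t. 0 \<le> s \<and> s < t \<and> t \<le> T \<longrightarrow>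
        norm (Y t - Y s - blinfun_apply (Y' s) (X t - X s)) \<le> B3 * (t - s) powr (2 * \<alpha>)"
    unfolding controlled_def holder_path_def by blast
  obtain C6 where Z4: "\<And>s. 0 \<le> s \<Longrightarrow> s \<le> T \<Longrightarrow> norm (Z' s) \<le> C6" using sup[OF Z2] by blast
  obtain B4 where Y4: "\<And>s. 0 \<le> s \<Longrightarrow> s \<le> T \<Longrightarrow> norm (Y' s) \<le> B4" using sup[OF Y2] by blast
  define L where "L = Max {0, C1, C2, C3, C4, C5, C6, C_CRK}"
  have L: "0 \<le> L" "C1 \<le> L" "C2 \<le> L" "C3 \<le> L" "C4 \<le> L" "C5 \<le> L" "C6 \<le> L" "C_CRK \<le> L" unfolding L_def by (rule Max_ge; simp)+
  define B where "B = Max {0, B1, B2, B3, B4}"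
  have B: "0 \<le> B" "B1 \<le> B" "B2 \<le> B" "B3 \<le> B" "B4 \<le> B" unfolding B_def by (rule Max_ge; simp)+
  have "\<forall>ai. \<exists>M. smooth_bounded (Suc p) M (\<lambda>y. F (fst ai) y $ snd ai)"
    unfolding Suc_eq_plus1 by (intro allI Cb_imp_smooth_bounded assms(8))
  then obtain Mf where Mf: "\<And>ai. smooth_bounded (Suc p) (Mf ai) (\<lambda>y. F (fst ai) y $ snd ai)" by metis
  define M where "M = Max (range Mf)"
  have M: "smooth_bounded (Suc p) M (\<lambda>y. F a y $ i)" for a i
  proof (rule smooth_bounded_weaken)
    show "smooth_bounded (Suc p) (Mf (a, i)) (\<lambda>y. F a y $ i)" using Mf[of "(a, i)"] by simp
    show "Mf (a, i) \<le> M" unfolding M_def by (rule Max_ge) auto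
  qed
  have XX0: "XX s s = 0" if "0 \<le> s" "s \<le> T" for s
  proof -
    have "tensor 0 0 = (0 :: real^'d^'d)" by (simp add: tensor_def vec_eq_iff)
    then show ?thesis using chen[of s s s] that by simp
  qed
  have entries: "\<bar>A u v a $ i $ j\<bar> \<le> L * (v - u) powr \<alpha>" "\<bar>b u v a $ i\<bar> \<le> L * (v - u) powr \<alpha>"
    if uv: "0 \<le> u" "u < v" "v \<le> T" for u v a i j
  proof -
    have "C_CRK * (v - u) powr \<alpha> \<le> L * (v - u) powr \<alpha>" using L by (intro mult_right_mono) auto
    then show "\<bar>A u v a $ i $ j\<bar> \<le> L * (v - u) powr \<alpha>" "\<bar>b u v a $ i\<bar> \<le> L * (v - u) powr \<alpha>"
      using assms(11)[OF uv(1) less_imp_le[OF uv(2)] uv(3), of a] abs_entry_le_matrix_infnorm[of "A u v a" i j] component_le_infnorm_cart[of "b u v a" i]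
        infnorm_pos_le[of "b u v a"] by linarith+
  qed
  have stages: "crk_stages (A u v) F (Y u) (stage u v (Y u))" if "0 \<le> u" "u < v" "v \<le> T" for u v
    using assms(12) that by simp
  have rde: "Y' t = joint_field F (Y t) o\<^sub>L Z' t"
    "has_rough_integral XX (\<lambda>r. joint_field F (Y r))
        (\<lambda>r. Blinfun (frechet_derivative (joint_field F) (at (Y r))) o\<^sub>L Y' r) Z Z' 0 t (Y t - y\<^sub>0)"
    if "0 \<le> t" "t \<le> T" for t
    using assms(9) that by (simp_all add: rde_solution_def)
  have driver: "norm (X t - X s) \<le> L * (t - s) powr \<alpha>" "norm (XX s t) \<le> L * ((t - s) powr \<alpha>)\<^sup>2"
    "\<bar>Z t $ a - Z s $ a\<bar> \<le> L * (t - s) powr \<alpha>"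
    "norm ((blinfun_inner_left (axis a 1) o\<^sub>L Z' t) - (blinfun_inner_left (axis a 1) o\<^sub>L Z' s)) \<le> L * (t - s) powr \<alpha>"
    "\<bar>Z t $ a - Z s $ a - blinfun_apply (blinfun_inner_left (axis a 1) o\<^sub>L Z' s) (X t - X s)\<bar> \<le> L * ((t - s) powr \<alpha>)\<^sup>2"
    if st: "0 \<le> s" "s \<le> t" "t \<le> T" for s t a
  proof -
    show "norm (X t - X s) \<le> L * (t - s) powr \<alpha>"
      by (rule holder_bound[OF X1 _ st L(2)]) simp
    show "norm (XX s t) \<le> L * ((t - s) powr \<alpha>)\<^sup>2"
      unfolding sq[symmetric] by (rule holder_bound[OF X2 XX0 st L(3)])
    have "norm (Z t - Z s) \<le> L * (t - s) powr \<alpha>"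
      by (rule holder_bound[OF Z1 _ st L(4)]) simp
    then show "\<bar>Z t $ a - Z s $ a\<bar> \<le> L * (t - s) powr \<alpha>"
      using component_le_norm_cart[of "Z t - Z s" a] by simp
    have "norm (Z' t - Z' s) \<le> L * (t - s) powr \<alpha>"
      by (rule holder_bound[OF Z2 _ st L(5)]) simp
    then show "norm ((blinfun_inner_left (axis a 1) o\<^sub>L Z' t) - (blinfun_inner_left (axis a 1) o\<^sub>L Z' s)) \<le> L * (t - s) powr \<alpha>"
      using norm_blinfun_component[of a "Z' t - Z' s", unfolded blinfun_component_diff, unfolded blinfun_component_def]
      by linarith
    have "norm (Z t - Z s - blinfun_apply (Z' s) (X t - X s)) \<le> L * ((t - s) powr \<alpha>)\<^sup>2"
      unfolding sq[symmetric] by (rule holder_bound[OF Z3 _ st L(6)]) simp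
    then show "\<bar>Z t $ a - Z s $ a - blinfun_apply (blinfun_inner_left (axis a 1) o\<^sub>L Z' s) (X t - X s)\<bar> \<le> L * ((t - s) powr \<alpha>)\<^sup>2"
      using component_le_norm_cart[of "Z t - Z s - blinfun_apply (Z' s) (X t - X s)" a] by (simp add: inner_axis)
  qed
  have driver_deriv: "norm (blinfun_inner_left (axis a 1) o\<^sub>L Z' s) \<le> L" if "0 \<le> s" "s \<le> T" for s a
    using norm_blinfun_component[of a "Z' s"] Z4[OF that] L(7) unfolding blinfun_component_def by linarith
  have solution: "norm (Y t - Y s) \<le> B * (t - s) powr \<alpha>" "norm (Y' t - Y' s) \<le> B * (t - s) powr \<alpha>"
    "norm (Y t - Y s - blinfun_apply (Y' s) (X t - X s)) \<le> B * ((t - s) powr \<alpha>)\<^sup>2"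
    if st: "0 \<le> s" "s \<le> t" "t \<le> T" for s t
  proof -
    show "norm (Y t - Y s) \<le> B * (t - s) powr \<alpha>" by (rule holder_bound[OF Y1 _ st B(2)]) simp
    show "norm (Y' t - Y' s) \<le> B * (t - s) powr \<alpha>" by (rule holder_bound[OF Y2 _ st B(3)]) simp
    show "norm (Y t - Y s - blinfun_apply (Y' s) (X t - X s)) \<le> B * ((t - s) powr \<alpha>)\<^sup>2"
      unfolding sq[symmetric] by (rule holder_bound[OF Y3 _ st B(4)]) simp
  qed
  have solution_deriv: "norm (Y' s) \<le> B" if "0 \<le> s" "s \<le> T" for s
    using Y4[OF that] B(5) by linarith
  have F_diff: "F a differentiable (at y)" for a y using assms(8)[of a] by simp
  interpret rde_and_method \<alpha> T L X XX Z Z' A b "\<lambda>s t. (t - s) powr \<alpha>" "\<lambda>a r. blinfun_inner_left (axis a 1) o\<^sub>L Z' r"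
    F Y Y' "\<lambda>u v. stage u v (Y u)" y\<^sub>0 p M B
    by unfold_locales
      (fact assms L B chen M F_diff entries stages driver driver_deriv solution solution_deriv rde)+
  obtain C where C: "\<And>u v i. 0 \<le> u \<Longrightarrow> u < v \<Longrightarrow> v \<le> T \<Longrightarrow>
      \<bar>Y v $ i - crk_step (b u v) F (Y u) (stage u v (Y u)) $ i\<bar> \<le> C * ((v - u) powr \<alpha>) ^ Suc p"
    using one_step_defect by blast
  define D where "D = real CARD('e) * max C 0 + 1"
  have "D > 0" by (simp add: D_def add_nonneg_pos)
  moreover have "norm (Y v - crk_step (b u v) F (Y u) (stage u v (Y u))) \<le> D * (v - u) powr ((real p + 1) * \<alpha>)"
    if uv: "0 \<le> u" "u \<le> v" "v \<le> T" for u v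
  proof (cases "u = v")
    case True
    \<comment> \<open>On an interval of length zero the bound on the coefficients is \<open>0 powr \<alpha> = 0\<close>, so the step does nothing.\<close>
    have "b u v a $ i = 0" for a i
    proof -
      have "matrix_infnorm (A u v a) + infnorm (b u v a) \<le> 0" using assms(11)[OF uv, of a] True by simp
      then have "infnorm (b u v a) \<le> 0" using abs_entry_le_matrix_infnorm[of "A u v a" undefined undefined] by linarith
      then show ?thesis using component_le_infnorm_cart[of "b u v a" i] by linarith
    qed
    then show ?thesis using True by (simp add: crk_step_def)
  next
    case False
    then have lt: "u < v" using uv by simp
    have pw: "((v - u) powr \<alpha>) ^ Suc p = (v - u) powr ((real p + 1) * \<alpha>)"
      using lt by (simp add: powr_realpow[symmetric] powr_powr algebra_simps del: power_Suc)
    let ?e = "Y v - crk_step (b u v) F (Y u) (stage u v (Y u))"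
    have "norm ?e \<le> (\<Sum>i\<in>UNIV. \<bar>?e $ i\<bar>)" by (rule norm_le_l1_cart)
    also have "\<dots> \<le> (\<Sum>i::'e\<in>UNIV. max C 0 * (v - u) powr ((real p + 1) * \<alpha>))"
    proof (rule sum_mono)
      fix i
      have "\<bar>?e $ i\<bar> \<le> C * (v - u) powr ((real p + 1) * \<alpha>)" using C[OF uv(1) lt uv(3), of i] unfolding pw by simp
      also have "\<dots> \<le> max C 0 * (v - u) powr ((real p + 1) * \<alpha>)" by (rule mult_right_mono) auto
      finally show "\<bar>?e $ i\<bar> \<le> max C 0 * (v - u) powr ((real p + 1) * \<alpha>)" .
    qed
    also have "\<dots> \<le> D * (v - u) powr ((real p + 1) * \<alpha>)" by (simp add: D_def distrib_right)
    finally show ?thesis .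
  qed
  \<comment> \<open>The estimate holds on all intervals in \<open>[0,T]\<close>, so any \<open>\<delta>\<close> serves.\<close>
  ultimately show ?thesis by (intro exI[of _ D] conjI exI[of _ 1]) auto
qed

end
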